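(* Let $\mathcal N^n\hookrightarrow\mathbb R^d$ be a $C^2$-Riemannian manifold (an $n$-dimensional submanifold of $\mathbb R^d$ with the induced metric), let $u\in W^{1,2}(B_1^m,\mathcal N)$, and let $\omega$ be the $\mathfrak{so}(d)$-valued one-form on $B_1^m$ given by $$\omega^i_j=-\big(\mathrm A^i_{jk}(u)-\mathrm A^j_{ik}(u)\big)\,\mathrm du^k ,$$ where $\mathrm A$ is the (extended) second fundamental form of $\mathcal N$. Let $\mathrm T(x)$ and $\mathcal V(x)$ denote the orthogonal projections of $\mathbb R^d$ onto $\mathrm T_{u(x)}\mathcal N$ and onto its orthogonal complement, respectively, and let $\mathcal R=\mathrm T-\mathcal V$. For a $d\times d$ matrix-valued function $E$ on $B_1^m$ (a section of $u^*\mathrm{End}(\mathrm T\mathbb R^d)$) set $\nabla^\omega E=\mathrm dE+[\omega,E]$. Then $$\nabla^\omega\mathrm T=0,\qquad \nabla^\omega\mathcal V=0,\qquad \nabla^\omega\mathcal R=0 .$$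
   Context: $B_1^m\subset\mathbb R^m$ is the open unit ball. $W^{1,2}(B_1^m,\mathcal N):=\{v\in W^{1,2}(B_1^m,\mathbb R^d): v(x)\in\mathcal N \text{ for a.e. } x\in B_1^m\}$. $[\omega,E]=\omega E-E\omega$ is the matrix commutator. $\nabla^\omega$ is the connection on endomorphisms induced by the connection $\mathrm d+\omega$ on $u^*(\mathrm T\mathbb R^d)=B_1^m\times\mathbb R^d$. The second fundamental form is $\mathrm A(X,Y)=(D_XY)^\perp$ for tangent fields $X,Y$ ($D$ the Euclidean derivative, $\perp$ the normal part), extended to all vectors of $\mathbb R^d$ at points of $\mathcal N$ by $\mathrm A(X,Y):=\mathrm A(X^\top,Y^\top)$, where $\top$ is the tangential part. In the standard coordinates $z$ of $\mathbb R^d$, $\mathrm A=\mathrm A^i_{jk}\,\mathrm dz^j\otimes \mathrm dz^k\otimes\partial_{z^i}$; repeated indices are summed. Equivalently, for $v\in\mathbb R^d$, $\omega v=-\mathrm A(v,\mathrm du)+\langle \mathrm A(\mathrm du,\cdot)^\sharp,v\rangle$.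
   Formalization: The equations are proved for every weak derivative dE of E = T, V, R; that dE exists is proved only if u lies a.e. in a closed set K contained in N with K compact or ω locally integrable, since for arbitrary (e.g. non-closed) N the projection T may jump and have no weak derivative. *)

theory Defs
  imports "HOL-Analysis.Analysis"
begin

section \<open>Functions of class \<open>C\<^sup>1\<close>, \<open>C\<^sup>2\<close> and submanifolds\<close>

definition C1_on :: "'a::real_normed_vector set \<Rightarrow> ('a \<Rightarrow> 'b::real_normed_vector) \<Rightarrow> bool" where
  "C1_on U f \<longleftrightarrow>
     (\<exists>f' :: 'a \<Rightarrow> 'a \<Rightarrow>\<^sub>L 'b.
        (\<forall>x\<in>U. (f has_derivative blinfun_apply (f' x)) (at x)) \<and> continuous_on U f')"

definition C2_on :: "'a::real_normed_vector set \<Rightarrow> ('a \<Rightarrow> 'b::real_normed_vector) \<Rightarrow> bool" where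
  "C2_on U f \<longleftrightarrow>
     (\<exists>f' :: 'a \<Rightarrow> 'a \<Rightarrow>\<^sub>L 'b.
        (\<forall>x\<in>U. (f has_derivative blinfun_apply (f' x)) (at x)) \<and> C1_on U f')"

text \<open>
  Embedded submanifolds without boundary, described by local \<open>C\<^sup>2\<close> diffeomorphisms that flatten
  \<open>N\<close> to an \<open>n\<close>-dimensional linear subspace.  Neither closedness nor compactness is required.
\<close>

definition C2_submanifold :: "nat \<Rightarrow> 'a::euclidean_space set \<Rightarrow> bool" where
  "C2_submanifold n N \<longleftrightarrow>
     (\<forall>p\<in>N. \<exists>U V L (\<Phi> :: 'a \<Rightarrow> 'a) \<Psi>.
        open U \<and> p \<in> U \<and> open V \<and> subspace L \<and> dim L = n \<and>
        homeomorphism U V \<Phi> \<Psi> \<and> C2_on U \<Phi> \<and> C2_on V \<Psi> \<and>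
        \<Phi> ` (U \<inter> N) = V \<inter> L)"

definition tangent_space :: "'a::euclidean_space set \<Rightarrow> 'a \<Rightarrow> 'a set" where
  "tangent_space N p =
     {v. \<exists>\<gamma> \<epsilon>. 0 < \<epsilon> \<and> \<gamma> C1_differentiable_on {-\<epsilon><..<\<epsilon>} \<and> \<gamma> ` {-\<epsilon><..<\<epsilon>} \<subseteq> N \<and>
             \<gamma> 0 = p \<and> (\<gamma> has_vector_derivative v) (at 0)}"

definition orth_proj :: "'a::euclidean_space set \<Rightarrow> 'a \<Rightarrow> 'a" where
  "orth_proj S v = (THE w. w \<in> S \<and> v - w \<in> S\<^sup>\<bottom>)"

definition tangential :: "'a::euclidean_space set \<Rightarrow> 'a \<Rightarrow> 'a \<Rightarrow> 'a" where
  "tangential N p = orth_proj (tangent_space N p)"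

definition normal_part :: "'a::euclidean_space set \<Rightarrow> 'a \<Rightarrow> 'a \<Rightarrow> 'a" where
  "normal_part N p = orth_proj ((tangent_space N p)\<^sup>\<bottom>)"

section \<open>The extended second fundamental form\<close>

text \<open>
  A tangent field near \<open>p\<close> is represented by a \<open>C\<^sup>1\<close> map \<open>Z\<close> on a neighbourhood of \<open>p\<close> in the
  ambient space whose values at points of \<open>N\<close> are tangent (\<open>C\<^sup>1\<close> is the natural regularity of
  tangent fields on a \<open>C\<^sup>2\<close> submanifold).  The normal part of the Euclidean derivative of \<open>Z\<close> in
  a tangent direction depends only on \<open>Z p\<close>, so the description below determines the
  value at every \<open>p \<in> N\<close>.  Arbitrary vectors \<open>X\<close>, \<open>Y\<close> enter through their tangential parts.
\<close>

definition second_ff :: "'a::euclidean_space set \<Rightarrow> 'a \<Rightarrow> 'a \<Rightarrow> 'a \<Rightarrow> 'a" where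
  "second_ff N p X Y =
     (THE a. \<exists>U Z. open U \<and> p \<in> U \<and> C1_on U Z \<and> (\<forall>q \<in> U \<inter> N. Z q \<in> tangent_space N q) \<and>
               Z p = tangential N p Y \<and>
               a = normal_part N p (frechet_derivative Z (at p) (tangential N p X)))"

text \<open>\<open>A_coeff N p i j k\<close> is $A^i_{jk}(p)$, i.e. $A = A^i_{jk}\,dz^j\otimes dz^k\otimes\partial_{z^i}$.\<close>

definition A_coeff :: "(real ^ 'd) set \<Rightarrow> real ^ 'd \<Rightarrow> 'd \<Rightarrow> 'd \<Rightarrow> 'd \<Rightarrow> real" where
  "A_coeff N p i j k = second_ff N p (axis j 1) (axis k 1) $ i"

section \<open>Weak derivatives and Sobolev maps\<close>

text \<open>
  A one-form \<open>\<eta>\<close> on a subset of \<open>real ^ 'm\<close> is given by its coefficients: \<open>\<eta> x a\<close> is the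
  coefficient of \<open>dx\<^sup>a\<close> at \<open>x\<close>, i.e. the value of \<open>\<eta>\<close> on the coordinate vector \<open>\<partial>\<^sub>a\<close>.
\<close>

type_synonym ('m, 'b) oneform = "real ^ 'm \<Rightarrow> 'm \<Rightarrow> 'b"

definition loc_integrable_on :: "('a::euclidean_space \<Rightarrow> 'b::euclidean_space) \<Rightarrow> 'a set \<Rightarrow> bool" where
  "loc_integrable_on f S \<longleftrightarrow> (\<forall>K. compact K \<and> K \<subseteq> S \<longrightarrow> f absolutely_integrable_on K)"

text \<open>
  As the derivatives have order one, compactly supported test functions of class \<open>C\<^sup>1\<close> are used
  (Gilbarg--Trudinger, Section 7.3).
\<close>

definition test_fun :: "'a::euclidean_space set \<Rightarrow> ('a \<Rightarrow> real) \<Rightarrow> bool" where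
  "test_fun S \<phi> \<longleftrightarrow> C1_on UNIV \<phi> \<and> (\<exists>K. compact K \<and> K \<subseteq> S \<and> (\<forall>x. x \<notin> K \<longrightarrow> \<phi> x = 0))"

definition has_weak_deriv ::
    "(real ^ 'm) set \<Rightarrow> (real ^ 'm \<Rightarrow> 'b::euclidean_space) \<Rightarrow> ('m, 'b) oneform \<Rightarrow> bool" where
  "has_weak_deriv S f df \<longleftrightarrow>
     loc_integrable_on f S \<and>
     (\<forall>a. loc_integrable_on (\<lambda>x. df x a) S \<and>
          (\<forall>\<phi>. test_fun S \<phi> \<longrightarrow>
             (LINT x:S|lebesgue. frechet_derivative \<phi> (at x) (axis a 1) *\<^sub>R f x) =
             - (LINT x:S|lebesgue. \<phi> x *\<^sub>R df x a)))"

definition weakly_differentiable_on ::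
    "(real ^ 'm \<Rightarrow> 'b::euclidean_space) \<Rightarrow> (real ^ 'm) set \<Rightarrow> bool" where
  "weakly_differentiable_on f S \<longleftrightarrow> (\<exists>df. has_weak_deriv S f df)"

text \<open>Measurability on \<open>S\<close> is part of local integrability, hence of \<open>has_weak_deriv\<close>.\<close>

definition W12 :: "(real ^ 'm) set \<Rightarrow> (real ^ 'm \<Rightarrow> 'b::euclidean_space) set" where
  "W12 S =
     {v. (\<lambda>x. (norm (v x))\<^sup>2) absolutely_integrable_on S \<and>
         (\<exists>dv. has_weak_deriv S v dv \<and>
               (\<forall>a. (\<lambda>x. (norm (dv x a))\<^sup>2) absolutely_integrable_on S))}"

definition W12_into ::
    "(real ^ 'm) set \<Rightarrow> 'b::euclidean_space set \<Rightarrow> (real ^ 'm \<Rightarrow> 'b) set" where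
  "W12_into S N = {v \<in> W12 S. AE x\<in>S in lebesgue. v x \<in> N}"

section \<open>The connection form and the induced connection on endomorphisms\<close>

definition conn_form ::
    "(real ^ 'd) set \<Rightarrow> (real ^ 'm \<Rightarrow> real ^ 'd) \<Rightarrow> ('m, real ^ 'd) oneform \<Rightarrow>
     ('m, real ^ 'd ^ 'd) oneform" where
  "conn_form N u du x a =
     (\<chi> i j. - (\<Sum>k\<in>UNIV. (A_coeff N (u x) i j k - A_coeff N (u x) j i k) * du x a $ k))"

definition commutator :: "real ^ 'd ^ 'd \<Rightarrow> real ^ 'd ^ 'd \<Rightarrow> real ^ 'd ^ 'd" where
  "commutator W E = W ** E - E ** W"

text \<open>\<open>dE\<close> is meant to be the weak derivative of \<open>E\<close>.\<close>

definition nabla_End ::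
    "('m, real ^ 'd ^ 'd) oneform \<Rightarrow> (real ^ 'm \<Rightarrow> real ^ 'd ^ 'd) \<Rightarrow>
     ('m, real ^ 'd ^ 'd) oneform \<Rightarrow> ('m, real ^ 'd ^ 'd) oneform" where
  "nabla_End \<omega> E dE x a = dE x a + commutator (\<omega> x a) (E x)"

definition T_proj :: "(real ^ 'd) set \<Rightarrow> (real ^ 'm \<Rightarrow> real ^ 'd) \<Rightarrow> real ^ 'm \<Rightarrow> real ^ 'd ^ 'd" where
  "T_proj N u x = matrix (tangential N (u x))"

definition V_proj :: "(real ^ 'd) set \<Rightarrow> (real ^ 'm \<Rightarrow> real ^ 'd) \<Rightarrow> real ^ 'm \<Rightarrow> real ^ 'd ^ 'd" where
  "V_proj N u x = matrix (normal_part N (u x))"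

definition R_refl :: "(real ^ 'd) set \<Rightarrow> (real ^ 'm \<Rightarrow> real ^ 'd) \<Rightarrow> real ^ 'm \<Rightarrow> real ^ 'd ^ 'd" where
  "R_refl N u x = T_proj N u x - V_proj N u x"

end

theory Submission
  imports Defs
begin

text \<open>
  Locally \<open>N = {G = 0}\<close> for a \<open>C\<^sup>2\<close> map \<open>G\<close> whose derivative \<open>C\<close> has constant range, and
  \<open>T\<^sub>qN = ker C(q)\<close>.  Hence the tangential projection \<open>P\<close> is the restriction to \<open>N\<close> of a \<open>C\<^sup>1\<close> map \<open>F\<close>.
  Differentiating \<open>C Z = 0\<close> for tangent fields \<open>Z\<close> gives \<open>C (A(X,Y)) = - D\<^sup>2G (X, Y)\<close>, so \<open>A\<close> is
  well defined, bilinear and symmetric.  With \<open>Z = F Y\<close> this yields \<open>A(X,Y) = (1 - P) D Y\<close> for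
  \<open>D = DF(X)\<close>, so the connection form at \<open>du = X\<close> is \<open>P D - D P\<close>; since \<open>P D + D P = D\<close> its
  commutator with \<open>P\<close> is \<open>- D\<close>.

  For a Sobolev map \<open>u\<close>, the chain rule gives the weak derivative \<open>DF(u) du\<close> of \<open>F(u)\<close>.  Weak
  derivatives of two functions agree almost everywhere where the functions agree, so countably
  many local extensions \<open>F\<close> suffice, and \<open>G(u) = 0\<close> shows that \<open>du\<close> is tangent to \<open>N\<close>.
\<close>

section \<open>Calculus of class \<open>C\<^sup>1\<close>\<close>

text \<open>The obstacle is that \<open>N\<close> need not be compact and A may be unbounded along
  \<open>u\<close>. Since \<omega> = P D - D P with P bounded, a weak derivative D of P(u) can exist
  only where \<omega> is locally integrable. The identity is therefore proved for every weak
  derivative that P(u) may have, by comparison with local extensions F, and existence is a separate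
  claim. If \<open>u\<close> stays in a compact subset of \<open>N\<close>, one global extension F
  settles it; if \<omega> is locally integrable, cutoffs in the target give approximations whose
  derivatives are bounded by |\<omega>| and |du| alone, independently of the extensions. F is a
  projection only at points of \<open>N\<close>, so its algebraic identities can be differentiated
  only in tangent directions. This is why the tangency of \<open>du\<close> comes before the
  identity for Sobolev maps.\<close>

lemma C1_onI:
  fixes f :: "'a::euclidean_space \<Rightarrow> 'b::real_normed_vector"
  assumes "\<And>x. x \<in> U \<Longrightarrow> (f has_derivative D x) (at x)"
    and "\<And>v. continuous_on U (\<lambda>x. D x v)"
  shows "C1_on U f"
  unfolding C1_on_def
proof (intro exI conjI ballI)
  have D: "blinfun_apply (Blinfun (D x)) = D x" if "x \<in> U" for x
    using assms(1)[OF that] by (simp add: bounded_linear_Blinfun_apply has_derivative_bounded_linear)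
  show "(f has_derivative blinfun_apply (Blinfun (D x))) (at x)" if "x \<in> U" for x
    using D assms(1) that by simp
  \<comment> \<open>In finite dimension, continuity of each directional derivative is continuity in
    operator norm, so regularity can be read off from pointwise formulas.\<close>
  show "continuous_on U (\<lambda>x. Blinfun (D x))"
    using D assms(2) by (intro continuous_on_blinfun_componentwise) (simp cong: continuous_on_cong)
qed

lemma C1_on_subset: "C1_on U f \<Longrightarrow> V \<subseteq> U \<Longrightarrow> C1_on V f"
  unfolding C1_on_def by (meson continuous_on_subset subsetD)

lemma C1_on_imp_continuous_on: "C1_on U f \<Longrightarrow> continuous_on U f"
  unfolding C1_on_def
  by (meson continuous_at_imp_continuous_on has_derivative_continuous)

lemma C1_on_frechet:
  assumes "C1_on U f"
  shows "\<And>x. x \<in> U \<Longrightarrow> (f has_derivative frechet_derivative f (at x)) (at x)"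
    and "\<And>v. continuous_on U (\<lambda>x. frechet_derivative f (at x) v)"
proof -
  obtain f' where f': "\<And>x. x \<in> U \<Longrightarrow> (f has_derivative blinfun_apply (f' x)) (at x)"
    "continuous_on U f'"
    using assms unfolding C1_on_def by blast
  show "(f has_derivative frechet_derivative f (at x)) (at x)" if "x \<in> U" for x
    using f' that differentiableI frechet_derivative_works by blast
  have "frechet_derivative f (at x) = blinfun_apply (f' x)" if "x \<in> U" for x
    using f' that frechet_derivative_at by metis
  then show "continuous_on U (\<lambda>x. frechet_derivative f (at x) v)" for v
    using f'(2) by (simp cong: continuous_on_cong) (intro continuous_intros)
qed

lemma C1_on_const: "C1_on U (\<lambda>x. c)"
  unfolding C1_on_def by (rule exI[of _ "\<lambda>_. 0"]) (auto simp: blinfun.zero_left zero_blinfun.rep_eq)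

lemma C1_on_id: "C1_on U (\<lambda>x. x)"
  unfolding C1_on_def by (rule exI[of _ "\<lambda>_. id_blinfun"]) (auto simp: id_blinfun.rep_eq)

lemma C1_on_cong:
  assumes "open U" "\<And>x. x \<in> U \<Longrightarrow> f x = g x"
  shows "C1_on U f \<longleftrightarrow> C1_on U g"
proof -
  have "(f has_derivative D) (at x) \<longleftrightarrow> (g has_derivative D) (at x)" if "x \<in> U" for x D
    using has_derivative_transform_within_open[OF _ assms(1) that, of f D UNIV g]
          has_derivative_transform_within_open[OF _ assms(1) that, of g D UNIV f] assms(2) by auto
  then show ?thesis unfolding C1_on_def by auto
qed

text \<open>The two derivatives agree on the overlap by uniqueness, so they glue. This is how a
  function cut off inside an open set is extended by zero.\<close>

lemma C1_on_Un:
  assumes "open U" "open V" "C1_on U f" "C1_on V f"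
  shows "C1_on (U \<union> V) f"
proof -
  obtain f' where f': "\<And>x. x \<in> U \<Longrightarrow> (f has_derivative blinfun_apply (f' x)) (at x)"
    "continuous_on U f'"
    using assms unfolding C1_on_def by blast
  obtain g' where g': "\<And>x. x \<in> V \<Longrightarrow> (f has_derivative blinfun_apply (g' x)) (at x)"
    "continuous_on V g'"
    using assms unfolding C1_on_def by blast
  define h where "h x = (if x \<in> U then f' x else g' x)" for x
  have eq: "h x = g' x" if "x \<in> V" for x
    using that f'(1)[of x] g'(1)[of x] unfolding h_def
    by (auto intro!: blinfun_eqI dest: has_derivative_unique)
  have "continuous_on U h" using f'(2) by (simp add: h_def cong: continuous_on_cong)
  moreover have "continuous_on V h" using g'(2) eq by (simp cong: continuous_on_cong)
  ultimately have "continuous_on (U \<union> V) h" using assms(1,2) by (simp add: continuous_on_open_Un)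
  then show ?thesis unfolding C1_on_def using f'(1) g'(1) eq
    by (intro exI[of _ h]) (auto simp: h_def)
qed

lemma C1_on_compose:
  assumes "C1_on U f" "C1_on V g" "f ` U \<subseteq> V"
  shows "C1_on U (\<lambda>x. g (f x))"
proof -
  obtain f' where f': "\<And>x. x \<in> U \<Longrightarrow> (f has_derivative blinfun_apply (f' x)) (at x)"
    "continuous_on U f'"
    using assms unfolding C1_on_def by blast
  obtain g' where g': "\<And>x. x \<in> V \<Longrightarrow> (g has_derivative blinfun_apply (g' x)) (at x)"
    "continuous_on V g'"
    using assms unfolding C1_on_def by blast
  show ?thesis unfolding C1_on_def
  proof (intro exI conjI ballI)
    show "((\<lambda>x. g (f x)) has_derivative blinfun_apply (g' (f x) o\<^sub>L f' x)) (at x)" if "x \<in> U" for x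
      using has_derivative_compose[OF f'(1)[OF that], of g "blinfun_apply (g' (f x))"]
        g'(1)[of "f x"] assms(3) that by (auto simp: blinfun_compose.rep_eq o_def)
    show "continuous_on U (\<lambda>x. g' (f x) o\<^sub>L f' x)"
      using f'(2) continuous_on_compose2[OF g'(2) C1_on_imp_continuous_on[OF assms(1)] assms(3)]
      by (intro continuous_intros) auto
  qed
qed

lemma C1_on_bounded_linear:
  assumes "bounded_linear L" "C1_on U f"
  shows "C1_on U (\<lambda>x. L (f x))"
proof -
  have "C1_on UNIV L" unfolding C1_on_def
    using bounded_linear_imp_has_derivative[OF assms(1)] bounded_linear_Blinfun_apply[OF assms(1)]
    by (intro exI[of _ "\<lambda>_. Blinfun L"]) auto
  then show ?thesis using C1_on_compose[OF assms(2)] by blast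
qed

lemma C1_on_bounded_bilinear:
  fixes f :: "'a::euclidean_space \<Rightarrow> _"
  assumes "bounded_bilinear B" "C1_on U f" "C1_on U g"
  shows "C1_on U (\<lambda>x. B (f x) (g x))"
proof (rule C1_onI)
  show "((\<lambda>x. B (f x) (g x)) has_derivative
      (\<lambda>v. B (f x) (frechet_derivative g (at x) v) + B (frechet_derivative f (at x) v) (g x))) (at x)"
    if "x \<in> U" for x
    by (rule bounded_bilinear.FDERIV[OF assms(1)]) (rule C1_on_frechet(1)[OF _ that], rule assms)+
  show "continuous_on U (\<lambda>x. B (f x) (frechet_derivative g (at x) v)
      + B (frechet_derivative f (at x) v) (g x))" for v
    by (intro continuous_on_add bounded_bilinear.continuous_on[OF assms(1)]
        C1_on_frechet(2) C1_on_imp_continuous_on assms)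
qed

lemmas C1_on_mult = C1_on_bounded_bilinear[OF bounded_bilinear_mult]
  and C1_on_scaleR = C1_on_bounded_bilinear[OF bounded_bilinear_scaleR]
  and C1_on_inner = C1_on_bounded_bilinear[OF bounded_bilinear_inner]

lemma C1_on_add:
  fixes f :: "'a::euclidean_space \<Rightarrow> _"
  assumes "C1_on U f" "C1_on U g"
  shows "C1_on U (\<lambda>x. f x + g x)"
  by (rule C1_onI[where D = "\<lambda>x v. frechet_derivative f (at x) v + frechet_derivative g (at x) v"])
     (auto intro!: has_derivative_add continuous_on_add C1_on_frechet assms)

lemma C1_on_diff:
  fixes f :: "'a::euclidean_space \<Rightarrow> _"
  assumes "C1_on U f" "C1_on U g"
  shows "C1_on U (\<lambda>x. f x - g x)"
  by (rule C1_onI[where D = "\<lambda>x v. frechet_derivative f (at x) v - frechet_derivative g (at x) v"])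
     (auto intro!: has_derivative_diff continuous_on_diff C1_on_frechet assms)

lemma C1_on_sum:
  fixes f :: "'i \<Rightarrow> 'a::euclidean_space \<Rightarrow> _"
  assumes "\<And>i. i \<in> I \<Longrightarrow> C1_on U (f i)"
  shows "C1_on U (\<lambda>x. \<Sum>i\<in>I. f i x)"
  using assms by (induction I rule: infinite_finite_induct) (auto intro: C1_on_const C1_on_add)

lemma C1_on_prod:
  fixes f :: "'i \<Rightarrow> 'a::euclidean_space \<Rightarrow> real"
  assumes "\<And>i. i \<in> I \<Longrightarrow> C1_on U (f i)"
  shows "C1_on U (\<lambda>x. \<Prod>i\<in>I. f i x)"
  using assms by (induction I rule: infinite_finite_induct) (auto intro: C1_on_const C1_on_mult)

lemma C1_on_inverse:
  fixes f :: "'a::euclidean_space \<Rightarrow> real"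
  assumes "C1_on U f" "\<And>x. x \<in> U \<Longrightarrow> f x \<noteq> 0"
  shows "C1_on U (\<lambda>x. inverse (f x))"
proof -
  have "C1_on {t. t \<noteq> 0} (inverse :: real \<Rightarrow> real)"
  proof (rule C1_onI)
    show "(inverse has_derivative (\<lambda>v. - (inverse t * v * inverse t))) (at t)"
      if "t \<in> {t. t \<noteq> 0}" for t :: real
      using that by (intro has_derivative_inverse') simp
    show "continuous_on {t. t \<noteq> 0} (\<lambda>t::real. - (inverse t * v * inverse t))" for v
      by (intro continuous_intros) auto
  qed
  then show ?thesis by (rule C1_on_compose[OF assms(1)]) (use assms(2) in auto)
qed

lemma C1_on_vec_lambda:
  fixes f :: "'i::finite \<Rightarrow> 'a::euclidean_space \<Rightarrow> 'b::euclidean_space"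
  assumes "\<And>i. C1_on U (f i)"
  shows "C1_on U (\<lambda>x. \<chi> i. f i x)"
proof -
  have "bounded_linear (\<lambda>y::'b. axis i y :: 'b^'i)" for i
    by (intro linear_conv_bounded_linear[THEN iffD1] linearI)
       (auto simp: axis_def vec_eq_iff)
  then have "C1_on U (\<lambda>x. \<Sum>i\<in>UNIV. axis i (f i x) :: 'b^'i)"
    by (intro C1_on_sum C1_on_bounded_linear[of "axis _"] assms) auto
  moreover have "(\<Sum>i\<in>UNIV. axis i (f i x) :: 'b^'i) = (\<chi> i. f i x)" for x
    by (simp add: vec_eq_iff axis_def sum.delta)
  ultimately show ?thesis by simp
qed

lemma C1_on_vec_nth:
  "C1_on U f \<Longrightarrow> C1_on U (\<lambda>x. f x $ i)"
  by (rule C1_on_bounded_linear[OF bounded_linear_vec_nth])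

lemma C1_on_det:
  fixes M :: "'a::euclidean_space \<Rightarrow> real^'n^'n"
  assumes "C1_on U M"
  shows "C1_on U (\<lambda>x. det (M x))"
  unfolding det_def
  by (intro C1_on_sum C1_on_mult C1_on_const C1_on_prod C1_on_vec_nth assms)

text \<open>By Cramer's rule this vector solves \<open>M x *v y = b x\<close>; as a quotient of
  determinants its dependence on \<open>x\<close> is visibly of class C^1.\<close>

lemma C1_on_solve:
  fixes M :: "'a::euclidean_space \<Rightarrow> real^'n^'n"
  assumes "C1_on U M" "C1_on U b" "\<And>x. x \<in> U \<Longrightarrow> det (M x) \<noteq> 0"
  shows "C1_on U (\<lambda>x. \<chi> k. det (\<chi> i j. if j = k then b x $ i else M x $ i $ j) / det (M x))"
  unfolding divide_inverse
proof (intro C1_on_vec_lambda C1_on_mult C1_on_inverse C1_on_det assms)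
  show "C1_on U (\<lambda>x. if j = k then b x $ i else M x $ i $ j)" for i j k
    using assms by (cases "j = k") (auto intro!: C1_on_vec_nth)
qed

section \<open>Bump functions and cutoffs of class C^1\<close>

lemma has_derivative_sq_pos_part:
  "((\<lambda>t::real. (max 0 t)\<^sup>2) has_derivative (\<lambda>v. 2 * max 0 x * v)) (at x)"
proof -
  consider "x < 0" | "x > 0" | "x = 0" by linarith
  then show ?thesis
  proof cases
    case 1
    have "((\<lambda>t. 0::real) has_derivative (\<lambda>v. 2 * max 0 x * v)) (at x)" using 1 by simp
    then show ?thesis
      by (rule has_derivative_transform_within_open[of _ _ _ _ "{..<0}"]) (use 1 in auto)
  next
    case 2
    have "((\<lambda>t::real. t\<^sup>2) has_derivative (\<lambda>v. 2 * max 0 x * v)) (at x)"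
      using 2 by (auto intro!: derivative_eq_intros)
    then show ?thesis
      by (rule has_derivative_transform_within_open[of _ _ _ _ "{0<..}"]) (use 2 in auto)
  next
    case 3
    have "((\<lambda>t::real. (max 0 t)\<^sup>2 / \<bar>t\<bar>) \<longlongrightarrow> 0) (at 0)"
    proof (rule tendsto_sandwich[of "\<lambda>_. 0" _ _ "\<lambda>t. \<bar>t\<bar>"])
      show "\<forall>\<^sub>F t in at (0::real). (max 0 t)\<^sup>2 / \<bar>t\<bar> \<le> \<bar>t\<bar>"
        by (intro always_eventually) (auto simp: max_def power2_eq_square)
    qed (auto intro!: tendsto_eq_intros always_eventually)
    then show ?thesis using 3 by (simp add: has_derivative_at_within has_derivative_at divide_inverse mult.commute)
  qed
qed

lemma C1_on_sq_pos_part: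
  assumes "C1_on U f"
  shows "C1_on U (\<lambda>x. (max 0 (f x :: real))\<^sup>2)"
proof -
  have "C1_on UNIV (\<lambda>t::real. (max 0 t)\<^sup>2)"
    by (rule C1_onI[OF has_derivative_sq_pos_part]) (intro continuous_intros)
  then show ?thesis using C1_on_compose[OF assms] by blast
qed

text \<open>Test functions are of class C^1 here, so squared positive parts can take the place of
  the usual exponential bump.\<close>

lemma C1_bump:
  fixes p :: "'a::euclidean_space"
  assumes "0 < r"
  obtains \<beta> :: "'a \<Rightarrow> real" where "C1_on UNIV \<beta>" "\<And>x. 0 \<le> \<beta> x" "\<And>x. \<beta> x \<le> 1"
    "\<And>x. x \<in> ball p r \<Longrightarrow> \<beta> x = 1" "\<And>x. x \<notin> cball p (2*r) \<Longrightarrow> \<beta> x = 0"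
proof
  \<comment> \<open>\<open>s\<close> is the squared distance from \<open>p\<close> in units of
    \<open>r\<close>. The nested positive parts create a plateau on either side: for
    \<open>s x \<le> 1\<close> the inner square is at least 1 and \<open>\<beta> x = 1\<close>, for
    \<open>s x \<ge> 2\<close> the inner square is 0 and \<open>\<beta> x = 0\<close>.\<close>
  define s where "s x = (x - p) \<bullet> (x - p) * inverse (r\<^sup>2)" for x
  define \<beta> where "\<beta> x = 1 - (max 0 (1 - (max 0 (2 - s x))\<^sup>2))\<^sup>2" for x
  show "C1_on UNIV \<beta>" unfolding \<beta>_def s_def
    by (intro C1_on_diff C1_on_sq_pos_part C1_on_const C1_on_mult C1_on_inner C1_on_id)
  have m: "0 \<le> (max 0 (1 - (max 0 (2 - s x))\<^sup>2))" "(max 0 (1 - (max 0 (2 - s x))\<^sup>2)) \<le> 1" for x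
    by auto
  show "0 \<le> \<beta> x" "\<beta> x \<le> 1" for x
    using power_le_one[OF m(1)[of x] m(2)[of x], of 2] unfolding \<beta>_def by auto
  have n: "s x = (norm (x - p) / r)\<^sup>2" for x
    by (simp add: s_def power_divide power2_norm_eq_inner field_simps)
  show "\<beta> x = 1" if "x \<in> ball p r" for x
  proof -
    have "norm (x - p) / r \<le> 1" using that assms by (simp add: dist_norm norm_minus_commute)
    then have "s x \<le> 1" unfolding n using assms by (intro power_le_one) auto
    then have "1 \<le> (max 0 (2 - s x))\<^sup>2" by (intro one_le_power) auto
    then show ?thesis by (simp add: \<beta>_def)
  qed
  show "\<beta> x = 0" if "x \<notin> cball p (2*r)" for x
  proof -
    have "norm (x - p) / r \<ge> 2" using that assms by (simp add: dist_norm norm_minus_commute field_simps)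
    then have "s x \<ge> 2\<^sup>2" unfolding n by (intro power_mono) auto
    then show ?thesis by (simp add: \<beta>_def)
  qed
qed

text \<open>Finitely many bumps are combined as 1 minus the product of the
  \<open>1 - \<beta> p x\<close>: a single bump equal to 1 gives the value 1, all bumps equal to 0
  give 0, and the values stay in the unit interval without normalisation. Being 1 on the open set
  \<open>W\<close>, the cutoff does not disturb derivatives there.\<close>

lemma C1_cutoff:
  fixes C :: "'a::euclidean_space set"
  assumes "compact C" "open V" "C \<subseteq> V"
  obtains \<theta> :: "'a \<Rightarrow> real" and W K where "C1_on UNIV \<theta>" "\<And>x. 0 \<le> \<theta> x" "\<And>x. \<theta> x \<le> 1"
    "open W" "C \<subseteq> W" "\<And>x. x \<in> W \<Longrightarrow> \<theta> x = 1"
    "compact K" "K \<subseteq> V" "\<And>x. x \<notin> K \<Longrightarrow> \<theta> x = 0"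
proof -
  have "\<exists>r>0. cball p (2*r) \<subseteq> V" if "p \<in> C" for p
  proof -
    obtain e where "e > 0" "cball p e \<subseteq> V" using open_contains_cball[THEN iffD1, OF assms(2)] \<open>p \<in> C\<close> assms(3) by (meson subsetD)
    then show ?thesis by (intro exI[of _ "e/2"]) auto
  qed
  then obtain r where r: "\<And>p. p \<in> C \<Longrightarrow> 0 < r p" "\<And>p. p \<in> C \<Longrightarrow> cball p (2 * r p) \<subseteq> V"
    by metis
  define P where "P p \<beta> \<longleftrightarrow> C1_on UNIV \<beta> \<and> (\<forall>x. 0 \<le> \<beta> x) \<and> (\<forall>x. \<beta> x \<le> 1) \<and>
    (\<forall>x\<in>ball p (r p). \<beta> x = 1) \<and> (\<forall>x. x \<notin> cball p (2 * r p) \<longrightarrow> \<beta> x = 0)"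
    for p and \<beta> :: "'a \<Rightarrow> real"
  have "\<exists>\<beta>. P p \<beta>" if "p \<in> C" for p
  proof (rule C1_bump[OF r(1)[OF that], of p])
    fix b :: "'a \<Rightarrow> real"
    assume "C1_on UNIV b" "\<And>x. 0 \<le> b x" "\<And>x. b x \<le> 1"
      "\<And>x. x \<in> ball p (r p) \<Longrightarrow> b x = 1" "\<And>x. x \<notin> cball p (2 * r p) \<Longrightarrow> b x = 0"
    then show ?thesis unfolding P_def by (intro exI[of _ b]) simp
  qed
  then obtain \<beta> where "\<And>p. p \<in> C \<Longrightarrow> P p (\<beta> p)"
    by (metis (no_types))
  note \<beta>0 = this[unfolded P_def]
  have \<beta>: "\<And>p. p \<in> C \<Longrightarrow> C1_on UNIV (\<beta> p)"
    "\<And>p x. p \<in> C \<Longrightarrow> 0 \<le> \<beta> p x" "\<And>p x. p \<in> C \<Longrightarrow> \<beta> p x \<le> 1"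
    "\<And>p x. p \<in> C \<Longrightarrow> x \<in> ball p (r p) \<Longrightarrow> \<beta> p x = 1"
    "\<And>p x. p \<in> C \<Longrightarrow> x \<notin> cball p (2 * r p) \<Longrightarrow> \<beta> p x = 0"
    using \<beta>0 by auto
  have "C \<subseteq> (\<Union>p\<in>C. ball p (r p))" using r(1) by auto
  then obtain F where F: "F \<subseteq> C" "finite F" "C \<subseteq> (\<Union>p\<in>F. ball p (r p))"
    by (rule compactE_image[OF assms(1) open_ball])
  show thesis
  proof (rule that[of "\<lambda>x. 1 - (\<Prod>p\<in>F. 1 - \<beta> p x)" "\<Union>p\<in>F. ball p (r p)" "\<Union>p\<in>F. cball p (2 * r p)"])
    show "C1_on UNIV (\<lambda>x. 1 - (\<Prod>p\<in>F. 1 - \<beta> p x))"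
      by (intro C1_on_diff C1_on_const C1_on_prod \<beta>(1) subsetD[OF F(1)])
    show "0 \<le> 1 - (\<Prod>p\<in>F. 1 - \<beta> p x)" for x
      proof -
      have "(\<Prod>p\<in>F. 1 - \<beta> p x) \<le> (\<Prod>p\<in>F. 1)"
        using \<beta>(2)[OF subsetD[OF F(1)], of _ x] \<beta>(3)[OF subsetD[OF F(1)], of _ x] by (intro prod_mono) simp
      then show ?thesis by simp
    qed
    show "1 - (\<Prod>p\<in>F. 1 - \<beta> p x) \<le> 1" for x
      proof -
      have "0 \<le> (\<Prod>p\<in>F. 1 - \<beta> p x)"
        using \<beta>(3)[OF subsetD[OF F(1)], of _ x] by (intro prod_nonneg) simp
      then show ?thesis by simp
    qed
    show "1 - (\<Prod>p\<in>F. 1 - \<beta> p x) = 1" if "x \<in> (\<Union>p\<in>F. ball p (r p))" for x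
      proof -
      from that obtain p where "p \<in> F" "x \<in> ball p (r p)" by blast
      then have "\<beta> p x = 1" using \<beta>(4) F(1) by blast
      then show ?thesis using prod_zero[OF F(2), of "\<lambda>p. 1 - \<beta> p x"] \<open>p \<in> F\<close> by auto
    qed
    show "1 - (\<Prod>p\<in>F. 1 - \<beta> p x) = 0" if "x \<notin> (\<Union>p\<in>F. cball p (2 * r p))" for x
    proof -
      have "\<beta> p x = 0" if "p \<in> F" for p
        using that \<open>x \<notin> _\<close> by (intro \<beta>(5) subsetD[OF F(1)]) auto
      then show ?thesis by simp
    qed
    show "(\<Union>p\<in>F. cball p (2 * r p)) \<subseteq> V" by (intro UN_least r(2) subsetD[OF F(1)])
    show "open (\<Union>p\<in>F. ball p (r p))" by auto
    show "compact (\<Union>p\<in>F. cball p (2 * r p))" using F(2) by (intro compact_UN) auto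
  qed (rule F(3))
qed

section \<open>Density of continuous functions in \<open>L\<^sup>1\<close>\<close>

text \<open>Provides a margin: mollifying with radius at most \<delta> at points of \<open>K\<close>
  sees only values on the compact set \<open>K'\<close>.\<close>

lemma compact_cball_nbhd:
  fixes K :: "'a::euclidean_space set"
  assumes "compact K" "open V" "K \<subseteq> V"
  obtains K' \<delta> where "compact K'" "K' \<subseteq> V" "0 < \<delta>" "\<And>x. x \<in> K \<Longrightarrow> cball x \<delta> \<subseteq> K'"
proof -
  obtain \<delta> where \<delta>: "0 < \<delta>" "(\<Union>x\<in>K. cball x \<delta>) \<subseteq> V"
    using compact_subset_open_imp_cball_epsilon_subset[OF assms] by blast
  have "cball x \<delta> = (+) x ` cball 0 \<delta>" for x :: 'a by simp
  then have eq: "(\<Union>x\<in>K. cball x \<delta>) = {x + y |x y. x \<in> K \<and> y \<in> cball 0 \<delta>}" by blast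
  have "compact (\<Union>x\<in>K. cball x \<delta>)"
    unfolding eq by (intro compact_sums assms(1) compact_cball)
  then show thesis using that[OF _ \<delta>(2,1)] by blast
qed

lemma loc_integrable_onD:
  "loc_integrable_on f S \<Longrightarrow> compact K \<Longrightarrow> K \<subseteq> S \<Longrightarrow> integrable lebesgue (\<lambda>x. indicator K x *\<^sub>R f x)"
  by (auto simp: loc_integrable_on_def set_integrable_def)

lemma integrable_continuous_compact_support:
  fixes g :: "'a::euclidean_space \<Rightarrow> 'b::euclidean_space"
  assumes "continuous_on UNIV g" "compact K" "\<And>x. x \<notin> K \<Longrightarrow> g x = 0"
  shows "integrable lborel g"
proof -
  have "(\<lambda>x. indicator K x *\<^sub>R g x) = g" using assms(3) by (auto simp: indicator_def)
  then show ?thesis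
    using borel_integrable_compact[OF assms(2) continuous_on_subset[OF assms(1)]] by simp
qed

lemma integral_lborel_translate:
  fixes f :: "'a::euclidean_space \<Rightarrow> 'b::euclidean_space"
  assumes "f \<in> borel_measurable borel"
  shows "(LINT x|lborel. f (h + x)) = (LINT x|lborel. f x)"
proof -
  have "(LINT x|lborel. f x) = (LINT x|distr lborel borel ((+) h). f x)"
    by (simp add: lborel_distr_plus)
  also have "\<dots> = (LINT x|lborel. f (h + x))"
    using assms by (subst integral_distr) auto
  finally show ?thesis by simp
qed

lemma nn_integral_lborel_diff_right:
  fixes f :: "'a::euclidean_space \<Rightarrow> ennreal"
  assumes "f \<in> borel_measurable borel"
  shows "(\<integral>\<^sup>+x. f (x - h) \<partial>lborel) = (\<integral>\<^sup>+x. f x \<partial>lborel)"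
proof -
  have "(\<integral>\<^sup>+x. f x \<partial>lborel) = (\<integral>\<^sup>+x. f x \<partial>distr lborel borel ((+) (-h)))"
    by (simp add: lborel_distr_plus)
  also have "\<dots> = (\<integral>\<^sup>+x. f (-h + x) \<partial>lborel)"
    using assms by (subst nn_integral_distr) auto
  finally show ?thesis by simp
qed

text \<open>Measurability yields continuous \<open>g n\<close> that converge to \<open>f\<close>
  almost everywhere, but without domination. Hence \<open>f\<close> is first replaced by its
  truncation at a level \<open>k\<close>, and then the truncation of \<open>f\<close> by that of
  \<open>g n\<close>; dominated convergence applies to both.\<close>

lemma L1_dense_continuous_compact_support:
  fixes f :: "'a::euclidean_space \<Rightarrow> 'b::euclidean_space"
  assumes f: "integrable lborel f" and "0 < e"
  obtains g R where "continuous_on UNIV g" "\<And>x. x \<notin> cball 0 R \<Longrightarrow> g x = 0"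
    "(LINT x|lborel. norm (f x - g x)) < e"
proof -
  have fm[measurable]: "f \<in> borel_measurable borel" using f by auto
  have "f measurable_on UNIV"
    using fm by (auto intro!: lebesgue_measurable_imp_measurable_on measurable_completion)
  then obtain N g where N: "negligible N" and g: "\<And>n. continuous_on UNIV (g n)"
    and lim: "\<And>x. x \<notin> N \<Longrightarrow> (\<lambda>n. g n x) \<longlonglongrightarrow> f x"
    unfolding measurable_on_def by auto
  have AEN: "AE x in lborel. x \<notin> N"
    using N AE_not_in[of N lebesgue] by (simp add: negligible_iff_null_sets AE_completion_iff)
  \<comment> \<open>\<open>T k\<close> retracts the values radially onto the ball of radius
    \<open>Suc k\<close>, and \<open>c k\<close> is a continuous cutoff in space. Neither changes
    anything when \<open>norm y\<close> and \<open>norm x\<close> are at most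
    \<open>k\<close>.\<close>
  define T where "T k y = (1 / max 1 (norm y / real (Suc k))) *\<^sub>R y" for k and y :: 'b
  define c where "c k x = max 0 (min 1 (real (Suc k) + 1 - norm x))" for k and x :: 'a
  have contT: "continuous_on UNIV (T k)" for k
    unfolding T_def by (intro continuous_intros) (auto simp: max_def)
  have contc: "continuous_on UNIV (c k)" for k unfolding c_def by (intro continuous_intros)
  have m1: "0 < max 1 (norm y / real (Suc k))" for y :: 'b and k by linarith
  have T_le: "norm (T k y) \<le> norm y" for k y
  proof -
    have "norm y * 1 \<le> norm y * max 1 (norm y / real (Suc k))" by (intro mult_left_mono) auto
    then show ?thesis using m1[of y k] by (simp add: T_def divide_le_eq)
  qed
  have T_bd: "norm (T k y) \<le> real (Suc k)" for k y
  proof -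
    have "norm y / real (Suc k) \<le> max 1 (norm y / real (Suc k))" by simp
    then have "norm y \<le> real (Suc k) * max 1 (norm y / real (Suc k))"
      by (simp only: pos_divide_le_eq of_nat_0_less_iff mult.commute)
    then show ?thesis using m1[of y k] by (simp add: T_def divide_le_eq)
  qed
  have c_bd: "0 \<le> c k x" "c k x \<le> 1" for k x by (auto simp: c_def)
  have c_0: "c k x = 0" if "x \<notin> cball 0 (real (Suc k) + 1)" for k x
    using that by (auto simp: c_def)
  have [measurable]: "T k \<in> borel_measurable borel" "c k \<in> borel_measurable borel"
    "g n \<in> borel_measurable borel" for k n
    using contT contc g by (auto intro: borel_measurable_continuous_onI)
  have cT: "c k x *\<^sub>R T k y = y" if "norm y \<le> real k" "norm x \<le> real k" for k x y
  proof -
    have "norm y / real (Suc k) \<le> 1" using that by (simp add: divide_le_eq)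
    then have "T k y = y" by (simp add: T_def max_def)
    moreover have "c k x = 1" using that by (simp add: c_def)
    ultimately show ?thesis by simp
  qed
  have "(\<lambda>k. LINT x|lborel. norm (f x - c k x *\<^sub>R T k (f x))) \<longlonglongrightarrow> (LINT x::'a|lborel. 0)"
  proof (rule integral_dominated_convergence[where w = "\<lambda>x. 2 * norm (f x)"])
    show "AE x in lborel. (\<lambda>k. norm (f x - c k x *\<^sub>R T k (f x))) \<longlonglongrightarrow> 0"
    proof (intro AE_I2 tendsto_eventually)
      fix x
      obtain k0 where k0: "max (norm (f x)) (norm x) \<le> real k0" using real_arch_simple by blast
      show "\<forall>\<^sub>F k in sequentially. norm (f x - c k x *\<^sub>R T k (f x)) = 0"
        using eventually_ge_at_top[of k0]
      proof eventually_elim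
        fix k assume "k0 \<le> k"
        then have "c k x *\<^sub>R T k (f x) = f x" using k0 by (intro cT) auto
        then show "norm (f x - c k x *\<^sub>R T k (f x)) = 0" by simp
      qed
    qed
    show "AE x in lborel. norm (norm (f x - c k x *\<^sub>R T k (f x))) \<le> 2 * norm (f x)" for k
    proof (intro AE_I2)
      fix x
      have "norm (c k x *\<^sub>R T k (f x)) \<le> 1 * norm (f x)"
        unfolding norm_scaleR using c_bd[of k x] T_le[of k "f x"] by (intro mult_mono) auto
      then show "norm (norm (f x - c k x *\<^sub>R T k (f x))) \<le> 2 * norm (f x)"
        using norm_triangle_ineq4[of "f x" "c k x *\<^sub>R T k (f x)"] by simp
    qed
  qed (use f in auto)
  then have "\<forall>\<^sub>F k in sequentially. (LINT x|lborel. norm (f x - c k x *\<^sub>R T k (f x))) < e / 2"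
    using \<open>0 < e\<close> by (intro order_tendstoD(2)) auto
  then obtain k where k: "(LINT x|lborel. norm (f x - c k x *\<^sub>R T k (f x))) < e / 2"
    by (auto simp: eventually_sequentially)
  have bnd: "norm (c k x *\<^sub>R T k y) \<le> indicator (cball 0 (real (Suc k) + 1)) x *\<^sub>R real (Suc k)" for x y
  proof (cases "x \<in> cball 0 (real (Suc k) + 1)")
    case True
    have "norm (c k x *\<^sub>R T k y) \<le> 1 * real (Suc k)"
      unfolding norm_scaleR using c_bd[of k x] T_bd[of k y] by (intro mult_mono) auto
    then show ?thesis using True by simp
  qed (use c_0 in auto)
  have dom: "integrable lborel (\<lambda>x::'a. indicator (cball 0 (real (Suc k) + 1)) x *\<^sub>R real (Suc k))"
    by (intro borel_integrable_compact) auto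
  \<comment> \<open>With \<open>k\<close> frozen, all functions are bounded by \<open>Suc k\<close>
    and vanish off one ball, so almost everywhere convergence of \<open>g n\<close> is
    enough.\<close>
  have "(\<lambda>n. LINT x|lborel. norm (c k x *\<^sub>R T k (f x) - c k x *\<^sub>R T k (g n x))) \<longlonglongrightarrow> (LINT x::'a|lborel. 0)"
  proof (rule integral_dominated_convergence[where w = "\<lambda>x. 2 * indicator (cball 0 (real (Suc k) + 1)) x *\<^sub>R real (Suc k)"])
    show "AE x in lborel. (\<lambda>n. norm (c k x *\<^sub>R T k (f x) - c k x *\<^sub>R T k (g n x))) \<longlonglongrightarrow> 0"
      using AEN
    proof eventually_elim
      fix x assume "x \<notin> N"
      then have "(\<lambda>n. T k (g n x)) \<longlonglongrightarrow> T k (f x)"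
        using contT lim by (metis UNIV_I continuous_on_tendsto_compose eventually_sequentiallyI)
      then have "(\<lambda>n. norm (c k x *\<^sub>R T k (f x) - c k x *\<^sub>R T k (g n x))) \<longlonglongrightarrow> norm (c k x *\<^sub>R T k (f x) - c k x *\<^sub>R T k (f x))"
        by (intro tendsto_intros)
      then show "(\<lambda>n. norm (c k x *\<^sub>R T k (f x) - c k x *\<^sub>R T k (g n x))) \<longlonglongrightarrow> 0" by simp
    qed
    show "AE x in lborel. norm (norm (c k x *\<^sub>R T k (f x) - c k x *\<^sub>R T k (g n x)))
        \<le> 2 * indicator (cball 0 (real (Suc k) + 1)) x *\<^sub>R real (Suc k)" for n
    proof (intro AE_I2)
      fix x
      show "norm (norm (c k x *\<^sub>R T k (f x) - c k x *\<^sub>R T k (g n x)))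
        \<le> 2 * indicator (cball 0 (real (Suc k) + 1)) x *\<^sub>R real (Suc k)"
        using bnd[of x "f x"] bnd[of x "g n x"] norm_triangle_ineq4[of "c k x *\<^sub>R T k (f x)" "c k x *\<^sub>R T k (g n x)"]
        by (simp add: mult.assoc)
    qed
  qed (use dom in \<open>auto simp: mult.assoc\<close>)
  then have "\<forall>\<^sub>F n in sequentially. (LINT x|lborel. norm (c k x *\<^sub>R T k (f x) - c k x *\<^sub>R T k (g n x))) < e / 2"
    using \<open>0 < e\<close> by (intro order_tendstoD(2)) auto
  then obtain n where n: "(LINT x|lborel. norm (c k x *\<^sub>R T k (f x) - c k x *\<^sub>R T k (g n x))) < e / 2"
    by (auto simp: eventually_sequentially)
  have i1: "integrable lborel (\<lambda>x. c k x *\<^sub>R T k (f x))" "integrable lborel (\<lambda>x. c k x *\<^sub>R T k (g n x))"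
    by (rule Bochner_Integration.integrable_bound[OF dom]; use bnd in \<open>auto intro!: AE_I2\<close>)+
  show thesis
  proof (rule that[of "\<lambda>x. c k x *\<^sub>R T k (g n x)" "real (Suc k) + 1"])
    show "continuous_on UNIV (\<lambda>x. c k x *\<^sub>R T k (g n x))"
      by (intro continuous_intros contc continuous_on_compose2[OF contT g]) auto
    show "c k x *\<^sub>R T k (g n x) = 0" if "x \<notin> cball 0 (real (Suc k) + 1)" for x
      using c_0[OF that] by simp
    have "(LINT x|lborel. norm (f x - c k x *\<^sub>R T k (g n x))) \<le>
        (LINT x|lborel. norm (f x - c k x *\<^sub>R T k (f x)) + norm (c k x *\<^sub>R T k (f x) - c k x *\<^sub>R T k (g n x)))"
      proof (rule integral_mono)
      show "norm (f x - c k x *\<^sub>R T k (g n x)) \<le>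
        norm (f x - c k x *\<^sub>R T k (f x)) + norm (c k x *\<^sub>R T k (f x) - c k x *\<^sub>R T k (g n x))" for x
        by (rule norm_diff_triangle_ineq[of "f x" "c k x *\<^sub>R T k (f x)" "c k x *\<^sub>R T k (f x)", simplified] | norm)
    qed (use f i1 in auto)
    also have "\<dots> = (LINT x|lborel. norm (f x - c k x *\<^sub>R T k (f x))) + (LINT x|lborel. norm (c k x *\<^sub>R T k (f x) - c k x *\<^sub>R T k (g n x)))"
      using f i1 by (intro Bochner_Integration.integral_add) auto
    finally show "(LINT x|lborel. norm (f x - c k x *\<^sub>R T k (g n x))) < e" using k n by linarith
  qed
qed

section \<open>Mollification\<close>

lemma C1_compact_support_bounded_derivative:
  fixes f :: "'a::euclidean_space \<Rightarrow> 'b::euclidean_space"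
  assumes "C1_on UNIV f" "compact K" "\<And>x. x \<notin> K \<Longrightarrow> f x = 0"
  obtains B where "0 \<le> B" "\<And>x v. norm (frechet_derivative f (at x) v) \<le> B * norm v"
    "\<And>x v. x \<notin> K \<Longrightarrow> frechet_derivative f (at x) v = 0"
proof -
  obtain f' where f': "\<And>x. (f has_derivative blinfun_apply (f' x)) (at x)" "continuous_on UNIV f'"
    using assms(1) unfolding C1_on_def by auto
  have eq: "frechet_derivative f (at x) = blinfun_apply (f' x)" for x
    using f' frechet_derivative_at by metis
  have z: "frechet_derivative f (at x) v = 0" if "x \<notin> K" for x v
  proof -
    have "((\<lambda>x. 0) has_derivative (\<lambda>v. 0)) (at x)" by simp
    then have "(f has_derivative (\<lambda>v. 0)) (at x)"
      by (rule has_derivative_transform_within_open[of _ _ _ _ "-K"])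
         (use that assms(2,3) in \<open>auto simp: compact_imp_closed open_Compl\<close>)
    then show ?thesis using frechet_derivative_at by metis
  qed
  have "bounded (f' ` K)"
    using compact_continuous_image[OF continuous_on_subset[OF f'(2)] assms(2)] compact_imp_bounded by blast
  then obtain B where B: "0 < B" "\<And>x. x \<in> K \<Longrightarrow> norm (f' x) \<le> B"
    unfolding bounded_pos by auto
  have "norm (frechet_derivative f (at x) v) \<le> B * norm v" for x v
  proof (cases "x \<in> K")
    case True
    then show ?thesis using norm_blinfun[of "f' x" v] B(2)[OF True] unfolding eq
      by (meson mult_right_mono norm_ge_zero order_trans)
  qed (use z B in auto)
  then show thesis using that[of B] B z by auto
qed

lemma C1_bounded_derivative_lipschitz:
  fixes f :: "'a::euclidean_space \<Rightarrow> 'b::euclidean_space"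
  assumes "C1_on UNIV f" "\<And>x v. norm (frechet_derivative f (at x) v) \<le> B * norm v"
  shows "norm (f x - f y) \<le> B * norm (x - y)"
proof (rule differentiable_bound[of UNIV f "\<lambda>x. frechet_derivative f (at x)"])
  show "(f has_derivative frechet_derivative f (at x)) (at x)" for x
    using C1_on_frechet(1)[OF assms(1)] by simp
  show "onorm (frechet_derivative f (at x)) \<le> B" for x
    using assms(2) by (intro onorm_le) auto
qed auto

definition bump :: "real \<Rightarrow> 'a::euclidean_space \<Rightarrow> real" where
  "bump r z = (max 0 (r\<^sup>2 - z \<bullet> z))\<^sup>2"

definition mollifier :: "real \<Rightarrow> 'a::euclidean_space \<Rightarrow> real" where
  "mollifier r z = bump r z / (LINT z|lborel. bump r (z::'a))"

text \<open>The convolution runs over the whole space; a function given only on \<open>S\<close> is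
  multiplied by the indicator of a compact subset beforehand.\<close>

definition mollify :: "real \<Rightarrow> ('a::euclidean_space \<Rightarrow> 'b::euclidean_space) \<Rightarrow> 'a \<Rightarrow> 'b" where
  "mollify r f x = (LINT y|lborel. mollifier r (x - y) *\<^sub>R f y)"

lemma C1_on_bump: "C1_on U (bump r)"
  unfolding bump_def[abs_def] by (intro C1_on_sq_pos_part C1_on_diff C1_on_const C1_on_inner C1_on_id)

lemma bump_eq_0:
  assumes "0 < r" "z \<notin> cball 0 r"
  shows "bump r z = 0"
proof -
  have "r < norm z" using assms by simp
  then have "r\<^sup>2 < z \<bullet> z" using assms(1) power2_norm_eq_inner[of z] power_strict_mono[of r "norm z" 2] by simp
  then show ?thesis by (simp add: bump_def)
qed

lemma integrable_bump: "0 < r \<Longrightarrow> integrable lborel (bump r :: 'a::euclidean_space \<Rightarrow> real)"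
  by (rule integrable_continuous_compact_support[OF C1_on_imp_continuous_on[OF C1_on_bump] compact_cball])
     (rule bump_eq_0)

lemma integral_bump_pos:
  assumes "0 < r"
  shows "0 < (LINT z|lborel. bump r (z::'a::euclidean_space))"
proof -
  \<comment> \<open>On the ball of radius \<open>r / 2\<close> the quantity
    \<open>r^2 - z \<bullet> z\<close> is at least 3/4 of \<open>r^2\<close>, and this ball has
    positive measure.\<close>
  have "0 < (3 / 4 * r\<^sup>2)\<^sup>2 * measure lborel (ball (0::'a) (r / 2))"
    using assms content_ball_pos[of "r / 2" "0::'a"] by simp
  also have "\<dots> = (LINT z|lborel. (3 / 4 * r\<^sup>2)\<^sup>2 * indicator (ball (0::'a) (r / 2)) z)"
    by simp
  also have "\<dots> \<le> (LINT z|lborel. bump r (z::'a))"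
  proof (rule integral_mono)
    show "(3 / 4 * r\<^sup>2)\<^sup>2 * indicator (ball 0 (r / 2)) z \<le> bump r z" for z :: 'a
    proof (cases "z \<in> ball 0 (r / 2)")
      case True
      then have "(norm z)\<^sup>2 \<le> (r / 2)\<^sup>2" by (intro power_mono) auto
      then have "3 / 4 * r\<^sup>2 \<le> r\<^sup>2 - z \<bullet> z" by (simp add: power2_norm_eq_inner power_divide)
      then have "(3 / 4 * r\<^sup>2)\<^sup>2 \<le> (max 0 (r\<^sup>2 - z \<bullet> z))\<^sup>2"
        by (intro power_mono order_trans[OF _ max.cobounded2]) auto
      then show ?thesis using True by (simp add: bump_def)
    qed (auto simp: bump_def)
    show "integrable lborel (\<lambda>z. (3 / 4 * r\<^sup>2)\<^sup>2 * indicator (ball (0::'a) (r / 2)) z :: real)"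
      using emeasure_bounded_finite[OF bounded_ball, of "0::'a" "r/2"]
      by (intro integrable_mult_right integrable_real_indicator) auto
  qed (rule integrable_bump[OF assms])
  finally show ?thesis .
qed

lemma C1_on_mollifier: "C1_on U (mollifier r)"
  unfolding mollifier_def[abs_def] divide_inverse by (intro C1_on_mult C1_on_bump C1_on_const)

lemma mollifier_nonneg: "0 \<le> mollifier r z"
  by (simp add: mollifier_def bump_def)

lemma mollifier_minus: "mollifier r (- z) = mollifier r z"
  by (simp add: mollifier_def bump_def)

lemma mollifier_eq_0: "0 < r \<Longrightarrow> z \<notin> cball 0 r \<Longrightarrow> mollifier r z = 0"
  by (simp add: mollifier_def bump_eq_0)

lemma continuous_mollifier: "continuous_on U (mollifier r)"
  by (rule C1_on_imp_continuous_on[OF C1_on_mollifier])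

lemma mollifier_measurable[measurable]: "mollifier r \<in> borel_measurable borel"
  by (rule borel_measurable_continuous_onI[OF continuous_mollifier])

lemma nn_integral_mollifier:
  assumes "0 < r"
  shows "(\<integral>\<^sup>+x. ennreal (mollifier r (x - y)) \<partial>lborel) = 1"
proof -
  have "(\<integral>\<^sup>+x. ennreal (mollifier r (x - y)) \<partial>lborel) = (\<integral>\<^sup>+x. ennreal (mollifier r (x::'a)) \<partial>lborel)"
    by (rule nn_integral_lborel_diff_right) measurable
  also have "\<dots> = ennreal (LINT x|lborel. mollifier r (x::'a))"
    using integrable_bump[OF assms, where 'a='a] mollifier_nonneg
    by (intro nn_integral_eq_integral) (auto simp: mollifier_def[abs_def])
  also have "(LINT x|lborel. mollifier r (x::'a)) = 1"
    using integral_bump_pos[OF assms, where 'a='a] by (simp add: mollifier_def)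
  finally show ?thesis by simp
qed

lemma mollifier_bounded_derivative:
  assumes "0 < r"
  obtains B where "0 \<le> B" "\<And>x v. norm (frechet_derivative (mollifier r) (at (x::'a::euclidean_space)) v) \<le> B * norm v"
  by (rule C1_compact_support_bounded_derivative[of "mollifier r :: 'a \<Rightarrow> real" "cball 0 r"])
     (auto intro: C1_on_mollifier mollifier_eq_0 assms)

lemma mollifier_bounded:
  assumes "0 < r"
  obtains B where "\<And>z::'a::euclidean_space. mollifier r z \<le> B"
proof -
  have "bounded (mollifier r ` cball (0::'a) r)"
    by (intro compact_imp_bounded compact_continuous_image continuous_mollifier) simp
  then obtain B where B: "0 < B" "\<And>z. z \<in> cball (0::'a) r \<Longrightarrow> norm (mollifier r z) \<le> B"
    unfolding bounded_pos by auto
  have "mollifier r z \<le> B" for z :: 'a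
    using B(1) B(2)[of z] mollifier_eq_0[OF assms, of z] by (cases "z \<in> cball 0 r") auto
  then show thesis using that by blast
qed

lemma integrable_mollifier_scaleR:
  fixes f :: "'a::euclidean_space \<Rightarrow> 'b::euclidean_space"
  assumes "0 < r" "integrable lborel f"
  shows "integrable lborel (\<lambda>y. mollifier r (x - y) *\<^sub>R f y)"
proof -
  obtain B where B: "\<And>z::'a. mollifier r z \<le> B" using mollifier_bounded[OF assms(1)] by metis
  have "integrable lborel (\<lambda>y. B *\<^sub>R f y)" using assms(2) by auto
  then show ?thesis
  proof (rule Bochner_Integration.integrable_bound)
    show "(\<lambda>y. mollifier r (x - y) *\<^sub>R f y) \<in> borel_measurable lborel"
      using assms(2) by measurable
    show "AE y in lborel. norm (mollifier r (x - y) *\<^sub>R f y) \<le> norm (B *\<^sub>R f y)"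
    proof (intro AE_I2)
      fix y
      have "\<bar>mollifier r (x - y)\<bar> \<le> \<bar>B\<bar>"
        using B[of "x - y"] mollifier_nonneg[of r "x - y"] by linarith
      then show "norm (mollifier r (x - y) *\<^sub>R f y) \<le> norm (B *\<^sub>R f y)"
        by (simp add: mult_right_mono)
    qed
  qed
qed

text \<open>By Tonelli the kernel can be integrated first, and it has total mass one; so
  mollification is a contraction of L^1.\<close>

lemma mollify_L1:
  fixes f :: "'a::euclidean_space \<Rightarrow> 'b::euclidean_space"
  assumes "0 < r" and f: "integrable lborel f"
  shows integrable_mollify: "integrable lborel (mollify r f)"
    and norm_mollify_le: "(LINT x|lborel. norm (mollify r f x)) \<le> (LINT x|lborel. norm (f x))"
proof -
  have [measurable]: "f \<in> borel_measurable borel" using f by auto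
  have m[measurable]: "mollify r f \<in> borel_measurable borel"
    unfolding mollify_def[abs_def] by measurable
  have "(\<integral>\<^sup>+x. ennreal (norm (mollify r f x)) \<partial>lborel) \<le>
     (\<integral>\<^sup>+x. \<integral>\<^sup>+y. ennreal (mollifier r (x - y)) * ennreal (norm (f y)) \<partial>lborel \<partial>lborel)"
  proof (intro nn_integral_mono)
    fix x
    have "ennreal (norm (mollify r f x)) \<le> ennreal (LINT y|lborel. norm (mollifier r (x - y) *\<^sub>R f y))"
      unfolding mollify_def by (intro ennreal_leI integral_norm_bound)
    also have "\<dots> = (\<integral>\<^sup>+y. ennreal (norm (mollifier r (x - y) *\<^sub>R f y)) \<partial>lborel)"
      by (intro nn_integral_eq_integral[symmetric] integrable_norm integrable_mollifier_scaleR assms) auto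
    also have "\<dots> = (\<integral>\<^sup>+y. ennreal (mollifier r (x - y)) * ennreal (norm (f y)) \<partial>lborel)"
      by (intro nn_integral_cong) (simp add: ennreal_mult mollifier_nonneg)
    finally show "ennreal (norm (mollify r f x)) \<le>
      (\<integral>\<^sup>+y. ennreal (mollifier r (x - y)) * ennreal (norm (f y)) \<partial>lborel)" .
  qed
  also have "\<dots> = (\<integral>\<^sup>+y. \<integral>\<^sup>+x. ennreal (mollifier r (x - y)) * ennreal (norm (f y)) \<partial>lborel \<partial>lborel)"
    by (rule lborel_pair.Fubini') measurable
  also have "\<dots> = (\<integral>\<^sup>+y. ennreal (norm (f y)) \<partial>lborel)"
    by (simp add: nn_integral_multc nn_integral_mollifier[OF assms(1)])
  also have "\<dots> = ennreal (LINT y|lborel. norm (f y))"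
    using f by (intro nn_integral_eq_integral) auto
  finally have le: "(\<integral>\<^sup>+x. ennreal (norm (mollify r f x)) \<partial>lborel) \<le> ennreal (LINT y|lborel. norm (f y))" .
  then show int: "integrable lborel (mollify r f)"
    by (intro integrableI_bounded) (auto intro: le_less_trans)
  show "(LINT x|lborel. norm (mollify r f x)) \<le> (LINT x|lborel. norm (f x))"
    using le int by (subst (asm) nn_integral_eq_integral) auto
qed

lemma mollify_diff:
  fixes f g :: "'a::euclidean_space \<Rightarrow> 'b::euclidean_space"
  assumes "0 < r" "integrable lborel f" "integrable lborel g"
  shows "mollify r (\<lambda>x. f x - g x) x = mollify r f x - mollify r g x"
  unfolding mollify_def scaleR_diff_right
  by (intro Bochner_Integration.integral_diff integrable_mollifier_scaleR assms)

lemma integral_mollifier: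
  assumes "0 < r"
  shows "integrable lborel (\<lambda>y. mollifier r (x - y))"
    and "(LINT y|lborel. mollifier r (x - y)) = 1"
proof -
  have nn: "(\<integral>\<^sup>+y. ennreal (mollifier r (x - y)) \<partial>lborel) = 1"
    using nn_integral_mollifier[OF assms, of x] mollifier_minus[of r "x - y" for y] by simp
  then show "integrable lborel (\<lambda>y. mollifier r (x - y))"
    by (intro integrableI_bounded) (auto simp: mollifier_nonneg)
  then show "(LINT y|lborel. mollifier r (x - y)) = 1"
    using nn mollifier_nonneg by (subst (asm) nn_integral_eq_integral) auto
qed

text \<open>The kernel is a probability density concentrated on the ball of radius \<open>r\<close>
  around \<open>x\<close>, so the mollification averages values that differ from \<open>g x\<close>
  by at most \<open>e\<close>.\<close>

lemma mollify_uniform: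
  fixes g :: "'a::euclidean_space \<Rightarrow> 'b::euclidean_space"
  assumes "0 < r" and g: "integrable lborel g"
    and e: "\<And>x y. norm (x - y) \<le> r \<Longrightarrow> norm (g y - g x) \<le> e"
  shows "norm (mollify r g x - g x) \<le> e"
proof -
  have "0 \<le> e" using e[of x x] assms(1) by simp
  note ints = integral_mollifier[OF assms(1), of x] integrable_mollifier_scaleR[OF assms(1) g, of x]
  have "mollify r g x - g x = (LINT y|lborel. mollifier r (x - y) *\<^sub>R g y) - (LINT y|lborel. mollifier r (x - y) *\<^sub>R g x)"
    using ints(2) by (simp add: mollify_def Bochner_Integration.integral_scaleR_left[OF ints(1)])
  also have "\<dots> = (LINT y|lborel. mollifier r (x - y) *\<^sub>R g y - mollifier r (x - y) *\<^sub>R g x)"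
    using ints by (intro Bochner_Integration.integral_diff[symmetric]) auto
  also have "norm \<dots> \<le> (LINT y|lborel. mollifier r (x - y) * e)"
  proof (rule order_trans[OF integral_norm_bound])
    show "(LINT y|lborel. norm (mollifier r (x - y) *\<^sub>R g y - mollifier r (x - y) *\<^sub>R g x))
       \<le> (LINT y|lborel. mollifier r (x - y) * e)"
    proof (rule integral_mono)
      fix y
      show "norm (mollifier r (x - y) *\<^sub>R g y - mollifier r (x - y) *\<^sub>R g x) \<le> mollifier r (x - y) * e"
      proof (cases "norm (x - y) \<le> r")
        case True
        then show ?thesis
          using e[of x y] mollifier_nonneg[of r "x - y"]
          by (simp add: scaleR_diff_right[symmetric] mult_left_mono)
      qed (use mollifier_eq_0[OF assms(1), of "x - y"] in simp)
    qed (use ints in auto)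
  qed
  also have "\<dots> = e" using ints by simp
  finally show ?thesis .
qed

text \<open>Three error terms: \<open>f - g\<close> for a continuous compactly supported
  \<open>g\<close> close to \<open>f\<close>, the mollification of \<open>f - g\<close>, controlled
  by the L^1 contraction, and the mollification error of \<open>g\<close>, controlled by uniform
  continuity on a fixed ball.\<close>

lemma mollify_tendsto_L1:
  fixes f :: "'a::euclidean_space \<Rightarrow> 'b::euclidean_space"
  assumes f: "integrable lborel f"
  shows "(\<lambda>n. LINT x|lborel. norm (mollify (1 / real (Suc n)) f x - f x)) \<longlonglongrightarrow> 0"
proof (rule LIMSEQ_I)
  fix e :: real assume "0 < e"
  then obtain g R where g: "continuous_on UNIV g" "\<And>x. x \<notin> cball 0 R \<Longrightarrow> g x = 0"
    "(LINT x|lborel. norm (f x - g x)) < e / 3"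
    using L1_dense_continuous_compact_support[OF f, of "e / 3"] by auto
  have gi: "integrable lborel g"
    using integrable_continuous_compact_support[OF g(1) compact_cball g(2)] .
  define c where "c = measure lborel (cball (0::'a) (R + 1))"
  \<comment> \<open>Chosen so that a pointwise error \<open>e'\<close> on a ball of measure
    \<open>c\<close> integrates to less than \<open>e / 3\<close>; the summand 1 covers
    \<open>c = 0\<close>.\<close>
  define e' where "e' = e / (3 * (c + 1))"
  have c0: "0 \<le> c" by (simp add: c_def)
  then have e': "0 < e'" "e' * c < e / 3"
    using \<open>0 < e\<close> by (auto simp: e'_def divide_simps)
  have "uniformly_continuous_on (cball 0 (R + 2)) g"
    by (rule compact_uniformly_continuous[OF continuous_on_subset[OF g(1)]]) auto
  then obtain d where d: "0 < d" "\<And>x y. x \<in> cball 0 (R + 2) \<Longrightarrow> y \<in> cball 0 (R + 2) \<Longrightarrow> dist y x < d \<Longrightarrow> dist (g y) (g x) < e'"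
    unfolding uniformly_continuous_on_def using e'(1) by metis
  \<comment> \<open>If one of the points lies outside the ball of radius \<open>R + 2\<close>, both
    have norm above \<open>R + 1\<close>, and \<open>g\<close> vanishes at both.\<close>
  have un: "norm (g y - g x) \<le> e'" if "norm (x - y) \<le> r" "r < d" "r \<le> 1" for x y r
  proof (cases "x \<in> cball 0 (R + 2) \<and> y \<in> cball 0 (R + 2)")
    case True
    then show ?thesis using d(2)[of x y] that by (simp add: dist_norm norm_minus_commute)
  next
    case False
    have "norm x - norm y \<le> 1" "norm y - norm x \<le> 1"
      using that norm_triangle_ineq2[of x y] norm_triangle_ineq2[of y x] by (auto simp: norm_minus_commute)
    then have "g x = 0" "g y = 0" using False by (auto intro!: g(2))
    then show ?thesis using e' by simp
  qed
  obtain N where N: "1 / real (Suc N) < d" using nat_approx_posE d(1) by blast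
  have "norm ((LINT x|lborel. norm (mollify (1 / real (Suc n)) f x - f x)) - 0) < e" if "N \<le> n" for n
  proof -
    define r where "r = 1 / real (Suc n)"
    have "1 / real (Suc n) \<le> 1 / real (Suc N)" using that by (simp add: divide_simps)
    then have r: "0 < r" "r < d" "r \<le> 1" using N by (auto simp: r_def)
    have gm: "norm (mollify r g x - g x) \<le> indicator (cball 0 (R + 1)) x * e'" for x
    proof (cases "x \<in> cball 0 (R + 1)")
      case True
      then show ?thesis using mollify_uniform[OF r(1) gi un] r by simp
    next
      case False
      have "mollifier r (x - y) *\<^sub>R g y = 0" for y
      proof (cases "y \<in> cball 0 R")
        case True
        then have "x - y \<notin> cball 0 r" using False r(3) norm_triangle_ineq2[of x y] by auto
        then have "mollifier r (x - y) = 0" by (rule mollifier_eq_0[OF r(1)])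
        then show ?thesis by simp
      qed (use g(2) in auto)
      then have "mollify r g x = 0" by (simp only: mollify_def Bochner_Integration.integral_zero)
      then show ?thesis using False g(2)[of x] by simp
    qed
    have ind: "integrable lborel (\<lambda>x. indicator (cball (0::'a) (R + 1)) x * e')"
      using emeasure_bounded_finite[OF bounded_cball, of "0::'a" "R + 1"]
      by (intro integrable_mult_left integrable_real_indicator) auto
    note ints = integrable_mollify[OF r(1) f] integrable_mollify[OF r(1) gi]
      integrable_mollify[OF r(1) Bochner_Integration.integrable_diff[OF f gi]]
    have "(LINT x|lborel. norm (mollify r g x - g x)) \<le> (LINT x|lborel. indicator (cball (0::'a) (R + 1)) x * e')"
      using ind gm ints gi by (intro integral_mono) auto
    also have "\<dots> = c * e'" by (simp add: c_def)
    finally have 2: "(LINT x|lborel. norm (mollify r g x - g x)) < e / 3" using e'(2) by (simp add: mult.commute)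
    have 1: "(LINT x|lborel. norm (mollify r (\<lambda>x. f x - g x) x)) < e / 3"
      using norm_mollify_le[OF r(1) Bochner_Integration.integrable_diff[OF f gi]] g(3) by simp
    have "(LINT x|lborel. norm (mollify r f x - f x)) \<le> (LINT x|lborel.
       norm (mollify r (\<lambda>x. f x - g x) x) + norm (mollify r g x - g x) + norm (f x - g x))"
    proof (rule integral_mono)
      show "norm (mollify r f x - f x) \<le> norm (mollify r (\<lambda>x. f x - g x) x) + norm (mollify r g x - g x) + norm (f x - g x)" for x
        unfolding mollify_diff[OF r(1) f gi] by norm
    qed (use ints f gi in auto)
    also have "\<dots> = (LINT x|lborel. norm (mollify r (\<lambda>x. f x - g x) x)) + (LINT x|lborel. norm (mollify r g x - g x))
       + (LINT x|lborel. norm (f x - g x))"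
      using ints f gi by (simp add: Bochner_Integration.integral_add)
    also have "\<dots> < e" using 1 2 g(3) by linarith
    finally show ?thesis by (simp add: r_def)
  qed
  then show "\<exists>N. \<forall>n\<ge>N. norm ((LINT x|lborel. norm (mollify (1 / real (Suc n)) f x - f x)) - 0) < e" by blast
qed

text \<open>The Lipschitz constant of the kernel passes under the integral. It depends on
  \<open>r\<close>, which is harmless because integration by parts is applied for one radius at a
  time.\<close>

lemma mollify_lipschitz:
  fixes f :: "'a::euclidean_space \<Rightarrow> 'b::euclidean_space"
  assumes "0 < r" and f: "integrable lborel f"
  obtains L where "0 \<le> L" "\<And>x y. norm (mollify r f x - mollify r f y) \<le> L * norm (x - y)"
proof -
  obtain B where B: "0 \<le> B" "\<And>x v. norm (frechet_derivative (mollifier r) (at (x::'a)) v) \<le> B * norm v"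
    using mollifier_bounded_derivative[OF assms(1)] by blast
  show thesis
  proof (rule that[of "B * (LINT z|lborel. norm (f z))"])
    show "0 \<le> B * (LINT z|lborel. norm (f z))" using B(1) by (simp add: integral_nonneg_AE)
    fix x y
    have "mollify r f x - mollify r f y = (LINT z|lborel. mollifier r (x - z) *\<^sub>R f z - mollifier r (y - z) *\<^sub>R f z)"
      unfolding mollify_def
      by (intro Bochner_Integration.integral_diff[symmetric] integrable_mollifier_scaleR assms)
    also have "norm \<dots> \<le> (LINT z|lborel. B * norm (x - y) * norm (f z))"
    proof (rule order_trans[OF integral_norm_bound integral_mono])
      show "integrable lborel (\<lambda>z. norm (mollifier r (x - z) *\<^sub>R f z - mollifier r (y - z) *\<^sub>R f z))"
        by (intro integrable_norm Bochner_Integration.integrable_diff integrable_mollifier_scaleR assms)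
      show "integrable lborel (\<lambda>z. B * norm (x - y) * norm (f z))"
        using f by auto
      show "norm (mollifier r (x - z) *\<^sub>R f z - mollifier r (y - z) *\<^sub>R f z) \<le> B * norm (x - y) * norm (f z)" for z
        using C1_bounded_derivative_lipschitz[OF C1_on_mollifier B(2), of "x - z" "y - z"]
        by (simp add: scaleR_diff_left[symmetric] mult_right_mono)
    qed
    finally show "norm (mollify r f x - mollify r f y) \<le> B * (LINT z|lborel. norm (f z)) * norm (x - y)"
      by (simp add: mult_ac)
  qed
qed

lemma has_vector_derivative_at_0_iff:
  "(f has_vector_derivative d) (at 0) \<longleftrightarrow> ((\<lambda>t. (f t - f 0) /\<^sub>R t) \<longlongrightarrow> d) (at 0)"
proof -
  have "norm ((f t - f 0) /\<^sub>R t - d) = norm (f t - f 0 - t *\<^sub>R d) / norm t" if "t \<noteq> 0" for t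
  proof -
    have "(f t - f 0) /\<^sub>R t - d = (f t - f 0 - t *\<^sub>R d) /\<^sub>R t"
      using that by (simp add: scaleR_diff_right)
    then show ?thesis by (simp add: divide_inverse)
  qed
  then have "((\<lambda>t. norm ((f t - f 0) /\<^sub>R t - d)) \<longlongrightarrow> 0) (at 0) \<longleftrightarrow>
      ((\<lambda>t. norm (f t - f 0 - t *\<^sub>R d) / norm t) \<longlongrightarrow> 0) (at 0)"
    by (intro tendsto_cong) (auto simp: eventually_at_filter)
  then show ?thesis
    using tendsto_norm_zero_iff[of "\<lambda>t. (f t - f 0) /\<^sub>R t - d" "at 0"]
      LIM_zero_iff[of "\<lambda>t. (f t - f 0) /\<^sub>R t" d "at 0"]
    by (simp add: has_vector_derivative_def has_derivative_at bounded_linear_scaleR_left)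
qed

text \<open>Differentiation under the integral sign: the difference quotients of the kernel are
  bounded by its Lipschitz constant, so \<open>norm (f y)\<close> times a constant
  dominates.\<close>

lemma mollify_has_vector_derivative:
  fixes f :: "'a::euclidean_space \<Rightarrow> 'b::euclidean_space"
  assumes "0 < r" and f: "integrable lborel f"
  shows "((\<lambda>t. mollify r f (x + t *\<^sub>R v)) has_vector_derivative
      (LINT y|lborel. frechet_derivative (mollifier r) (at (x - y)) v *\<^sub>R f y)) (at 0)"
proof -
  obtain B where B: "0 \<le> B" "\<And>x v. norm (frechet_derivative (mollifier r) (at (x::'a)) v) \<le> B * norm v"
    using mollifier_bounded_derivative[OF assms(1)] by blast
  have [measurable]: "f \<in> borel_measurable borel" using f by auto
  have [measurable]: "(\<lambda>x::'a. frechet_derivative (mollifier r) (at x) v) \<in> borel_measurable borel"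
    by (intro borel_measurable_continuous_onI C1_on_frechet(2)[OF C1_on_mollifier])
  define q where "q t y = ((mollifier r (x + t *\<^sub>R v - y) - mollifier r (x - y)) / t) *\<^sub>R f y" for t y
  have "((\<lambda>t. LINT y|lborel. q t y) \<longlongrightarrow>
      (LINT y|lborel. frechet_derivative (mollifier r) (at (x - y)) v *\<^sub>R f y)) (at 0)"
    unfolding tendsto_at_iff_sequentially
  proof (intro allI impI, unfold comp_def)
    fix t :: "nat \<Rightarrow> real" assume t: "\<forall>i. t i \<in> UNIV - {0}" "t \<longlonglongrightarrow> 0"
    show "(\<lambda>n. LINT y|lborel. q (t n) y) \<longlonglongrightarrow>
      (LINT y|lborel. frechet_derivative (mollifier r) (at (x - y)) v *\<^sub>R f y)"
    proof (rule integral_dominated_convergence[where w = "\<lambda>y. B * norm v * norm (f y)"])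
      show "AE y in lborel. (\<lambda>n. q (t n) y) \<longlonglongrightarrow> frechet_derivative (mollifier r) (at (x - y)) v *\<^sub>R f y"
      proof (intro AE_I2)
        fix y
        have d0: "(mollifier r has_derivative frechet_derivative (mollifier r) (at (x - y))) (at (x + 0 *\<^sub>R v - y))"
          using C1_on_frechet(1)[OF C1_on_mollifier[of UNIV]] by simp
        have "((\<lambda>t. x + t *\<^sub>R v - y) has_vector_derivative v) (at 0)"
          by (auto intro!: derivative_eq_intros)
        then have "((mollifier r \<circ> (\<lambda>t. x + t *\<^sub>R v - y)) has_vector_derivative
            frechet_derivative (mollifier r) (at (x - y)) v) (at 0)"
          using has_derivative_at_withinI[OF d0, of "range (\<lambda>t. x + t *\<^sub>R v - y)"]
          by (intro vector_derivative_diff_chain_within)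
        then have "((\<lambda>t. (mollifier r (x + t *\<^sub>R v - y) - mollifier r (x - y)) / t) \<longlongrightarrow>
            frechet_derivative (mollifier r) (at (x - y)) v) (at 0)"
          by (simp add: has_real_derivative_iff_has_vector_derivative[symmetric] has_field_derivative_iff o_def)
        then have "(\<lambda>n. (mollifier r (x + t n *\<^sub>R v - y) - mollifier r (x - y)) / t n) \<longlonglongrightarrow>
            frechet_derivative (mollifier r) (at (x - y)) v"
          using t unfolding tendsto_at_iff_sequentially by (auto simp: comp_def)
        then show "(\<lambda>n. q (t n) y) \<longlonglongrightarrow> frechet_derivative (mollifier r) (at (x - y)) v *\<^sub>R f y"
          unfolding q_def by (intro tendsto_intros)
      qed
      show "AE y in lborel. norm (q (t n) y) \<le> B * norm v * norm (f y)" for n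
      proof (intro AE_I2)
        fix y
        have "norm (mollifier r (x + t n *\<^sub>R v - y) - mollifier r (x - y)) \<le> B * norm (t n *\<^sub>R v)"
          using C1_bounded_derivative_lipschitz[OF C1_on_mollifier B(2), of "x + t n *\<^sub>R v - y" "x - y"] by simp
        then have "norm ((mollifier r (x + t n *\<^sub>R v - y) - mollifier r (x - y)) / t n) \<le> B * norm v"
          using t(1) by (auto simp: divide_le_eq mult_ac)
        then show "norm (q (t n) y) \<le> B * norm v * norm (f y)"
          unfolding q_def norm_scaleR by (intro mult_right_mono) auto
      qed
    qed (use f in \<open>auto simp: q_def\<close>)
  qed
  moreover have "(LINT y|lborel. q t y) = (mollify r f (x + t *\<^sub>R v) - mollify r f (x + 0 *\<^sub>R v)) /\<^sub>R t" for t
  proof -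
    have "(LINT y|lborel. q t y) =
       (LINT y|lborel. (1 / t) *\<^sub>R (mollifier r (x + t *\<^sub>R v - y) *\<^sub>R f y - mollifier r (x - y) *\<^sub>R f y))"
      by (intro Bochner_Integration.integral_cong) (auto simp: q_def scaleR_diff_left[symmetric] divide_inverse)
    also have "\<dots> = (1 / t) *\<^sub>R (mollify r f (x + t *\<^sub>R v) - mollify r f x)"
      unfolding mollify_def integral_scaleR_right
      by (subst Bochner_Integration.integral_diff) (auto intro: integrable_mollifier_scaleR assms)
    finally show ?thesis by (simp add: divide_inverse)
  qed
  ultimately show ?thesis by (simp add: has_vector_derivative_at_0_iff)
qed

section \<open>Integration by parts for Lipschitz functions\<close>

lemma continuous_on_UNIV_bounded_on_compact:
  assumes "continuous_on UNIV g" "compact K"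
  obtains M where "0 \<le> M" "\<And>x. x \<in> K \<Longrightarrow> norm (g x) \<le> M"
proof -
  have "bounded (g ` K)"
    using compact_continuous_image[OF continuous_on_subset[OF assms(1)] assms(2)] compact_imp_bounded by blast
  then obtain M where "0 < M" "\<And>x. x \<in> K \<Longrightarrow> norm (g x) \<le> M"
    unfolding bounded_pos by auto
  then show thesis using that[of M] by auto
qed

lemma lipschitz_imp_continuous_on:
  assumes "\<And>x y. norm (w x - w y) \<le> L * norm (x - y)"
  shows "continuous_on U w"
proof (rule continuous_at_imp_continuous_on, intro ballI)
  fix x
  have "((\<lambda>y. norm (w y - w x)) \<longlongrightarrow> 0) (at x)"
  proof (rule tendsto_sandwich[of "\<lambda>_. 0" _ _ "\<lambda>y. L * norm (y - x)"])
    show "((\<lambda>y. L * norm (y - x)) \<longlongrightarrow> 0) (at x)"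
      by (rule tendsto_eq_intros refl tendsto_ident_at | simp)+
  qed (use assms in auto)
  then show "isCont w x" unfolding isCont_def by (simp add: tendsto_norm_zero_iff LIM_zero_iff)
qed

text \<open>Translation invariance makes the integral of every difference quotient of \<open>\<phi> w\<close> vanish.\<close>

lemma integration_by_parts_lipschitz:
  fixes \<phi> :: "'a::euclidean_space \<Rightarrow> real" and w :: "'a \<Rightarrow> 'b::euclidean_space"
  assumes \<phi>: "C1_on UNIV \<phi>" "compact K" "\<And>x. x \<notin> K \<Longrightarrow> \<phi> x = 0"
    and w: "\<And>x y. norm (w x - w y) \<le> L * norm (x - y)"
    and w': "\<And>x. x \<in> K \<Longrightarrow> ((\<lambda>t. w (x + t *\<^sub>R v)) has_vector_derivative w' x) (at 0)"
  shows "integrable lborel (\<lambda>x. frechet_derivative \<phi> (at x) v *\<^sub>R w x)"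
    and "integrable lborel (\<lambda>x. \<phi> x *\<^sub>R w' x)"
    and "(LINT x|lborel. frechet_derivative \<phi> (at x) v *\<^sub>R w x) = - (LINT x|lborel. \<phi> x *\<^sub>R w' x)"
proof -
  obtain B where B: "0 \<le> B" "\<And>x v. norm (frechet_derivative \<phi> (at x) v) \<le> B * norm v"
    "\<And>x v. x \<notin> K \<Longrightarrow> frechet_derivative \<phi> (at x) v = 0"
    using C1_compact_support_bounded_derivative[OF \<phi>] by blast
  have cont: "continuous_on UNIV \<phi>" "continuous_on UNIV w"
    using C1_on_imp_continuous_on[OF \<phi>(1)] lipschitz_imp_continuous_on[OF w] by auto
  define g where "g x = \<phi> x *\<^sub>R w x" for x
  define g' where "g' x = frechet_derivative \<phi> (at x) v *\<^sub>R w x + \<phi> x *\<^sub>R w' x" for x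
  have gcont: "continuous_on UNIV g" unfolding g_def by (intro continuous_intros cont)
  have g0: "g x = 0" if "x \<notin> K" for x using \<phi>(3)[OF that] by (simp add: g_def)
  have gint: "integrable lborel g"
    by (rule integrable_continuous_compact_support[OF gcont \<phi>(2) g0])
  show int1: "integrable lborel (\<lambda>x. frechet_derivative \<phi> (at x) v *\<^sub>R w x)"
    by (rule integrable_continuous_compact_support[OF _ \<phi>(2)])
       (use B(3) in \<open>auto intro!: continuous_intros cont C1_on_frechet(2)[OF \<phi>(1)]\<close>)
  obtain R where R: "\<And>x. x \<in> K \<Longrightarrow> norm x \<le> R"
    using compact_imp_bounded[OF \<phi>(2)] bounded_iff by blast
  \<comment> \<open>The increments \<open>1 / Suc n\<close> are at most 1. Hence all difference
    quotients of \<open>g\<close> vanish off \<open>K'\<close>, and a shifted point of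
    \<open>K'\<close> stays in the ball of radius \<open>R + 2 * norm v\<close>, where
    \<open>w\<close> is bounded by \<open>M\<close>.\<close>
  define K' where "K' = cball (0::'a) (R + norm v)"
  obtain M where M: "0 \<le> M" "\<And>x. x \<in> cball 0 (R + 2 * norm v) \<Longrightarrow> norm (w x) \<le> M"
    using continuous_on_UNIV_bounded_on_compact[OF cont(2) compact_cball] by blast
  obtain M' where M': "0 \<le> M'" "\<And>x. x \<in> K' \<Longrightarrow> norm (\<phi> x) \<le> M'"
    using continuous_on_UNIV_bounded_on_compact[OF cont(1), of K'] by (auto simp: K'_def)
  \<comment> \<open>The two terms come from the discrete product rule, with \<open>B\<close> and
    \<open>\<bar>L\<bar>\<close> as Lipschitz constants of \<open>\<phi>\<close> and
    \<open>w\<close>. The absolute value is taken because the sign of \<open>L\<close> is not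
    prescribed.\<close>
  define C where "C = (B * M + M' * \<bar>L\<bar>) * norm v"
  define s where "s n x = (g (x + (1 / real (Suc n)) *\<^sub>R v) - g x) /\<^sub>R (1 / real (Suc n))" for n x
  have s_int: "(LINT x|lborel. s n x) = 0" for n
  proof -
    have m: "g \<in> borel_measurable borel" using gint by auto
    have i: "integrable lborel (\<lambda>x. g ((1 / real (Suc n)) *\<^sub>R v + x))"
    proof (rule integrable_continuous_compact_support[where K = "cball 0 (R + norm v)"])
      show "continuous_on UNIV (\<lambda>x. g ((1 / real (Suc n)) *\<^sub>R v + x))"
        by (rule continuous_on_compose2[OF gcont]) (auto intro!: continuous_intros)
      fix x :: 'a assume "x \<notin> cball 0 (R + norm v)"
      moreover have "norm ((1 / real (Suc n)) *\<^sub>R v) \<le> norm v"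
        using mult_right_mono[of "1 / real (Suc n)" 1 "norm v"] by simp
      ultimately have "R < norm ((1 / real (Suc n)) *\<^sub>R v + x)"
        using norm_diff_ineq[of x "(1 / real (Suc n)) *\<^sub>R v"] by (simp add: add.commute)
      then show "g ((1 / real (Suc n)) *\<^sub>R v + x) = 0" using R g0 by force
    qed auto
    have "(LINT x|lborel. g ((1 / real (Suc n)) *\<^sub>R v + x) - g x) = 0"
      using i gint by (simp add: integral_lborel_translate[OF m])
    then show ?thesis unfolding s_def by (simp add: add.commute)
  qed
  have dom: "integrable lborel (\<lambda>x. indicator K' x *\<^sub>R C)"
    by (intro borel_integrable_compact) (auto simp: K'_def)
  have lim: "(\<lambda>n. s n x) \<longlonglongrightarrow> g' x" for x
  proof -
    have "((\<lambda>t. g (x + t *\<^sub>R v)) has_vector_derivative g' x) (at 0)"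
    proof (cases "x \<in> K")
      case True
      have d0: "(\<phi> has_derivative frechet_derivative \<phi> (at x)) (at (x + 0 *\<^sub>R v))"
        using C1_on_frechet(1)[OF \<phi>(1)] by simp
      have "((\<lambda>t. x + t *\<^sub>R v) has_vector_derivative v) (at 0)"
        by (auto intro!: derivative_eq_intros)
      then have "((\<phi> \<circ> (\<lambda>t. x + t *\<^sub>R v)) has_vector_derivative frechet_derivative \<phi> (at x) v) (at 0)"
        using has_derivative_at_withinI[OF d0, of "range (\<lambda>t. x + t *\<^sub>R v)"]
        by (intro vector_derivative_diff_chain_within)
      then have "((\<lambda>t. \<phi> (x + t *\<^sub>R v)) has_real_derivative frechet_derivative \<phi> (at x) v) (at 0)"
        by (simp add: has_real_derivative_iff_has_vector_derivative o_def)
      from has_vector_derivative_scaleR[OF this w'[OF True]]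
      show ?thesis by (simp add: g_def g'_def add.commute)
    next
      case False
      then have "g' x = 0" using \<phi>(3) B(3) by (simp add: g'_def)
      moreover have "((\<lambda>t. g (x + t *\<^sub>R v)) has_vector_derivative 0) (at 0)"
      proof (rule has_vector_derivative_transform_within_open[of "\<lambda>_. 0"])
        show "open ((\<lambda>t. x + t *\<^sub>R v) -` (- K))"
          by (intro open_vimage continuous_intros) (simp add: \<phi>(2) compact_imp_closed open_Compl)
        show "0 = g (x + t *\<^sub>R v)" if "t \<in> (\<lambda>t. x + t *\<^sub>R v) -` (- K)" for t
          using that g0 by auto
      qed (use False in auto)
      ultimately show ?thesis by simp
    qed
    then have "((\<lambda>t. (g (x + t *\<^sub>R v) - g x) /\<^sub>R t) \<longlongrightarrow> g' x) (at 0)"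
      by (simp add: has_vector_derivative_at_0_iff)
    moreover have "filterlim (\<lambda>n. 1 / real (Suc n)) (at 0) sequentially"
      unfolding filterlim_at using LIMSEQ_inverse_real_of_nat[unfolded inverse_eq_divide] by simp
    ultimately have "(\<lambda>n. (g (x + (1 / real (Suc n)) *\<^sub>R v) - g x) /\<^sub>R (1 / real (Suc n))) \<longlonglongrightarrow> g' x"
      by (rule filterlim_compose)
    then show ?thesis by (simp only: s_def)
  qed
  have bound: "norm (s n x) \<le> indicator K' x *\<^sub>R C" for n x
  proof -
    define h where "h = (1 / real (Suc n)) *\<^sub>R v"
    have h: "norm h \<le> norm v" using mult_right_mono[of "1 / real (Suc n)" 1 "norm v"] by (simp add: h_def)
    have sx: "s n x = real (Suc n) *\<^sub>R (g (x + h) - g x)" by (simp add: s_def h_def)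
    show ?thesis
    proof (cases "x \<in> K'")
      case False
      then have "R + norm v < norm x" by (simp add: K'_def)
      then have "R < norm (x + h)" "R < norm x"
        using h norm_diff_ineq[of x h] norm_ge_zero[of v] by linarith+
      then have "x + h \<notin> K" "x \<notin> K" using R by force+
      then show ?thesis using False by (simp add: sx g0)
    next
      case True
      have "norm (x + h) \<le> norm x + norm h" by (rule norm_triangle_ineq)
      then have "norm (w (x + h)) \<le> M" using True h by (intro M(2)) (auto simp: K'_def)
      moreover have "norm (\<phi> (x + h) - \<phi> x) \<le> B * norm h"
        using C1_bounded_derivative_lipschitz[OF \<phi>(1) B(2), of "x + h" x] by simp
      ultimately have 1: "norm ((\<phi> (x + h) - \<phi> x) *\<^sub>R w (x + h)) \<le> B * norm h * M"
        unfolding norm_scaleR using B(1) by (intro mult_mono) auto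
      have "norm (w (x + h) - w x) \<le> \<bar>L\<bar> * norm h"
        using w[of "x + h" x] by (simp add: order_trans[OF _ mult_right_mono[OF abs_ge_self]])
      then have 2: "norm (\<phi> x *\<^sub>R (w (x + h) - w x)) \<le> M' * (\<bar>L\<bar> * norm h)"
        using M'(2)[OF True] M'(1) unfolding norm_scaleR by (intro mult_mono) auto
      have "g (x + h) - g x = (\<phi> (x + h) - \<phi> x) *\<^sub>R w (x + h) + \<phi> x *\<^sub>R (w (x + h) - w x)"
        by (simp add: g_def algebra_simps)
      then have "norm (g (x + h) - g x) \<le> B * norm h * M + M' * (\<bar>L\<bar> * norm h)"
        using norm_triangle_mono[OF 1 2] by simp
      also have "\<dots> = C * (1 / real (Suc n))" by (simp add: C_def h_def algebra_simps add_divide_distrib)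
      finally have "norm (g (x + h) - g x) * real (Suc n) \<le> C"
        by (simp add: pos_le_divide_eq del: of_nat_Suc)
      then show ?thesis using True by (simp add: sx mult.commute del: of_nat_Suc)
    qed
  qed
  have s_meas: "s n \<in> borel_measurable lborel" for n
  proof -
    have "continuous_on UNIV (s n)" unfolding s_def
      by (intro continuous_intros gcont continuous_on_compose2[OF gcont, of UNIV "\<lambda>x. x + _"]) auto
    then show ?thesis using borel_measurable_continuous_onI by auto
  qed
  \<comment> \<open>\<open>w'\<close> is not known to be measurable; \<open>g'\<close> is measurable
    as a pointwise limit of continuous difference quotients, and
    \<open>\<phi> x *\<^sub>R w' x\<close> is then recovered by subtraction.\<close>
  have g'_meas: "g' \<in> borel_measurable lborel"
    by (rule borel_measurable_LIMSEQ_metric[OF s_meas lim])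
  have dc: "integrable lborel g'" "(\<lambda>n. LINT x|lborel. s n x) \<longlonglongrightarrow> (LINT x|lborel. g' x)"
    using g'_meas s_meas dom lim bound
    by (auto intro!: integral_dominated_convergence[where w = "\<lambda>x. indicator K' x *\<^sub>R C"]
        dominated_convergence integrable_dominated_convergence[where w = "\<lambda>x. indicator K' x *\<^sub>R C" and s = s])
  have z: "(LINT x|lborel. g' x) = 0"
    using dc(2) unfolding s_int by (metis LIMSEQ_const_iff)
  have "(\<lambda>x. g' x - frechet_derivative \<phi> (at x) v *\<^sub>R w x) = (\<lambda>x. \<phi> x *\<^sub>R w' x)"
    by (simp add: g'_def)
  then show int2: "integrable lborel (\<lambda>x. \<phi> x *\<^sub>R w' x)"
    using Bochner_Integration.integrable_diff[OF dc(1) int1] by simp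
  have "(LINT x|lborel. g' x) = (LINT x|lborel. frechet_derivative \<phi> (at x) v *\<^sub>R w x) + (LINT x|lborel. \<phi> x *\<^sub>R w' x)"
    unfolding g'_def by (rule Bochner_Integration.integral_add[OF int1 int2])
  then show "(LINT x|lborel. frechet_derivative \<phi> (at x) v *\<^sub>R w x) = - (LINT x|lborel. \<phi> x *\<^sub>R w' x)"
    using z by (simp add: eq_neg_iff_add_eq_0)
qed

text \<open>Convolutions and Fubini are carried out for Borel functions, while Sobolev functions are
  only Lebesgue measurable. The passage is made coordinate by coordinate.\<close>

lemma lebesgue_borel_version:
  fixes f :: "'a::euclidean_space \<Rightarrow> 'b::euclidean_space"
  assumes "f \<in> borel_measurable lebesgue"
  obtains g where "g \<in> borel_measurable lborel" "AE x in lebesgue. f x = g x"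
proof -
  have "\<exists>h\<in>borel_measurable lborel. (AE x in lborel. f x \<bullet> b = h x)" for b
    using assms by (intro completion_ex_borel_measurable_real) auto
  then obtain h where h: "\<And>b. h b \<in> borel_measurable lborel" "\<And>b. AE x in lborel. f x \<bullet> b = h b x"
    by metis
  show thesis
  proof (rule that[of "\<lambda>x. \<Sum>b\<in>Basis. h b x *\<^sub>R b"])
    show "(\<lambda>x. \<Sum>b\<in>Basis. h b x *\<^sub>R b) \<in> borel_measurable lborel" using h(1) by simp
    have "AE x in lborel. \<forall>b\<in>Basis. f x \<bullet> b = h b x"
      using h(2) by (intro AE_finite_allI) auto
    then have "AE x in lborel. f x = (\<Sum>b\<in>Basis. h b x *\<^sub>R b)"
      by eventually_elim (metis (no_types, lifting) euclidean_representation sum.cong)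
    then show "AE x in lebesgue. f x = (\<Sum>b\<in>Basis. h b x *\<^sub>R b)" by (rule AE_completion)
  qed
qed

text \<open>Turns the integrals over \<open>S\<close> in the definition of weak derivatives into
  whole-space integrals of a Borel representative; both see only \<open>K\<close>, off which \<psi>
  vanishes.\<close>

lemma set_integral_borel_version:
  fixes \<psi> :: "'a::euclidean_space \<Rightarrow> real" and u f :: "'a \<Rightarrow> 'b::euclidean_space"
  assumes "\<psi> \<in> borel_measurable lborel" "f \<in> borel_measurable lborel"
    and "\<And>x. x \<notin> K \<Longrightarrow> \<psi> x = 0" "K \<subseteq> S" "AE x in lebesgue. indicator K x *\<^sub>R u x = f x"
  shows "(LINT x:S|lebesgue. \<psi> x *\<^sub>R u x) = (LINT x|lborel. \<psi> x *\<^sub>R f x)"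
proof -
  have m: "(\<lambda>x. \<psi> x *\<^sub>R f x) \<in> borel_measurable lborel" using assms by measurable
  have ae: "AE x in lebesgue. \<psi> x *\<^sub>R f x = indicator S x *\<^sub>R \<psi> x *\<^sub>R u x"
    using assms(5)
  proof eventually_elim
    fix x assume "indicator K x *\<^sub>R u x = f x"
    then show "\<psi> x *\<^sub>R f x = indicator S x *\<^sub>R \<psi> x *\<^sub>R u x"
      using assms(3)[of x] assms(4) by (cases "x \<in> K") (auto simp: indicator_def)
  qed
  have ml: "(\<lambda>x. \<psi> x *\<^sub>R f x) \<in> borel_measurable lebesgue" using m by (simp add: measurable_completion)
  have "(LINT x|lborel. \<psi> x *\<^sub>R f x) = (LINT x|lebesgue. \<psi> x *\<^sub>R f x)"
    using m by (simp add: integral_completion)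
  also have "\<dots> = (LINT x|lebesgue. indicator S x *\<^sub>R \<psi> x *\<^sub>R u x)"
    by (rule integral_cong_AE[OF ml borel_measurable_AE[OF ml ae] ae])
  finally show ?thesis by (simp add: set_lebesgue_integral_def)
qed

section \<open>The fundamental lemma and the chain rule\<close>

lemma loc_integrable_borel_version:
  fixes f :: "'a::euclidean_space \<Rightarrow> 'b::euclidean_space"
  assumes "loc_integrable_on f S" "compact K" "K \<subseteq> S"
  obtains g where "integrable lborel g" "AE x in lebesgue. indicator K x *\<^sub>R f x = g x"
proof -
  note i = loc_integrable_onD[OF assms]
  obtain g where g: "g \<in> borel_measurable lborel" "AE x in lebesgue. indicator K x *\<^sub>R f x = g x"
    using lebesgue_borel_version[OF borel_measurable_integrable[OF i]] .
  have "integrable lborel g"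
    using integrable_cong_AE_imp[OF i measurable_completion[OF g(1)]] g
    by (simp add: integrable_completion eq_commute)
  then show thesis using that g(2) by blast
qed

lemma C1_on_mollifier_diff: "C1_on UNIV (\<lambda>y. mollifier r (x - y))"
  by (rule C1_on_compose[OF C1_on_diff[OF C1_on_const C1_on_id] C1_on_mollifier[of UNIV]]) simp

lemma mollifier_diff_eq_0: "0 < r \<Longrightarrow> y \<notin> cball x r \<Longrightarrow> mollifier r (x - y) = 0"
  by (intro mollifier_eq_0) (simp_all add: dist_norm norm_minus_commute)

lemma test_fun_mollifier: "0 < r \<Longrightarrow> cball x r \<subseteq> S \<Longrightarrow> test_fun S (\<lambda>y. mollifier r (x - y))"
  unfolding test_fun_def
  by (intro conjI exI[of _ "cball x r"] allI impI C1_on_mollifier_diff compact_cball mollifier_diff_eq_0)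

lemma frechet_derivative_mollifier_diff:
  "frechet_derivative (\<lambda>y. mollifier r (x - y)) (at y) v = - frechet_derivative (mollifier r) (at (x - y)) v"
proof -
  have "((\<lambda>y. x - y) has_derivative (\<lambda>v. - v)) (at y)" by (auto intro!: derivative_eq_intros)
  from has_derivative_compose[OF this C1_on_frechet(1)[OF C1_on_mollifier UNIV_I]]
  have "((\<lambda>y. mollifier r (x - y)) has_derivative (\<lambda>v. frechet_derivative (mollifier r) (at (x - y)) (- v))) (at y)" .
  moreover have "linear (frechet_derivative (mollifier r) (at (x - y)))"
    by (rule has_derivative_linear[OF C1_on_frechet(1)[OF C1_on_mollifier UNIV_I]])
  ultimately show ?thesis by (simp add: frechet_derivative_at[symmetric] linear_neg)
qed

text \<open>Testing with the reflected mollifier shows that the mollifications of \<open>f\<close> vanish.\<close>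

lemma fundamental_lemma_calculus_of_variations:
  fixes f :: "'a::euclidean_space \<Rightarrow> 'b::euclidean_space"
  assumes "open S" and f: "loc_integrable_on f S"
    and test: "\<And>\<phi>. test_fun S \<phi> \<Longrightarrow> (LINT x:S|lebesgue. \<phi> x *\<^sub>R f x) = 0"
  shows "AE x\<in>S in lebesgue. f x = 0"
proof -
  have K0: "AE x in lebesgue. x \<in> K \<longrightarrow> f x = 0" if K: "compact K" "K \<subseteq> S" for K
  proof -
    obtain K' \<delta> where K': "compact K'" "K' \<subseteq> S" "0 < \<delta>" "\<And>x. x \<in> K \<Longrightarrow> cball x \<delta> \<subseteq> K'"
      using compact_cball_nbhd[OF K(1) assms(1) K(2)] by blast
    obtain g where g: "integrable lborel g" "AE x in lebesgue. indicator K' x *\<^sub>R f x = g x"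
      using loc_integrable_borel_version[OF f K'(1,2)] .
    obtain N where N: "1 / real (Suc N) < \<delta>" using nat_approx_posE K'(3) by blast
    have z: "mollify (1 / real (Suc n)) g x = 0" if x: "x \<in> K" and n: "N \<le> n" for x n
    proof -
      define r where "r = 1 / real (Suc n)"
      have "1 / real (Suc n) \<le> 1 / real (Suc N)" using n by (simp add: divide_simps)
      then have r: "0 < r" "r \<le> \<delta>" using N by (auto simp: r_def)
      then have sub: "cball x r \<subseteq> K'" using K'(4)[OF x] by (meson subset_cball subset_trans)
      have m: "(\<lambda>y. mollifier r (x - y)) \<in> borel_measurable lborel" by measurable
      have z0: "mollifier r (x - y) = 0" if "y \<notin> K'" for y
        using that sub by (intro mollifier_diff_eq_0[OF r(1)]) blast
      have "0 = (LINT y:S|lebesgue. mollifier r (x - y) *\<^sub>R f y)"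
        by (rule test[OF test_fun_mollifier[OF r(1) subset_trans[OF sub K'(2)]], symmetric])
      also have "\<dots> = (LINT y|lborel. mollifier r (x - y) *\<^sub>R g y)"
        by (rule set_integral_borel_version[OF m borel_measurable_integrable[OF g(1)] z0 K'(2) g(2)])
      finally show ?thesis by (simp add: mollify_def r_def)
    qed
    have i: "integrable lborel (\<lambda>x. indicator K x * norm (g x))"
      using integrable_mult_indicator[OF _ integrable_norm[OF g(1)], of K] K(1) by (simp add: borel_compact)
    \<comment> \<open>On \<open>K\<close> the mollifications vanish for large \<open>n\<close>, so
      there \<open>norm (g x)\<close> equals the mollification error, whose integral tends to
      0.\<close>
    have "(LINT x|lborel. indicator K x * norm (g x)) \<le> 0"
    proof (rule tendsto_lowerbound[OF mollify_tendsto_L1[OF g(1)]])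
      show "\<forall>\<^sub>F n in sequentially. (LINT x|lborel. indicator K x * norm (g x))
          \<le> (LINT x|lborel. norm (mollify (1 / real (Suc n)) g x - g x))"
        using eventually_ge_at_top[of N]
      proof eventually_elim
        fix n assume n: "N \<le> n"
        show "(LINT x|lborel. indicator K x * norm (g x)) \<le> (LINT x|lborel. norm (mollify (1 / real (Suc n)) g x - g x))"
        proof (rule integral_mono[OF i])
          show "indicator K x * norm (g x) \<le> norm (mollify (1 / real (Suc n)) g x - g x)" for x
            using z[OF _ n, of x] by (cases "x \<in> K") auto
          show "integrable lborel (\<lambda>x. norm (mollify (1 / real (Suc n)) g x - g x))"
            by (intro integrable_norm Bochner_Integration.integrable_diff integrable_mollify g(1)) simp
        qed
      qed
    qed simp
    then have "(LINT x|lborel. indicator K x * norm (g x)) = 0"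
      by (intro antisym integral_nonneg_AE) auto
    then have "AE x in lborel. indicator K x * norm (g x) = 0"
      using i by (subst (asm) integral_nonneg_eq_0_iff_AE) auto
    then have "AE x in lebesgue. indicator K x * norm (g x) = 0" by (rule AE_completion)
    then show ?thesis
      using g(2)
    proof eventually_elim
      fix x assume "indicator K x * norm (g x) = 0" "indicator K' x *\<^sub>R f x = g x"
      then show "x \<in> K \<longrightarrow> f x = 0" using K'(3) K'(4)[of x] by (force simp: indicator_def split: if_splits)
    qed
  qed
  obtain C where C: "\<And>n::nat. compact (C n)" "\<And>n. C n \<subseteq> S" "(\<Union>n. C n) = S"
    using open_Union_compact_subsets[OF assms(1)] by metis
  have "AE x in lebesgue. \<forall>n. x \<in> C n \<longrightarrow> f x = 0"
    using K0[OF C(1,2)] by (rule AE_all_countable[THEN iffD2, OF allI])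
  then show ?thesis by eventually_elim (use C(3) in blast)
qed

section \<open>The chain rule for weak derivatives\<close>

lemma C1_on_derivative_measurable:
  fixes F :: "'a::euclidean_space \<Rightarrow> 'b::euclidean_space"
  assumes "C1_on UNIV F" "y \<in> borel_measurable M" "v \<in> borel_measurable M"
  shows "(\<lambda>x. frechet_derivative F (at (y x)) (v x)) \<in> borel_measurable M"
proof (rule borel_measurable_continuous_Pair[OF assms(2,3)])
  obtain F' where F': "\<And>x. (F has_derivative blinfun_apply (F' x)) (at x)" "continuous_on UNIV F'"
    using assms(1) unfolding C1_on_def by auto
  have "frechet_derivative F (at x) = blinfun_apply (F' x)" for x
    using F' frechet_derivative_at by metis
  then show "continuous_on UNIV (\<lambda>p. frechet_derivative F (at (fst p)) (snd p))"
    by (auto intro!: continuous_intros continuous_on_compose2[OF F'(2)])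
qed

lemma loc_integrable_on_bound:
  fixes f :: "'a::euclidean_space \<Rightarrow> 'b::euclidean_space" and g :: "'a \<Rightarrow> 'c::euclidean_space"
  assumes "loc_integrable_on f S"
    and "\<And>K. compact K \<Longrightarrow> K \<subseteq> S \<Longrightarrow> (\<lambda>x. indicator K x *\<^sub>R g x) \<in> borel_measurable lebesgue"
    and "AE x\<in>S in lebesgue. norm (g x) \<le> c + B * norm (f x)"
  shows "loc_integrable_on g S"
  unfolding loc_integrable_on_def set_integrable_def
proof (intro allI impI)
  fix K assume "compact K \<and> K \<subseteq> S"
  then have K: "compact K" "K \<subseteq> S" by auto
  have "integrable lebesgue (\<lambda>x. indicator K x * c + B * norm (indicator K x *\<^sub>R f x))"
    using loc_integrable_onD[OF assms(1) K] lmeasurable_compact[OF K(1)]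
    by (intro Bochner_Integration.integrable_add integrable_mult_left integrable_mult_right
        integrable_norm integrable_real_indicator) (auto simp: fmeasurable_def)
  then show "integrable lebesgue (\<lambda>x. indicator K x *\<^sub>R g x)"
  proof (rule Bochner_Integration.integrable_bound[OF _ assms(2)[OF K]])
    show "AE x in lebesgue. norm (indicator K x *\<^sub>R g x) \<le> norm (indicator K x * c + B * norm (indicator K x *\<^sub>R f x))"
      using assms(3)
    proof eventually_elim
      fix x assume "x \<in> S \<longrightarrow> norm (g x) \<le> c + B * norm (f x)"
      then show "norm (indicator K x *\<^sub>R g x) \<le> norm (indicator K x * c + B * norm (indicator K x *\<^sub>R f x))"
        using K(2) by (cases "x \<in> K") auto
    qed
  qed
qed

lemma tendsto_integral_diff_0:
  fixes a b :: "nat \<Rightarrow> 'a \<Rightarrow> 'b::{banach, second_countable_topology}"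
    and e :: "nat \<Rightarrow> 'a \<Rightarrow> 'c::{banach, second_countable_topology}"
  assumes "\<And>n. integrable M (a n)" "\<And>n. integrable M (b n)" "\<And>n. integrable M (e n)"
    and "\<And>n x. norm (a n x - b n x) \<le> c * norm (e n x)"
    and "(\<lambda>n. LINT x|M. norm (e n x)) \<longlonglongrightarrow> 0"
  shows "(\<lambda>n. (LINT x|M. a n x) - (LINT x|M. b n x)) \<longlonglongrightarrow> 0"
proof (rule Lim_null_comparison[OF always_eventually[rule_format] tendsto_mult_right_zero[OF assms(5), of c]])
  fix n
  have "norm ((LINT x|M. a n x) - (LINT x|M. b n x)) = norm (LINT x|M. a n x - b n x)"
    using assms(1,2) by simp
  also have "\<dots> \<le> (LINT x|M. norm (a n x - b n x))" by (rule integral_norm_bound)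
  also have "\<dots> \<le> (LINT x|M. c * norm (e n x))"
    by (intro integral_mono integrable_mult_right integrable_norm Bochner_Integration.integrable_diff assms(1-4))
  finally show "norm ((LINT x|M. a n x) - (LINT x|M. b n x)) \<le> c * (LINT x|M. norm (e n x))" by simp
qed

text \<open>The derivative falls on the kernel, and the kernel reflected at \<open>x\<close> is a
  test function because its support lies in \<open>S\<close>. The sign from the reflection cancels
  the sign in the definition of weak derivatives, so mollification commutes with
  differentiation.\<close>

lemma mollify_has_weak_deriv:
  fixes u :: "real^'m \<Rightarrow> 'b::euclidean_space"
  assumes u: "has_weak_deriv S u du" and "0 < r" "cball x r \<subseteq> K" "K \<subseteq> S"
    and f: "integrable lborel f" "AE x in lebesgue. indicator K x *\<^sub>R u x = f x"
    and g: "integrable lborel g" "AE x in lebesgue. indicator K x *\<^sub>R du x a = g x"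
  shows "((\<lambda>t. mollify r f (x + t *\<^sub>R axis a 1)) has_vector_derivative mollify r g x) (at 0)"
proof -
  let ?e = "axis a 1 :: real^'m"
  define \<psi> where "\<psi> y = mollifier r (x - y)" for y
  have \<psi>C: "C1_on UNIV \<psi>" unfolding \<psi>_def by (rule C1_on_mollifier_diff)
  have \<psi>0: "\<psi> y = 0" if "y \<notin> cball x r" for y
    unfolding \<psi>_def by (rule mollifier_diff_eq_0[OF assms(2) that])
  have \<psi>': "frechet_derivative \<psi> (at y) v = - frechet_derivative (mollifier r) (at (x - y)) v" for y v
    unfolding \<psi>_def by (rule frechet_derivative_mollifier_diff)
  have \<psi>'0: "frechet_derivative \<psi> (at y) v = 0" if "y \<notin> cball x r" for y v
    by (rule C1_compact_support_bounded_derivative[OF \<psi>C compact_cball \<psi>0]) (use that in simp_all)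
  have \<psi>m: "\<psi> \<in> borel_measurable lborel" "(\<lambda>y. frechet_derivative \<psi> (at y) ?e) \<in> borel_measurable lborel"
    using borel_measurable_continuous_onI[OF C1_on_imp_continuous_on[OF \<psi>C]]
      borel_measurable_continuous_onI[OF C1_on_frechet(2)[OF \<psi>C]] by auto
  have "test_fun S \<psi>"
    unfolding \<psi>_def using assms(2-4) by (intro test_fun_mollifier) auto
  then have "(LINT y:S|lebesgue. frechet_derivative \<psi> (at y) ?e *\<^sub>R u y) = - (LINT y:S|lebesgue. \<psi> y *\<^sub>R du y a)"
    using u by (simp add: has_weak_deriv_def)
  also have "(LINT y:S|lebesgue. frechet_derivative \<psi> (at y) ?e *\<^sub>R u y) = (LINT y|lborel. frechet_derivative \<psi> (at y) ?e *\<^sub>R f y)"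
    by (rule set_integral_borel_version[OF \<psi>m(2) borel_measurable_integrable[OF f(1)] _ assms(4) f(2)])
       (use \<psi>'0 assms(3) in blast)
  also have "(LINT y:S|lebesgue. \<psi> y *\<^sub>R du y a) = (LINT y|lborel. \<psi> y *\<^sub>R g y)"
    by (rule set_integral_borel_version[OF \<psi>m(1) borel_measurable_integrable[OF g(1)] _ assms(4) g(2)])
       (use \<psi>0 assms(3) in blast)
  finally have "(LINT y|lborel. frechet_derivative (mollifier r) (at (x - y)) ?e *\<^sub>R f y) = (LINT y|lborel. \<psi> y *\<^sub>R g y)"
    by (simp add: \<psi>')
  then have "(LINT y|lborel. frechet_derivative (mollifier r) (at (x - y)) ?e *\<^sub>R f y) = mollify r g x"
    by (simp add: \<psi>_def mollify_def)
  then show ?thesis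
    using mollify_has_vector_derivative[OF assms(2) f(1), of x ?e] by simp
qed

text \<open>The classical chain rule and integration by parts hold for the mollifications
  \<open>w n\<close> of \<open>u\<close>, whose derivatives \<open>d n\<close> mollify
  \<open>du\<close>. In the limit, \<open>F (w n)\<close> converges in L^1 because \<open>F\<close>
  is Lipschitz. On the other side \<open>d n\<close> is exchanged for its limit \<open>g\<close> at
  a cost bounded by \<open>B\<close>, and then \<open>DF (w n) g\<close> converges by
  domination.\<close>

lemma has_weak_deriv_compose:
  fixes u :: "real^'m \<Rightarrow> 'a::euclidean_space" and F :: "'a \<Rightarrow> 'b::euclidean_space"
  assumes "open S" and u: "has_weak_deriv S u du"
    and F: "C1_on UNIV F" "\<And>y v. norm (frechet_derivative F (at y) v) \<le> B * norm v"
  shows "has_weak_deriv S (\<lambda>x. F (u x)) (\<lambda>x a. frechet_derivative F (at (u x)) (du x a))"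
proof -
  let ?DF = "\<lambda>y. frechet_derivative F (at y)"
  have B0: "norm (F y - F z) \<le> B * norm (y - z)" for y z
    using C1_bounded_derivative_lipschitz[OF F] .
  have lu: "loc_integrable_on u S" and ldu: "loc_integrable_on (\<lambda>x. du x a) S" for a
    using u by (auto simp: has_weak_deriv_def)
  have mF: "F \<in> borel_measurable borel"
    using C1_on_imp_continuous_on[OF F(1)] by (rule borel_measurable_continuous_onI)
  have ind: "(\<lambda>x. indicator K x *\<^sub>R g x) = (\<lambda>x. indicator K x *\<^sub>R h x)"
    if "\<And>x. x \<in> K \<Longrightarrow> g x = h x" for K and g h :: "real^'m \<Rightarrow> 'b"
    using that by (auto simp: indicator_def fun_eq_iff)
  have mK: "(indicator K :: real^'m \<Rightarrow> real) \<in> borel_measurable (lebesgue :: (real^'m) measure)" if "compact K" for K :: "(real^'m) set"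
    by (intro borel_measurable_indicator fmeasurableD lmeasurable_compact that)
  have lFu: "loc_integrable_on (\<lambda>x. F (u x)) S"
  proof (rule loc_integrable_on_bound[OF lu, where c = "norm (F 0)" and B = B])
    fix K :: "(real^'m) set" assume K: "compact K" "K \<subseteq> S"
    \<comment> \<open>Only the product of \<open>u\<close> with the indicator of \<open>K\<close> is
      known to be measurable, so the indicator is also placed inside \<open>F\<close>; off
      \<open>K\<close> the outer factor removes the value \<open>F 0\<close>.\<close>
    have "(\<lambda>x. indicator K x *\<^sub>R F (indicator K x *\<^sub>R u x)) \<in> borel_measurable lebesgue"
      using measurable_compose[OF borel_measurable_integrable[OF loc_integrable_onD[OF lu K]] mF]
      by (intro borel_measurable_scaleR mK K)
    then show "(\<lambda>x. indicator K x *\<^sub>R F (u x)) \<in> borel_measurable lebesgue"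
      by (subst ind[where h = "\<lambda>x. F (indicator K x *\<^sub>R u x)"]) auto
  next
    show "AE x\<in>S in lebesgue. norm (F (u x)) \<le> norm (F 0) + B * norm (u x)"
    proof (intro AE_I2 impI)
      fix x show "norm (F (u x)) \<le> norm (F 0) + B * norm (u x)"
        using B0[of "u x" 0] norm_triangle_sub[of "F (u x)" "F 0"] by simp
    qed
  qed
  have ldF: "loc_integrable_on (\<lambda>x. ?DF (u x) (du x a)) S" for a
  proof (rule loc_integrable_on_bound[OF ldu[of a], where c = 0 and B = B])
    fix K :: "(real^'m) set" assume K: "compact K" "K \<subseteq> S"
    have "(\<lambda>x. indicator K x *\<^sub>R ?DF (indicator K x *\<^sub>R u x) (indicator K x *\<^sub>R du x a)) \<in> borel_measurable lebesgue"
      by (rule borel_measurable_scaleR[OF mK[OF K(1)] C1_on_derivative_measurable[OF F(1)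
        borel_measurable_integrable[OF loc_integrable_onD[OF lu K]]
        borel_measurable_integrable[OF loc_integrable_onD[OF ldu[of a] K]]]])
    then show "(\<lambda>x. indicator K x *\<^sub>R ?DF (u x) (du x a)) \<in> borel_measurable lebesgue"
      by (subst ind[where h = "\<lambda>x. ?DF (indicator K x *\<^sub>R u x) (indicator K x *\<^sub>R du x a)"]) auto
  qed (use F(2) in auto)
  have "(LINT x:S|lebesgue. frechet_derivative \<phi> (at x) (axis a 1) *\<^sub>R F (u x)) =
        - (LINT x:S|lebesgue. \<phi> x *\<^sub>R ?DF (u x) (du x a))" if \<phi>S: "test_fun S \<phi>" for \<phi> a
  proof -
    let ?e = "axis a 1 :: real^'m"
    let ?\<phi>' = "\<lambda>x. frechet_derivative \<phi> (at x) ?e"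
    obtain K where \<phi>: "C1_on UNIV \<phi>" and K: "compact K" "K \<subseteq> S" and \<phi>0: "\<And>x. x \<notin> K \<Longrightarrow> \<phi> x = 0"
      using \<phi>S unfolding test_fun_def by auto
    obtain D where D: "0 \<le> D" "\<And>x v. norm (frechet_derivative \<phi> (at x) v) \<le> D * norm v"
      "\<And>x v. x \<notin> K \<Longrightarrow> frechet_derivative \<phi> (at x) v = 0"
      using C1_compact_support_bounded_derivative[OF \<phi> K(1) \<phi>0] by blast
    obtain M where M: "0 \<le> M" "\<And>x. x \<in> K \<Longrightarrow> norm (\<phi> x) \<le> M"
      using continuous_on_UNIV_bounded_on_compact[OF C1_on_imp_continuous_on[OF \<phi>] K(1)] by blast
    have M': "norm (\<phi> x) \<le> M" for x using M \<phi>0[of x] by (cases "x \<in> K") auto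
    \<comment> \<open>Values on \<open>K'\<close> determine the mollifications on \<open>K\<close>;
      \<open>f\<close> and \<open>g\<close> below represent \<open>u\<close> and \<open>du\<close>
      on \<open>K'\<close> only.\<close>
    obtain K' \<delta> where K': "compact K'" "K' \<subseteq> S" and \<delta>: "0 < \<delta>" "\<And>x. x \<in> K \<Longrightarrow> cball x \<delta> \<subseteq> K'"
      using compact_cball_nbhd[OF K(1) assms(1) K(2)] by blast
    have KK': "x \<in> K'" if "x \<in> K" for x using \<delta>(1) \<delta>(2)[OF that] by force
    obtain f where fi: "integrable lborel f" and fu: "AE x in lebesgue. indicator K' x *\<^sub>R u x = f x"
      using loc_integrable_borel_version[OF lu K'] .
    obtain g where gi: "integrable lborel g" and gdu: "AE x in lebesgue. indicator K' x *\<^sub>R du x a = g x"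
      using loc_integrable_borel_version[OF ldu[of a] K'] .
    note f = borel_measurable_integrable[OF fi] fu and g = borel_measurable_integrable[OF gi] gdu
    define w where "w n = mollify (1 / real (Suc n)) f" for n
    define d where "d n = mollify (1 / real (Suc n)) g" for n
    have r: "0 < 1 / real (Suc n)" for n by simp
    have wi: "integrable lborel (w n)" and di: "integrable lborel (d n)" for n
      unfolding w_def d_def using integrable_mollify[OF r] fi gi by auto
    have lim: "(\<lambda>n. LINT x|lborel. norm (w n x - f x)) \<longlonglongrightarrow> 0" "(\<lambda>n. LINT x|lborel. norm (d n x - g x)) \<longlonglongrightarrow> 0"
      unfolding w_def d_def using mollify_tendsto_L1[OF fi] mollify_tendsto_L1[OF gi] by auto
    have w': "((\<lambda>t. w n (x + t *\<^sub>R ?e)) has_vector_derivative d n x) (at 0)"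
      if x: "x \<in> K" and n: "1 / real (Suc n) < \<delta>" for x n
    proof -
      have "cball x (1 / real (Suc n)) \<subseteq> K'"
        using \<delta>(2)[OF x] n by (meson less_imp_le subset_cball subset_trans)
      then show ?thesis
        unfolding w_def d_def by (rule mollify_has_weak_deriv[OF u r _ K'(2) fi fu gi gdu])
    qed
    have Fw': "((\<lambda>t. F (w n (x + t *\<^sub>R ?e))) has_vector_derivative ?DF (w n x) (d n x)) (at 0)"
      if x: "x \<in> K" and n: "1 / real (Suc n) < \<delta>" for x n
    proof -
      have d0: "(F has_derivative ?DF (w n x)) (at (w n (x + 0 *\<^sub>R ?e)))"
        using C1_on_frechet(1)[OF F(1)] by simp
      have "((F \<circ> (\<lambda>t. w n (x + t *\<^sub>R ?e))) has_vector_derivative ?DF (w n x) (d n x)) (at 0)"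
        using has_derivative_at_withinI[OF d0, of "range (\<lambda>t. w n (x + t *\<^sub>R ?e))"] w'[OF x n]
        by (intro vector_derivative_diff_chain_within)
      then show ?thesis by (simp add: o_def)
    qed
    have "0 \<le> B" using F(2)[of 0 "SOME b. b \<in> Basis"] norm_ge_zero[of "?DF 0 (SOME b. b \<in> Basis)"]
      by (metis (no_types) SOME_Basis norm_Basis mult.right_neutral order_trans)
    obtain N where N: "1 / real (Suc N) < \<delta>" using nat_approx_posE \<delta>(1) by blast
    have ibp: "integrable lborel (\<lambda>x. ?\<phi>' x *\<^sub>R F (w n x))"
      "integrable lborel (\<lambda>x. \<phi> x *\<^sub>R ?DF (w n x) (d n x))"
      "(LINT x|lborel. ?\<phi>' x *\<^sub>R F (w n x)) =
       - (LINT x|lborel. \<phi> x *\<^sub>R ?DF (w n x) (d n x))" if "N \<le> n" for n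
    proof -
      have "1 / real (Suc n) \<le> 1 / real (Suc N)" using that by (simp add: divide_simps)
      then have n: "1 / real (Suc n) < \<delta>" using N by simp
      obtain L where L: "0 \<le> L" "\<And>x y. norm (w n x - w n y) \<le> L * norm (x - y)"
        unfolding w_def using mollify_lipschitz[OF r fi] by blast
      have L': "norm (F (w n x) - F (w n y)) \<le> (B * L) * norm (x - y)" for x y
        using order_trans[OF B0 mult_left_mono[OF L(2) \<open>0 \<le> B\<close>]] by (simp add: mult.assoc)
      show "integrable lborel (\<lambda>x. ?\<phi>' x *\<^sub>R F (w n x))"
        "integrable lborel (\<lambda>x. \<phi> x *\<^sub>R ?DF (w n x) (d n x))"
        "(LINT x|lborel. ?\<phi>' x *\<^sub>R F (w n x)) =
         - (LINT x|lborel. \<phi> x *\<^sub>R ?DF (w n x) (d n x))"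
        using integration_by_parts_lipschitz[OF \<phi> K(1) \<phi>0 L' Fw'[OF _ n]] by blast+
    qed
    \<comment> \<open>The derivative of \<open>F\<close> is merely continuous, so
      \<open>DF (w n) g\<close> needs pointwise convergence of \<open>w n\<close>. Convergence in
      L^1 provides it along a subsequence.\<close>
    have "\<exists>s::nat\<Rightarrow>nat. strict_mono s \<and> (AE x in lborel. (\<lambda>n. w (s n) x - f x) \<longlonglongrightarrow> 0)"
      using wi fi lim(1) by (intro tendsto_L1_AE_subseq) auto
    then obtain s :: "nat \<Rightarrow> nat" where s: "strict_mono s" and ae: "AE x in lborel. (\<lambda>n. w (s n) x - f x) \<longlonglongrightarrow> 0"
      by blast
    have smono: "N \<le> s (n + N)" for n using seq_suble[OF s, of "n + N"] by linarith
    have sN: "strict_mono (\<lambda>n. s (n + N))"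
      using s by (auto simp: strict_mono_def)
    \<comment> \<open>The shift by \<open>N\<close> keeps all radii below \<delta>, so that
      integration by parts is available for every term.\<close>
    define t where "t n = s (n + N)" for n
    have t: "N \<le> t n" for n using smono by (simp add: t_def)
    have ts: "strict_mono t" unfolding t_def[abs_def] by (rule sN)
    have ae_t: "AE x in lborel. (\<lambda>n. w (t n) x) \<longlonglongrightarrow> f x"
      using ae
    proof eventually_elim
      fix x assume "(\<lambda>n. w (s n) x - f x) \<longlonglongrightarrow> 0"
      then have "(\<lambda>n. w (s (n + N)) x - f x) \<longlonglongrightarrow> 0" by (rule LIMSEQ_ignore_initial_segment)
      then show "(\<lambda>n. w (t n) x) \<longlonglongrightarrow> f x" unfolding t_def by (rule LIM_zero_cancel)
    qed
    have lim_t: "(\<lambda>n. LINT x|lborel. norm (w (t n) x - f x)) \<longlonglongrightarrow> 0" "(\<lambda>n. LINT x|lborel. norm (d (t n) x - g x)) \<longlonglongrightarrow> 0"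
      using LIMSEQ_subseq_LIMSEQ[OF lim(1) ts] LIMSEQ_subseq_LIMSEQ[OF lim(2) ts] by (auto simp: o_def)
    have [measurable]: "w n \<in> borel_measurable lborel" "d n \<in> borel_measurable lborel" for n
      using wi di by auto
    have \<phi>m: "\<phi> \<in> borel_measurable lborel" "?\<phi>' \<in> borel_measurable lborel"
      using borel_measurable_continuous_onI[OF C1_on_imp_continuous_on[OF \<phi>]]
        borel_measurable_continuous_onI[OF C1_on_frechet(2)[OF \<phi>]] by auto
    have Ff: "(\<lambda>x. F (f x)) \<in> borel_measurable lborel"
      using measurable_compose[OF f(1)] mF by auto
    have DFg: "(\<lambda>x. ?DF (f x) (g x)) \<in> borel_measurable lborel"
      by (rule C1_on_derivative_measurable[OF F(1) f(1) g(1)])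
    have DFw: "(\<lambda>x. ?DF (w n x) (g x)) \<in> borel_measurable lborel" for n
      using g(1) by (intro C1_on_derivative_measurable[OF F(1)]) auto
    have De: "norm (?\<phi>' x) \<le> D" for x
      using D(2)[of x ?e] by simp
    have b1: "norm (?\<phi>' x *\<^sub>R F (w n x) - ?\<phi>' x *\<^sub>R F (f x))
        \<le> (D * B) * norm (w n x - f x)" for n x
    proof -
      have "norm (?\<phi>' x *\<^sub>R (F (w n x) - F (f x))) \<le> D * (B * norm (w n x - f x))"
        unfolding norm_scaleR using De B0 D(1) by (intro mult_mono) auto
      then show ?thesis by (simp add: scaleR_diff_right mult.assoc)
    qed
    have int1: "integrable lborel (\<lambda>x. ?\<phi>' x *\<^sub>R F (f x))"
    proof -
      have "integrable lborel (\<lambda>x. (D * B) * norm (w (t 0) x - f x))" using wi fi by auto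
      then have "integrable lborel (\<lambda>x. ?\<phi>' x *\<^sub>R F (w (t 0) x) - ?\<phi>' x *\<^sub>R F (f x))"
      proof (rule Bochner_Integration.integrable_bound)
        show "AE x in lborel. norm (?\<phi>' x *\<^sub>R F (w (t 0) x) - ?\<phi>' x *\<^sub>R F (f x))
           \<le> norm ((D * B) * norm (w (t 0) x - f x))"
          using b1 by (intro AE_I2) (auto intro: order_trans[OF _ abs_ge_self])
      qed (use borel_measurable_integrable[OF ibp(1)[OF t[of 0]]] \<phi>m Ff in auto)
      from Bochner_Integration.integrable_diff[OF ibp(1)[OF t[of 0]] this] show ?thesis by simp
    qed
    have lhs: "(\<lambda>n. LINT x|lborel. ?\<phi>' x *\<^sub>R F (w (t n) x)) \<longlonglongrightarrow> (LINT x|lborel. ?\<phi>' x *\<^sub>R F (f x))"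
      by (rule LIM_zero_cancel, rule tendsto_integral_diff_0[OF ibp(1)[OF t] int1 _ b1 lim_t(1)]) (use wi fi in auto)
    have linF: "linear (?DF y)" for y
      by (rule has_derivative_linear[OF C1_on_frechet(1)[OF F(1) UNIV_I]])
    have nb: "norm (\<phi> x *\<^sub>R ?DF y v) \<le> M * B * norm v" for x y v
    proof -
      have "norm (\<phi> x *\<^sub>R ?DF y v) \<le> M * (B * norm v)"
        unfolding norm_scaleR using M' F(2) M(1) by (intro mult_mono) auto
      then show ?thesis by (simp add: mult.assoc)
    qed
    have int2: "integrable lborel (\<lambda>x. \<phi> x *\<^sub>R ?DF (f x) (g x))"
    proof (rule Bochner_Integration.integrable_bound[of _ "\<lambda>x. M * B * norm (g x)"])
      show "AE x in lborel. norm (\<phi> x *\<^sub>R ?DF (f x) (g x)) \<le> norm (M * B * norm (g x))"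
        by (intro AE_I2) (use nb in \<open>auto intro: order_trans[OF _ abs_ge_self]\<close>)
    qed (use gi \<phi>m DFg in auto)
    have int3: "integrable lborel (\<lambda>x. \<phi> x *\<^sub>R ?DF (w n x) (g x))" for n
    proof (rule Bochner_Integration.integrable_bound[of _ "\<lambda>x. M * B * norm (g x)"])
      show "AE x in lborel. norm (\<phi> x *\<^sub>R ?DF (w n x) (g x)) \<le> norm (M * B * norm (g x))"
        by (intro AE_I2) (use nb in \<open>auto intro: order_trans[OF _ abs_ge_self]\<close>)
    qed (use gi \<phi>m DFw in auto)
    have lim3: "(\<lambda>n. LINT x|lborel. \<phi> x *\<^sub>R ?DF (w (t n) x) (g x)) \<longlonglongrightarrow>
        (LINT x|lborel. \<phi> x *\<^sub>R ?DF (f x) (g x))"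
    proof (rule integral_dominated_convergence[where w = "\<lambda>x. M * B * norm (g x)"])
      show "AE x in lborel. (\<lambda>n. \<phi> x *\<^sub>R ?DF (w (t n) x) (g x)) \<longlonglongrightarrow> \<phi> x *\<^sub>R ?DF (f x) (g x)"
        using ae_t
      proof eventually_elim
        fix x assume "(\<lambda>n. w (t n) x) \<longlonglongrightarrow> f x"
        then have "(\<lambda>n. ?DF (w (t n) x) (g x)) \<longlonglongrightarrow> ?DF (f x) (g x)"
          by (intro continuous_on_tendsto_compose[OF C1_on_frechet(2)[OF F(1)]]) auto
        then show "(\<lambda>n. \<phi> x *\<^sub>R ?DF (w (t n) x) (g x)) \<longlonglongrightarrow> \<phi> x *\<^sub>R ?DF (f x) (g x)"
          by (intro tendsto_intros)
      qed
    qed (use gi nb \<phi>m DFg DFw in auto)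
    have lim4: "(\<lambda>n. (LINT x|lborel. \<phi> x *\<^sub>R ?DF (w (t n) x) (d (t n) x)) - (LINT x|lborel. \<phi> x *\<^sub>R ?DF (w (t n) x) (g x))) \<longlonglongrightarrow> 0"
    proof (rule tendsto_integral_diff_0[OF ibp(2)[OF t] int3 _ _ lim_t(2)])
      show "norm (\<phi> x *\<^sub>R ?DF (w (t n) x) (d (t n) x) - \<phi> x *\<^sub>R ?DF (w (t n) x) (g x)) \<le> M * B * norm (d (t n) x - g x)" for n x
        using nb[of x "w (t n) x" "d (t n) x - g x"] by (simp add: linear_diff[OF linF] scaleR_diff_right)
    qed (use di gi in auto)
    have rhs: "(\<lambda>n. LINT x|lborel. \<phi> x *\<^sub>R ?DF (w (t n) x) (d (t n) x)) \<longlonglongrightarrow>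
        (LINT x|lborel. \<phi> x *\<^sub>R ?DF (f x) (g x))"
      using tendsto_add[OF lim4 lim3] by simp
    have eq: "(LINT x|lborel. ?\<phi>' x *\<^sub>R F (f x)) =
      - (LINT x|lborel. \<phi> x *\<^sub>R ?DF (f x) (g x))"
      using lhs tendsto_minus[OF rhs] unfolding ibp(3)[OF t] by (rule LIMSEQ_unique)
    \<comment> \<open>Return to \<open>u\<close>: it agrees with \<open>f\<close> on
      \<open>K'\<close> only, which suffices because \<phi> and its derivative vanish off
      \<open>K\<close>.\<close>
    have aeF: "AE x in lebesgue. indicator K x *\<^sub>R F (u x) = indicator K x *\<^sub>R F (f x)"
      using f(2) by eventually_elim (use KK' in \<open>auto simp: indicator_def\<close>)
    have aeG: "AE x in lebesgue. indicator K x *\<^sub>R ?DF (u x) (du x a) = indicator K x *\<^sub>R ?DF (f x) (g x)"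
      using f(2) g(2) by eventually_elim (use KK' in \<open>auto simp: indicator_def\<close>)
    have mK': "(indicator K :: real^'m \<Rightarrow> real) \<in> borel_measurable (lborel :: (real^'m) measure)"
      using K(1) by (intro borel_measurable_indicator) (simp add: borel_compact)
    have "(LINT x:S|lebesgue. ?\<phi>' x *\<^sub>R F (u x)) =
      (LINT x|lborel. ?\<phi>' x *\<^sub>R (indicator K x *\<^sub>R F (f x)))"
      using D(3) by (intro set_integral_borel_version[OF \<phi>m(2) _ _ K(2) aeF] borel_measurable_scaleR mK' Ff)
    also have "\<dots> = (LINT x|lborel. ?\<phi>' x *\<^sub>R F (f x))"
      using D(3) by (intro Bochner_Integration.integral_cong) (auto simp: indicator_def)
    finally have 1: "(LINT x:S|lebesgue. ?\<phi>' x *\<^sub>R F (u x)) =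
      (LINT x|lborel. ?\<phi>' x *\<^sub>R F (f x))" .
    have "(LINT x:S|lebesgue. \<phi> x *\<^sub>R ?DF (u x) (du x a)) =
      (LINT x|lborel. \<phi> x *\<^sub>R (indicator K x *\<^sub>R ?DF (f x) (g x)))"
      using \<phi>0 by (intro set_integral_borel_version[OF \<phi>m(1) _ _ K(2) aeG] borel_measurable_scaleR mK' DFg)
    also have "\<dots> = (LINT x|lborel. \<phi> x *\<^sub>R ?DF (f x) (g x))"
      using \<phi>0 by (intro Bochner_Integration.integral_cong) (auto simp: indicator_def)
    finally show ?thesis using 1 eq by simp
  qed
  then show ?thesis unfolding has_weak_deriv_def using lFu ldF by blast
qed

section \<open>Weak derivatives on level sets\<close>

text \<open>No measurability is assumed: Lebesgue measure is complete, so either both functions are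
  measurable or neither is, and in the latter case both integrals have the default value 0.\<close>

lemma integral_lebesgue_cong_AE:
  fixes f g :: "'a::euclidean_space \<Rightarrow> 'b::euclidean_space"
  assumes "AE x in lebesgue. f x = g x"
  shows "(LINT x|lebesgue. f x) = (LINT x|lebesgue. g x)"
proof (cases "f \<in> borel_measurable lebesgue")
  case True
  then show ?thesis using borel_measurable_AE[OF True assms] assms by (intro integral_cong_AE)
next
  case False
  have "AE x in lebesgue. g x = f x" using assms by eventually_elim simp
  then have "g \<notin> borel_measurable lebesgue" using False borel_measurable_AE by blast
  then show ?thesis using False by (metis borel_measurable_integrable not_integrable_integral_eq)
qed

lemma integrable_lebesgue_cong_AE:
  fixes f g :: "'a::euclidean_space \<Rightarrow> 'b::euclidean_space"
  assumes "integrable lebesgue f" "AE x in lebesgue. f x = g x"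
  shows "integrable lebesgue g"
  using integrable_cong_AE_imp[OF assms(1) borel_measurable_AE[OF borel_measurable_integrable[OF assms(1)] assms(2)]]
    assms(2) by (simp add: eq_commute)

lemma has_weak_deriv_cong_AE:
  fixes f g :: "real^'m \<Rightarrow> 'b::euclidean_space"
  assumes f: "has_weak_deriv S f df" and ae: "AE x\<in>S in lebesgue. f x = g x"
  shows "has_weak_deriv S g df"
proof -
  have "loc_integrable_on g S"
    unfolding loc_integrable_on_def set_integrable_def
  proof (intro allI impI)
    fix K assume K: "compact K \<and> K \<subseteq> S"
    have "integrable lebesgue (\<lambda>x. indicator K x *\<^sub>R f x)"
      using f K by (intro loc_integrable_onD) (auto simp: has_weak_deriv_def)
    then show "integrable lebesgue (\<lambda>x. indicator K x *\<^sub>R g x)"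
    proof (rule integrable_lebesgue_cong_AE)
      show "AE x in lebesgue. indicator K x *\<^sub>R f x = indicator K x *\<^sub>R g x"
        using ae by eventually_elim (use K in \<open>auto simp: indicator_def\<close>)
    qed
  qed
  moreover have "(LINT x:S|lebesgue. c x *\<^sub>R f x) = (LINT x:S|lebesgue. c x *\<^sub>R g x)" for c
    unfolding set_lebesgue_integral_def
    by (rule integral_lebesgue_cong_AE) (use ae in eventually_elim, auto simp: indicator_def)
  ultimately show ?thesis using f by (simp add: has_weak_deriv_def)
qed

lemma integrable_test_scaleR:
  fixes f :: "'a::euclidean_space \<Rightarrow> 'b::euclidean_space" and \<psi> :: "'a \<Rightarrow> real"
  assumes "continuous_on UNIV \<psi>" "compact K" "K \<subseteq> S" "\<And>x. x \<notin> K \<Longrightarrow> \<psi> x = 0" "loc_integrable_on f S"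
  shows "integrable lebesgue (\<lambda>x. indicator S x *\<^sub>R \<psi> x *\<^sub>R f x)"
proof -
  obtain M where M: "0 \<le> M" "\<And>x. x \<in> K \<Longrightarrow> norm (\<psi> x) \<le> M"
    using continuous_on_UNIV_bounded_on_compact[OF assms(1,2)] by blast
  note i = loc_integrable_onD[OF assms(5,2,3)]
  have m: "\<psi> \<in> borel_measurable lebesgue"
    using borel_measurable_continuous_onI[OF assms(1)] by (simp add: measurable_completion)
  have "integrable lebesgue (\<lambda>x. \<psi> x *\<^sub>R (indicator K x *\<^sub>R f x))"
  proof (rule Bochner_Integration.integrable_bound[OF integrable_scaleR_right[OF i, of M]])
    show "(\<lambda>x. \<psi> x *\<^sub>R (indicator K x *\<^sub>R f x)) \<in> borel_measurable lebesgue"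
      by (rule borel_measurable_scaleR[OF m borel_measurable_integrable[OF i]])
    show "AE x in lebesgue. norm (\<psi> x *\<^sub>R (indicator K x *\<^sub>R f x)) \<le> norm (M *\<^sub>R (indicator K x *\<^sub>R f x))"
    proof (intro AE_I2)
      fix x show "norm (\<psi> x *\<^sub>R (indicator K x *\<^sub>R f x)) \<le> norm (M *\<^sub>R (indicator K x *\<^sub>R f x))"
        using M by (cases "x \<in> K") (auto intro!: mult_right_mono)
    qed
  qed
  moreover have "(\<lambda>x. \<psi> x *\<^sub>R (indicator K x *\<^sub>R f x)) = (\<lambda>x. indicator S x *\<^sub>R \<psi> x *\<^sub>R f x)"
  proof
    fix x show "\<psi> x *\<^sub>R (indicator K x *\<^sub>R f x) = indicator S x *\<^sub>R \<psi> x *\<^sub>R f x"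
      using assms(3) assms(4)[of x] by (cases "x \<in> K") auto
  qed
  ultimately show ?thesis by (simp only:)
qed

lemma test_fun_integrable:
  fixes f :: "real^'m \<Rightarrow> 'b::euclidean_space"
  assumes "test_fun S \<phi>" "loc_integrable_on f S"
  shows "integrable lebesgue (\<lambda>x. indicator S x *\<^sub>R \<phi> x *\<^sub>R f x)"
    and "integrable lebesgue (\<lambda>x. indicator S x *\<^sub>R frechet_derivative \<phi> (at x) v *\<^sub>R f x)"
proof -
  obtain K where \<phi>: "C1_on UNIV \<phi>" and K: "compact K" "K \<subseteq> S" and \<phi>0: "\<And>x. x \<notin> K \<Longrightarrow> \<phi> x = 0"
    using assms(1) unfolding test_fun_def by auto
  show "integrable lebesgue (\<lambda>x. indicator S x *\<^sub>R \<phi> x *\<^sub>R f x)"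
    by (rule integrable_test_scaleR[OF C1_on_imp_continuous_on[OF \<phi>] K \<phi>0 assms(2)])
  have "frechet_derivative \<phi> (at x) v = 0" if "x \<notin> K" for x
    by (rule C1_compact_support_bounded_derivative[OF \<phi> K(1) \<phi>0]) (simp_all add: that)
  then show "integrable lebesgue (\<lambda>x. indicator S x *\<^sub>R frechet_derivative \<phi> (at x) v *\<^sub>R f x)"
    by (rule integrable_test_scaleR[OF C1_on_frechet(2)[OF \<phi>] K _ assms(2)])
qed

lemma has_weak_deriv_diff:
  fixes f g :: "real^'m \<Rightarrow> 'b::euclidean_space"
  assumes f: "has_weak_deriv S f df" and g: "has_weak_deriv S g dg"
  shows "has_weak_deriv S (\<lambda>x. f x - g x) (\<lambda>x a. df x a - dg x a)"
proof -
  have loc: "loc_integrable_on (\<lambda>x. p x - q x) S" if "loc_integrable_on p S" "loc_integrable_on q S"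
    for p q :: "real^'m \<Rightarrow> 'b"
    using that by (auto simp: loc_integrable_on_def intro: set_integral_diff)
  have sub: "(LINT x:S|lebesgue. c x *\<^sub>R (p x - q x)) = (LINT x:S|lebesgue. c x *\<^sub>R p x) - (LINT x:S|lebesgue. c x *\<^sub>R q x)"
    if "integrable lebesgue (\<lambda>x. indicator S x *\<^sub>R c x *\<^sub>R p x)" "integrable lebesgue (\<lambda>x. indicator S x *\<^sub>R c x *\<^sub>R q x)"
    for c :: "real^'m \<Rightarrow> real" and p q :: "real^'m \<Rightarrow> 'b"
    unfolding set_lebesgue_integral_def scaleR_diff_right using that by (rule Bochner_Integration.integral_diff)
  have lf: "loc_integrable_on f S" "\<And>a. loc_integrable_on (\<lambda>x. df x a) S"
    and lg: "loc_integrable_on g S" "\<And>a. loc_integrable_on (\<lambda>x. dg x a) S"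
    using f g by (auto simp: has_weak_deriv_def)
  show ?thesis
    unfolding has_weak_deriv_def
  proof (intro conjI allI impI loc lf lg)
    fix a \<phi> assume \<phi>: "test_fun S \<phi>"
    show "(LINT x:S|lebesgue. frechet_derivative \<phi> (at x) (axis a 1) *\<^sub>R (f x - g x)) =
        - (LINT x:S|lebesgue. \<phi> x *\<^sub>R (df x a - dg x a))"
      using f g \<phi>
        sub[OF test_fun_integrable(2)[OF \<phi> lf(1), of "axis a 1"] test_fun_integrable(2)[OF \<phi> lg(1), of "axis a 1"]]
        sub[OF test_fun_integrable(1)[OF \<phi> lf(2), of a] test_fun_integrable(1)[OF \<phi> lg(2), of a]]
      by (simp add: has_weak_deriv_def)
  qed
qed

lemma borel_measurable_lebesgue_LIMSEQ_AE:
  fixes f :: "nat \<Rightarrow> 'a::euclidean_space \<Rightarrow> 'b::euclidean_space"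
  assumes "\<And>k. f k \<in> borel_measurable lebesgue" "AE x in lebesgue. (\<lambda>k. f k x) \<longlonglongrightarrow> g x"
  shows "g \<in> borel_measurable lebesgue"
proof -
  obtain Z where Z: "{x \<in> space lebesgue. \<not> (\<lambda>k. f k x) \<longlonglongrightarrow> g x} \<subseteq> Z" "Z \<in> null_sets lebesgue"
    using assms(2) by (rule AE_E3) blast
  have ZS: "- Z \<in> sets lebesgue" using Z(2) by (auto simp: null_sets_def Compl_in_sets_lebesgue)
  have "(\<lambda>x. indicator (- Z) x *\<^sub>R g x) \<in> borel_measurable lebesgue"
  proof (rule borel_measurable_LIMSEQ_metric)
    show "(\<lambda>x. indicator (- Z) x *\<^sub>R f k x) \<in> borel_measurable lebesgue" for k
      by (intro borel_measurable_scaleR borel_measurable_indicator ZS assms(1))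
    show "(\<lambda>k. indicator (- Z) x *\<^sub>R f k x) \<longlonglongrightarrow> indicator (- Z) x *\<^sub>R g x" for x
    proof (cases "x \<in> Z")
      case False
      then have "(\<lambda>k. f k x) \<longlonglongrightarrow> g x" using Z(1) by auto
      then show ?thesis by (intro tendsto_intros)
    qed simp
  qed
  moreover have "AE x in lebesgue. indicator (- Z) x *\<^sub>R g x = g x"
    using AE_not_in[OF Z(2)] by eventually_elim simp
  ultimately show ?thesis by (rule borel_measurable_AE)
qed

text \<open>Test functions have compact support, so locally integrable majorants justify dominated
  convergence on both sides of the defining identity. It serves twice: for the arctangent
  approximation on zero sets and for cutoffs in the target.\<close>

lemma has_weak_deriv_dominated_limit:
  fixes f :: "nat \<Rightarrow> real^'m \<Rightarrow> 'b::euclidean_space"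
  assumes wd: "\<And>k. has_weak_deriv S (f k) (df k)"
    and lim: "AE x\<in>S in lebesgue. (\<lambda>k. f k x) \<longlonglongrightarrow> g x"
    and dlim: "\<And>a. AE x\<in>S in lebesgue. (\<lambda>k. df k x a) \<longlonglongrightarrow> dg x a"
    and b: "loc_integrable_on b S" "\<And>k. AE x\<in>S in lebesgue. norm (f k x) \<le> b x"
    and c: "\<And>a. loc_integrable_on (\<lambda>x. c x a) S" "\<And>k a. AE x\<in>S in lebesgue. norm (df k x a) \<le> c x a"
  shows "has_weak_deriv S g dg"
proof -
  have loc: "loc_integrable_on q S"
    if p: "\<And>k. loc_integrable_on (p k) S" and l: "AE x\<in>S in lebesgue. (\<lambda>k. p k x) \<longlonglongrightarrow> q x"
      and d: "loc_integrable_on d S" "\<And>k. AE x\<in>S in lebesgue. norm (p k x) \<le> d x"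
    for p :: "nat \<Rightarrow> real^'m \<Rightarrow> 'b" and q and d :: "real^'m \<Rightarrow> real"
  proof (rule loc_integrable_on_bound[OF d(1), where c = 0 and B = 1])
    fix K :: "(real^'m) set" assume K: "compact K" "K \<subseteq> S"
    show "(\<lambda>x. indicator K x *\<^sub>R q x) \<in> borel_measurable lebesgue"
    proof (rule borel_measurable_lebesgue_LIMSEQ_AE)
      show "(\<lambda>x. indicator K x *\<^sub>R p k x) \<in> borel_measurable lebesgue" for k
        by (rule borel_measurable_integrable[OF loc_integrable_onD[OF p K]])
      show "AE x in lebesgue. (\<lambda>k. indicator K x *\<^sub>R p k x) \<longlonglongrightarrow> indicator K x *\<^sub>R q x"
        using l
      proof eventually_elim
        fix x assume "x \<in> S \<longrightarrow> (\<lambda>k. p k x) \<longlonglongrightarrow> q x"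
        then show "(\<lambda>k. indicator K x *\<^sub>R p k x) \<longlonglongrightarrow> indicator K x *\<^sub>R q x"
          using K(2) by (cases "x \<in> K") (auto intro!: tendsto_intros)
      qed
    qed
  next
    have "AE x in lebesgue. \<forall>k. x \<in> S \<longrightarrow> norm (p k x) \<le> d x"
      using d(2) by (rule AE_all_countable[THEN iffD2, OF allI])
    then show "AE x\<in>S in lebesgue. norm (q x) \<le> 0 + 1 * norm (d x)"
      using l
    proof eventually_elim
      fix x assume 1: "\<forall>k. x \<in> S \<longrightarrow> norm (p k x) \<le> d x" and 2: "x \<in> S \<longrightarrow> (\<lambda>k. p k x) \<longlonglongrightarrow> q x"
      show "x \<in> S \<longrightarrow> norm (q x) \<le> 0 + 1 * norm (d x)"
      proof
        assume "x \<in> S"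
        then have "norm (q x) \<le> d x" using 1 2 by (intro Lim_bounded[OF tendsto_norm[of "\<lambda>k. p k x"]]) auto
        then show "norm (q x) \<le> 0 + 1 * norm (d x)" by simp
      qed
    qed
  qed
  have lf: "loc_integrable_on (f k) S" "loc_integrable_on (\<lambda>x. df k x a) S" for k a
    using wd[of k] by (auto simp: has_weak_deriv_def)
  have lg: "loc_integrable_on g S" by (rule loc[OF lf(1) lim b])
  have ldg: "loc_integrable_on (\<lambda>x. dg x a) S" for a by (rule loc[OF lf(2) dlim c])
  let ?I = "\<lambda>(\<psi> :: real^'m \<Rightarrow> real) p x. indicator S x *\<^sub>R \<psi> x *\<^sub>R p x"
  have conv: "(\<lambda>k. LINT x|lebesgue. ?I \<psi> (p k) x) \<longlonglongrightarrow> (LINT x|lebesgue. ?I \<psi> q x)"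
    if l: "AE x\<in>S in lebesgue. (\<lambda>k. p k x) \<longlonglongrightarrow> q x"
      and d: "\<And>k. AE x\<in>S in lebesgue. norm (p k x) \<le> d x"
      and i: "\<And>k. integrable lebesgue (?I \<psi> (p k))" "integrable lebesgue (?I \<psi> q)"
        "integrable lebesgue (?I \<psi> d)"
    for \<psi> and p :: "nat \<Rightarrow> real^'m \<Rightarrow> 'b" and q d
  proof (rule integral_dominated_convergence[where w = "\<lambda>x. norm (?I \<psi> d x)"])
    show "AE x in lebesgue. (\<lambda>k. ?I \<psi> (p k) x) \<longlonglongrightarrow> ?I \<psi> q x"
      using l
    proof eventually_elim
      fix x assume "x \<in> S \<longrightarrow> (\<lambda>k. p k x) \<longlonglongrightarrow> q x"
      then show "(\<lambda>k. ?I \<psi> (p k) x) \<longlonglongrightarrow> ?I \<psi> q x"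
        by (cases "x \<in> S") (auto intro!: tendsto_intros)
    qed
    show "AE x in lebesgue. norm (?I \<psi> (p k) x) \<le> norm (?I \<psi> d x)" for k
      using d[of k]
    proof eventually_elim
      fix x assume "x \<in> S \<longrightarrow> norm (p k x) \<le> d x"
      then show "norm (?I \<psi> (p k) x) \<le> norm (?I \<psi> d x)"
        by (cases "x \<in> S") (auto simp: abs_mult intro!: mult_left_mono)
    qed
  qed (use i in auto)
  have "(LINT x:S|lebesgue. frechet_derivative \<phi> (at x) (axis a 1) *\<^sub>R g x) = - (LINT x:S|lebesgue. \<phi> x *\<^sub>R dg x a)"
    if \<phi>: "test_fun S \<phi>" for \<phi> a
  proof -
    note 1 = conv[OF lim b(2) test_fun_integrable(2)[OF \<phi> lf(1)] test_fun_integrable(2)[OF \<phi> lg]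
        test_fun_integrable(2)[OF \<phi> b(1)], of "axis a 1"]
    note 2 = conv[OF dlim c(2) test_fun_integrable(1)[OF \<phi> lf(2)] test_fun_integrable(1)[OF \<phi> ldg]
        test_fun_integrable(1)[OF \<phi> c(1)], of a]
    have eq: "(LINT x|lebesgue. ?I (\<lambda>x. frechet_derivative \<phi> (at x) (axis a 1)) (f k) x) =
        - (LINT x|lebesgue. ?I \<phi> (\<lambda>x. df k x a) x)" for k
      using wd[of k] \<phi> unfolding has_weak_deriv_def set_lebesgue_integral_def by blast
    show ?thesis
      unfolding set_lebesgue_integral_def
      by (rule LIMSEQ_unique[OF 1[unfolded eq] tendsto_minus[OF 2]])
  qed
  then show ?thesis unfolding has_weak_deriv_def using lg ldg by blast
qed

lemma C1_on_UNIV_frechet_derivative: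
  fixes f :: "'a::euclidean_space \<Rightarrow> 'b::real_normed_vector"
  assumes "\<And>x. (f has_derivative D x) (at x)" "\<And>v. continuous_on UNIV (\<lambda>x. D x v)"
  shows "C1_on UNIV f" "frechet_derivative f (at x) = D x"
  using C1_onI[of UNIV f D] assms frechet_derivative_at[OF assms(1)] by auto

lemma has_weak_deriv_affine:
  fixes f :: "real^'m \<Rightarrow> 'b::euclidean_space"
  assumes "open S" "has_weak_deriv S f df"
  shows "has_weak_deriv S (\<lambda>x. c *\<^sub>R f x + b) (\<lambda>x a. c *\<^sub>R df x a)"
proof -
  have d: "((\<lambda>y::'b. c *\<^sub>R y + b) has_derivative (\<lambda>v. c *\<^sub>R v)) (at y)" for y
    by (auto intro!: derivative_eq_intros)
  have "C1_on UNIV (\<lambda>y::'b. c *\<^sub>R y + b)"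
    by (rule C1_on_UNIV_frechet_derivative(1)[OF d]) (intro continuous_intros)
  moreover have fd: "frechet_derivative (\<lambda>y::'b. c *\<^sub>R y + b) (at y) = (\<lambda>v. c *\<^sub>R v)" for y
    using frechet_derivative_at[OF d] by simp
  ultimately show ?thesis
    using has_weak_deriv_compose[OF assms, of "\<lambda>y. c *\<^sub>R y + b" "\<bar>c\<bar>"] by (simp add: fd)
qed

text \<open>
  The functions \<open>arctan (n (h \<bullet> b)) / n\<close> tend to \<open>0\<close> uniformly, while their weak derivatives tend
  to the derivative of \<open>h \<bullet> b\<close> restricted to the zero set of \<open>h \<bullet> b\<close>.
\<close>

lemma weak_deriv_eq_0_on_zero_set_inner:
  fixes h :: "real^'m \<Rightarrow> 'b::euclidean_space"
  assumes "open S" and h: "has_weak_deriv S h dh"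
  shows "AE x\<in>S in lebesgue. h x \<bullet> b = 0 \<longrightarrow> dh x a \<bullet> b = 0"
proof -
  define F where "F n y = arctan (real (Suc n) * (y \<bullet> b)) / real (Suc n)" for n and y :: 'b
  define D where "D n y v = (v \<bullet> b) / (1 + (real (Suc n) * (y \<bullet> b))\<^sup>2)" for n and y v :: 'b
  define q where "q x a = (if h x \<bullet> b = 0 then dh x a \<bullet> b else 0)" for x a
  have pos: "1 + (real (Suc n) * (y \<bullet> b))\<^sup>2 \<noteq> 0" for n y
    using zero_le_power2[of "real (Suc n) * (y \<bullet> b)"] by linarith
  have FD: "(F n has_derivative D n y) (at y)" for n y
  proof -
    have "((\<lambda>y. arctan (real (Suc n) * (y \<bullet> b))) has_derivative (\<lambda>v. (real (Suc n) * (v \<bullet> b)) * inverse (1 + (real (Suc n) * (y \<bullet> b))\<^sup>2))) (at y)"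
      by (rule DERIV_compose_FDERIV[OF DERIV_arctan]) (auto intro!: derivative_eq_intros)
    then have "((\<lambda>y. (1 / real (Suc n)) * arctan (real (Suc n) * (y \<bullet> b))) has_derivative
       (\<lambda>v. (1 / real (Suc n)) * ((real (Suc n) * (v \<bullet> b)) * inverse (1 + (real (Suc n) * (y \<bullet> b))\<^sup>2)))) (at y)"
      by (rule has_derivative_mult_right)
    moreover have "(\<lambda>y. (1 / real (Suc n)) * arctan (real (Suc n) * (y \<bullet> b))) = F n"
      by (simp add: F_def fun_eq_iff)
    moreover have "(\<lambda>v. (1 / real (Suc n)) * ((real (Suc n) * (v \<bullet> b)) * inverse (1 + (real (Suc n) * (y \<bullet> b))\<^sup>2))) = D n y"
      by (simp add: D_def fun_eq_iff divide_inverse del: of_nat_Suc)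
    ultimately show ?thesis by (simp only:)
  qed
  have D_le: "norm (D n y v) \<le> norm b * norm v" for n y v
  proof -
    have "norm (D n y v) = \<bar>v \<bullet> b\<bar> / (1 + (real (Suc n) * (y \<bullet> b))\<^sup>2)" by (simp add: D_def)
    also have "\<dots> \<le> \<bar>v \<bullet> b\<bar> / 1" by (intro divide_left_mono) (auto simp: pos add_pos_nonneg)
    also have "\<dots> \<le> norm b * norm v" using Cauchy_Schwarz_ineq2[of v b] by (simp add: mult.commute)
    finally show ?thesis .
  qed
  have Dcont: "continuous_on UNIV (\<lambda>y. D n y v)" for n v
    unfolding D_def using pos by (intro continuous_intros) auto
  have FC: "C1_on UNIV (F n)" and Ff: "frechet_derivative (F n) (at y) = D n y" for n y
    using C1_on_UNIV_frechet_derivative[OF FD Dcont] by auto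
  have wd: "has_weak_deriv S (\<lambda>x. F n (h x)) (\<lambda>x a. D n (h x) (dh x a))" for n
    using has_weak_deriv_compose[OF assms FC, of n "norm b"] D_le by (simp add: Ff)
  \<comment> \<open>The arctangent is bounded by pi/2, which is less than 2.\<close>
  have F_le: "norm (F n y) \<le> 2 / real (Suc n)" for n y
    using arctan_bounded[of "real (Suc n) * (y \<bullet> b)"] pi_less_4 by (auto simp: F_def divide_simps abs_le_iff)
  have Flim: "(\<lambda>n. F n y) \<longlonglongrightarrow> 0" for y
  proof (rule Lim_null_comparison[of _ "\<lambda>n. 2 / real (Suc n)"])
    show "(\<lambda>n. 2 / real (Suc n)) \<longlonglongrightarrow> 0"
      using tendsto_mult_right_zero[OF LIMSEQ_inverse_real_of_nat, of 2] by (simp add: divide_inverse)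
  qed (use F_le in auto)
  have qlim: "(\<lambda>n. D n (h x) (dh x a)) \<longlonglongrightarrow> q x a" for x a
  proof (cases "h x \<bullet> b = 0")
    case False
    have "(\<lambda>n. (dh x a \<bullet> b) / (1 + (real (Suc n) * (h x \<bullet> b))\<^sup>2)) \<longlonglongrightarrow> 0"
    proof (rule Lim_null_comparison[of _ "\<lambda>n. (\<bar>dh x a \<bullet> b\<bar> / (h x \<bullet> b)\<^sup>2) * inverse (real (Suc n))"])
      show "\<forall>\<^sub>F n in sequentially. norm ((dh x a \<bullet> b) / (1 + (real (Suc n) * (h x \<bullet> b))\<^sup>2))
         \<le> (\<bar>dh x a \<bullet> b\<bar> / (h x \<bullet> b)\<^sup>2) * inverse (real (Suc n))"
      proof (intro always_eventually allI)
        fix n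
        have "real (Suc n) * (h x \<bullet> b)\<^sup>2 \<le> (real (Suc n))\<^sup>2 * (h x \<bullet> b)\<^sup>2"
          by (intro mult_right_mono self_le_power) auto
        then have "(h x \<bullet> b)\<^sup>2 * real (Suc n) \<le> 1 + (real (Suc n) * (h x \<bullet> b))\<^sup>2"
          by (simp add: power_mult_distrib mult.commute del: of_nat_Suc)
        then have "\<bar>dh x a \<bullet> b\<bar> / (1 + (real (Suc n) * (h x \<bullet> b))\<^sup>2) \<le> \<bar>dh x a \<bullet> b\<bar> / ((h x \<bullet> b)\<^sup>2 * real (Suc n))"
          using False by (intro divide_left_mono) (auto intro!: mult_pos_pos add_pos_nonneg simp del: of_nat_Suc)
        then show "norm ((dh x a \<bullet> b) / (1 + (real (Suc n) * (h x \<bullet> b))\<^sup>2))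
         \<le> (\<bar>dh x a \<bullet> b\<bar> / (h x \<bullet> b)\<^sup>2) * inverse (real (Suc n))"
          using abs_of_nonneg[of "1 + (real (Suc n) * (h x \<bullet> b))\<^sup>2"]
          by (simp add: divide_inverse mult.assoc abs_mult del: of_nat_Suc)
      qed
      show "(\<lambda>n. (\<bar>dh x a \<bullet> b\<bar> / (h x \<bullet> b)\<^sup>2) * inverse (real (Suc n))) \<longlonglongrightarrow> 0"
        by (rule tendsto_mult_right_zero[OF LIMSEQ_inverse_real_of_nat])
    qed
    then show ?thesis using False by (simp add: q_def D_def)
  qed (simp add: q_def D_def)
  \<comment> \<open>As a weak derivative of the zero function, \<open>q\<close> integrates to 0
    against every test function.\<close>
  have "has_weak_deriv S (\<lambda>x. 0) q"
  proof (rule has_weak_deriv_dominated_limit[where f = "\<lambda>n x. F n (h x)" and df = "\<lambda>n x a. D n (h x) (dh x a)"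
      and b = "\<lambda>_. 2" and c = "\<lambda>x a. norm b * norm (dh x a)", OF wd])
    show "loc_integrable_on (\<lambda>x. 2::real) S"
      by (auto simp: loc_integrable_on_def intro: absolutely_integrable_on_const lmeasurable_compact)
    show "loc_integrable_on (\<lambda>x. norm b * norm (dh x a)) S" for a
      using h by (auto simp: has_weak_deriv_def loc_integrable_on_def intro!: set_integrable_mult_right set_integrable_norm)
    show "AE x\<in>S in lebesgue. norm (F n (h x)) \<le> 2" for n
      using order_trans[OF F_le[of n], of 2] by (simp add: divide_le_eq)
  qed (use Flim qlim D_le in auto)
  then have lq: "loc_integrable_on (\<lambda>x. q x a) S"
    and "\<And>\<phi>. test_fun S \<phi> \<Longrightarrow> (LINT x:S|lebesgue. \<phi> x *\<^sub>R q x a) = 0"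
    by (simp_all add: has_weak_deriv_def set_lebesgue_integral_def)
  then have "AE x\<in>S in lebesgue. q x a = 0"
    by (intro fundamental_lemma_calculus_of_variations[OF assms(1) lq])
  then show ?thesis by eventually_elim (auto simp: q_def)
qed

lemma weak_deriv_eq_0_on_zero_set:
  fixes h :: "real^'m \<Rightarrow> 'b::euclidean_space"
  assumes "open S" "has_weak_deriv S h dh"
  shows "AE x\<in>S in lebesgue. h x = 0 \<longrightarrow> dh x a = 0"
proof -
  have "AE x in lebesgue. \<forall>b\<in>Basis. x \<in> S \<longrightarrow> h x \<bullet> b = 0 \<longrightarrow> dh x a \<bullet> b = 0"
    by (intro AE_finite_allI weak_deriv_eq_0_on_zero_set_inner[OF assms]) simp
  then show ?thesis
    by eventually_elim (auto intro!: euclidean_eqI[where 'a='b])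
qed

lemma weak_deriv_eq_on_coincidence_set:
  fixes f g :: "real^'m \<Rightarrow> 'b::euclidean_space"
  assumes "open S" "has_weak_deriv S f df" "has_weak_deriv S g dg"
  shows "AE x\<in>S in lebesgue. f x = g x \<longrightarrow> df x a = dg x a"
  using weak_deriv_eq_0_on_zero_set[OF assms(1) has_weak_deriv_diff[OF assms(2,3)], of a] by simp

section \<open>Orthogonal projections and symmetry of second derivatives\<close>

lemma orth_proj_eqI:
  fixes S :: "'a::euclidean_space set"
  assumes "subspace S" "w \<in> S" "v - w \<in> S\<^sup>\<bottom>"
  shows "orth_proj S v = w"
  unfolding orth_proj_def
proof (rule the_equality)
  fix w' assume w': "w' \<in> S \<and> v - w' \<in> S\<^sup>\<bottom>"
  have "(v - w) - (v - w') \<in> S\<^sup>\<bottom>"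
    using w' assms(3) subspace_diff[OF subspace_orthogonal_comp] by blast
  then have 1: "w' - w \<in> S\<^sup>\<bottom>" by simp
  have "w' - w \<in> S" using w' assms(1,2) by (simp add: subspace_diff)
  then have "(w' - w) \<bullet> (w' - w) = 0" using 1 by (simp add: orthogonal_comp_def orthogonal_def)
  then show "w' = w" by simp
qed (use assms in auto)

lemma orth_proj:
  fixes S :: "'a::euclidean_space set"
  assumes "subspace S"
  shows orth_proj_in: "orth_proj S v \<in> S"
    and orth_proj_compl: "v - orth_proj S v \<in> S\<^sup>\<bottom>"
proof -
  obtain x y where "v = x + y" "x \<in> S" "y \<in> S\<^sup>\<bottom>"
    using subspace_sum_orthogonal_comp[OF assms] set_plus_elim[of v S "S\<^sup>\<bottom>"] by auto
  moreover from this have "orth_proj S v = x" by (intro orth_proj_eqI assms) auto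
  ultimately show "orth_proj S v \<in> S" "v - orth_proj S v \<in> S\<^sup>\<bottom>" by auto
qed

lemma orth_proj_ident: "subspace S \<Longrightarrow> v \<in> S \<Longrightarrow> orth_proj S v = v"
  by (rule orth_proj_eqI) (auto simp: subspace_0 subspace_orthogonal_comp)

lemma orth_proj_linear:
  fixes S :: "'a::euclidean_space set"
  assumes "subspace S"
  shows "linear (orth_proj S)"
proof (rule linearI)
  note o = subspace_orthogonal_comp[of S]
  show "orth_proj S (x + y) = orth_proj S x + orth_proj S y" for x y
  proof (rule orth_proj_eqI[OF assms])
    show "x + y - (orth_proj S x + orth_proj S y) \<in> S\<^sup>\<bottom>"
      using subspace_add[OF o orth_proj_compl[OF assms, of x] orth_proj_compl[OF assms, of y]]
      by (simp add: algebra_simps)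
  qed (simp add: assms orth_proj_in subspace_add)
  show "orth_proj S (c *\<^sub>R x) = c *\<^sub>R orth_proj S x" for c x
  proof (rule orth_proj_eqI[OF assms])
    show "c *\<^sub>R x - c *\<^sub>R orth_proj S x \<in> S\<^sup>\<bottom>"
      using subspace_scale[OF o orth_proj_compl[OF assms, of x], of c] by (simp add: scaleR_diff_right)
  qed (simp add: assms orth_proj_in subspace_scale)
qed

lemma orth_proj_orthogonal_comp:
  fixes S :: "'a::euclidean_space set"
  assumes "subspace S"
  shows "orth_proj (S\<^sup>\<bottom>) v = v - orth_proj S v"
  by (rule orth_proj_eqI)
     (simp_all add: subspace_orthogonal_comp orth_proj_compl orth_proj_in assms orthogonal_comp_self)

lemma orth_proj_inner:
  fixes S :: "'a::euclidean_space set"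
  assumes "subspace S"
  shows "orth_proj S v \<bullet> w = v \<bullet> orth_proj S w"
proof -
  have o: "orth_proj S x \<bullet> (y - orth_proj S y) = 0" for x y
    using orth_proj_compl[OF assms, of y] orth_proj_in[OF assms, of x]
    by (simp add: orthogonal_comp_def orthogonal_def)
  have "orth_proj S v \<bullet> w = orth_proj S v \<bullet> orth_proj S w"
    using o[of v w] by (simp add: inner_diff_right)
  also have "\<dots> = v \<bullet> orth_proj S w" using o[of w v] by (simp add: inner_diff_right inner_commute)
  finally show ?thesis .
qed

lemma matrix_orth_proj:
  fixes S :: "(real^'d) set"
  assumes "subspace S"
  shows "matrix (orth_proj S) *v v = orth_proj S v"
    and "matrix (orth_proj S) ** matrix (orth_proj S) = matrix (orth_proj S)"
    and "transpose (matrix (orth_proj S)) = matrix (orth_proj S)"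
proof -
  note lin = orth_proj_linear[OF assms]
  show 1: "matrix (orth_proj S) *v v = orth_proj S v" for v
    by (simp add: matrix_works lin)
  show "matrix (orth_proj S) ** matrix (orth_proj S) = matrix (orth_proj S)"
    by (subst matrix_eq)
       (simp add: matrix_vector_mul_assoc[symmetric] 1 orth_proj_ident[OF assms orth_proj_in[OF assms]])
  show "transpose (matrix (orth_proj S)) = matrix (orth_proj S)"
    using orth_proj_inner[OF assms, of "axis _ 1" "axis _ 1"]
    by (simp add: vec_eq_iff transpose_def matrix_def inner_axis inner_axis')
qed

section \<open>Symmetry of second derivatives\<close>

lemma second_difference_estimate:
  fixes f :: "'a::real_normed_vector \<Rightarrow> 'b::euclidean_space" and f' :: "'a \<Rightarrow> 'a \<Rightarrow>\<^sub>L 'b"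
  assumes U: "open U" "p \<in> U" and f: "\<And>x. x \<in> U \<Longrightarrow> (f has_derivative blinfun_apply (f' x)) (at x)"
    and f': "(f' has_derivative f'') (at p)" and "0 < e"
  shows "\<exists>d>0. \<forall>h. 0 < h \<and> h < d \<longrightarrow>
    \<bar>(f (p + h *\<^sub>R X + h *\<^sub>R Y) - f (p + h *\<^sub>R X) - f (p + h *\<^sub>R Y) + f p) \<bullet> b - h * (h * (f'' Y X \<bullet> b))\<bar>
      \<le> h * (h * (e * (2 * norm X + norm Y) * norm X * norm b))"
proof -
  obtain r where r: "0 < r" "ball p r \<subseteq> U" using U open_contains_ball by blast
  obtain \<delta> where \<delta>: "0 < \<delta>" "\<And>y. norm (y - p) < \<delta> \<Longrightarrow> norm (f' y - f' p - f'' (y - p)) \<le> e * norm (y - p)"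
    using f' \<open>0 < e\<close> unfolding has_derivative_at_alt by metis
  \<comment> \<open>For \<open>h < d\<close> all points of the parallelogram spanned by
    \<open>h *\<^sub>R X\<close> and \<open>h *\<^sub>R Y\<close> are within
    \<open>min r \<delta>\<close> of \<open>p\<close>; the summand 1 in the denominator covers
    vanishing \<open>X\<close> and \<open>Y\<close>.\<close>
  define d where "d = min r \<delta> / (norm X + norm Y + 1)"
  have n0: "0 < norm X + norm Y + 1" by (simp add: add_nonneg_pos)
  have "0 < d" using r(1) \<delta>(1) n0 by (simp add: d_def)
  have lin: "linear f''" using f' by (rule has_derivative_linear)
  show ?thesis
  proof (intro exI[of _ d] conjI allI impI \<open>0 < d\<close>)
    fix h assume h: "0 < h \<and> h < d"
    have small: "norm (s *\<^sub>R X + t *\<^sub>R Y) < min r \<delta>" if "0 \<le> s" "s \<le> h" "0 \<le> t" "t \<le> h" for s t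
    proof -
      have "norm (s *\<^sub>R X + t *\<^sub>R Y) \<le> h * norm X + h * norm Y"
        using that by (intro norm_triangle_mono) (auto intro!: mult_right_mono)
      also have "\<dots> < h * (norm X + norm Y + 1)" using h by (simp add: algebra_simps)
      also have "\<dots> \<le> min r \<delta>" using h n0 by (simp add: d_def pos_less_divide_eq less_imp_le)
      finally show ?thesis .
    qed
    \<comment> \<open>The mean value theorem in \<open>s\<close> turns the second difference into
      \<open>h\<close> times a difference of \<open>f'\<close>. Since \<open>f'\<close> is
      differentiable at \<open>p\<close> alone, that difference is then evaluated by the first-order
      expansion at \<open>p\<close> and not by a second mean value.\<close>
    define k where "k s = (f (p + s *\<^sub>R X + h *\<^sub>R Y) - f (p + s *\<^sub>R X)) \<bullet> b" for s
    have inU: "p + s *\<^sub>R X + t *\<^sub>R Y \<in> U" if "0 \<le> s" "s \<le> h" "0 \<le> t" "t \<le> h" for s t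
    proof (rule subsetD[OF r(2)])
      have "dist (p + (s *\<^sub>R X + t *\<^sub>R Y)) p < r" using small[OF that] by (simp add: dist_norm)
      then show "p + s *\<^sub>R X + t *\<^sub>R Y \<in> ball p r"
        unfolding mem_ball add.assoc by (subst dist_commute)
    qed
    have k': "(k has_real_derivative (f' (p + s *\<^sub>R X + h *\<^sub>R Y) X - f' (p + s *\<^sub>R X) X) \<bullet> b) (at s)"
      if "0 \<le> s" "s \<le> h" for s
    proof -
      have u: "p + s *\<^sub>R X + h *\<^sub>R Y \<in> U" "p + s *\<^sub>R X \<in> U"
        using inU[of s h] inU[of s 0] that h by auto
      have "((\<lambda>s. p + s *\<^sub>R X + h *\<^sub>R Y) has_derivative (\<lambda>t. t *\<^sub>R X)) (at s)"
        "((\<lambda>s. p + s *\<^sub>R X) has_derivative (\<lambda>t. t *\<^sub>R X)) (at s)"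
        by (auto intro!: derivative_eq_intros)
      from has_derivative_compose[OF this(1) f[OF u(1)]] has_derivative_compose[OF this(2) f[OF u(2)]]
      have "(k has_derivative (\<lambda>t. (f' (p + s *\<^sub>R X + h *\<^sub>R Y) (t *\<^sub>R X) - f' (p + s *\<^sub>R X) (t *\<^sub>R X)) \<bullet> b)) (at s)"
        unfolding k_def by (intro has_derivative_inner_left has_derivative_diff)
      then show ?thesis
        by (rule has_derivative_imp_has_field_derivative) (simp add: blinfun.scaleR_right inner_diff_left algebra_simps)
    qed
    obtain s where s: "0 < s" "s < h" and eq: "k h - k 0 = (h - 0) * ((f' (p + s *\<^sub>R X + h *\<^sub>R Y) X - f' (p + s *\<^sub>R X) X) \<bullet> b)"
      using MVT2[of 0 h k "\<lambda>s. (f' (p + s *\<^sub>R X + h *\<^sub>R Y) X - f' (p + s *\<^sub>R X) X) \<bullet> b"] k' h by auto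
    define R where "R v = f' (p + v) - f' p - f'' v" for v
    have R: "norm (R v) \<le> e * norm v" if "norm v < \<delta>" for v
      using \<delta>(2)[of "p + v"] that by (simp add: R_def)
    have f'R: "f' (p + v) = f' p + f'' v + R v" for v by (simp add: R_def)
    define v1 where "v1 = s *\<^sub>R X + h *\<^sub>R Y"
    define v2 where "v2 = s *\<^sub>R X"
    have v: "norm v1 < \<delta>" "norm v2 < \<delta>"
      using small[of s h] small[of s 0] s h by (auto simp: v1_def v2_def)
    \<comment> \<open>Adding the two remainder bounds produces the factor
      \<open>2 * norm X + norm Y\<close>.\<close>
    have nv: "norm v1 \<le> h * norm X + h * norm Y" "norm v2 \<le> h * norm X"
      using s h by (auto simp: v1_def v2_def intro!: norm_triangle_mono mult_right_mono)
    have "f' (p + v1) - f' (p + v2) = f'' (v1 - v2) + (R v1 - R v2)"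
      by (simp add: f'R linear_diff[OF lin])
    also have "f'' (v1 - v2) = h *\<^sub>R f'' Y" by (simp add: v1_def v2_def linear_cmul[OF lin])
    finally have "f' (p + v1) X - f' (p + v2) X = h *\<^sub>R f'' Y X + (R v1 - R v2) X"
      by (metis blinfun.add_left blinfun.diff_left blinfun.scaleR_left)
    then have 1: "(f' (p + v1) X - f' (p + v2) X) \<bullet> b - h * (f'' Y X \<bullet> b) = (R v1 - R v2) X \<bullet> b"
      by (simp add: inner_add_left)
    have "\<bar>(R v1 - R v2) X \<bullet> b\<bar> \<le> norm (R v1 - R v2) * norm X * norm b"
      using Cauchy_Schwarz_ineq2[of "(R v1 - R v2) X" b] norm_blinfun[of "R v1 - R v2" X]
      by (meson mult_right_mono norm_ge_zero order_trans)
    also have "\<dots> \<le> (e * (h * norm X + h * norm Y) + e * (h * norm X)) * norm X * norm b"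
    proof (intro mult_right_mono)
      have "norm (R v1 - R v2) \<le> norm (R v1) + norm (R v2)" by (rule norm_triangle_ineq4)
      also have "\<dots> \<le> e * norm v1 + e * norm v2" using R[OF v(1)] R[OF v(2)] by simp
      also have "\<dots> \<le> e * (h * norm X + h * norm Y) + e * (h * norm X)"
        using nv \<open>0 < e\<close> by (intro add_mono mult_left_mono) auto
      finally show "norm (R v1 - R v2) \<le> e * (h * norm X + h * norm Y) + e * (h * norm X)" .
    qed auto
    also have "\<dots> = h * (e * (2 * norm X + norm Y) * norm X * norm b)" by (simp add: algebra_simps)
    finally have 2: "\<bar>(f' (p + v1) X - f' (p + v2) X) \<bullet> b - h * (f'' Y X \<bullet> b)\<bar> \<le> h * (e * (2 * norm X + norm Y) * norm X * norm b)"
      unfolding 1 .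
    have kk: "k h - k 0 = (f (p + h *\<^sub>R X + h *\<^sub>R Y) - f (p + h *\<^sub>R X) - f (p + h *\<^sub>R Y) + f p) \<bullet> b"
      by (simp add: k_def inner_diff_left inner_add_left)
    have "(f (p + h *\<^sub>R X + h *\<^sub>R Y) - f (p + h *\<^sub>R X) - f (p + h *\<^sub>R Y) + f p) \<bullet> b - h * (h * (f'' Y X \<bullet> b))
      = h * ((f' (p + v1) X - f' (p + v2) X) \<bullet> b - h * (f'' Y X \<bullet> b))"
      unfolding kk[symmetric] eq by (simp add: v1_def v2_def right_diff_distrib add.assoc)
    then show "\<bar>(f (p + h *\<^sub>R X + h *\<^sub>R Y) - f (p + h *\<^sub>R X) - f (p + h *\<^sub>R Y) + f p) \<bullet> b - h * (h * (f'' Y X \<bullet> b))\<bar>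
      \<le> h * (h * (e * (2 * norm X + norm Y) * norm X * norm b))"
      using 2 h by (simp add: abs_mult mult_left_mono)
  qed
qed

text \<open>The second difference is unchanged when \<open>X\<close> and \<open>Y\<close> are
  exchanged, while its quotient by \<open>h * h\<close> approximates \<open>f'' Y X\<close> as well
  as \<open>f'' X Y\<close>.\<close>

lemma second_derivative_symmetric:
  fixes f :: "'a::real_normed_vector \<Rightarrow> 'b::euclidean_space" and f' :: "'a \<Rightarrow> 'a \<Rightarrow>\<^sub>L 'b"
  assumes U: "open U" "p \<in> U" and f: "\<And>x. x \<in> U \<Longrightarrow> (f has_derivative blinfun_apply (f' x)) (at x)"
    and f': "(f' has_derivative f'') (at p)"
  shows "f'' X Y = f'' Y X"
proof (rule euclidean_eqI)
  fix b :: 'b assume "b \<in> Basis"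
  define c where "c = (2 * norm X + norm Y) * norm X * norm b + (2 * norm Y + norm X) * norm Y * norm b"
  have le: "\<bar>f'' X Y \<bullet> b - f'' Y X \<bullet> b\<bar> \<le> e * c" if "0 < e" for e
  proof -
    obtain d1 where d1: "d1 > 0" "\<forall>h. 0 < h \<and> h < d1 \<longrightarrow>
      \<bar>(f (p + h *\<^sub>R X + h *\<^sub>R Y) - f (p + h *\<^sub>R X) - f (p + h *\<^sub>R Y) + f p) \<bullet> b - h * (h * (f'' Y X \<bullet> b))\<bar>
      \<le> h * (h * (e * (2 * norm X + norm Y) * norm X * norm b))"
      using second_difference_estimate[OF U f f' \<open>0 < e\<close>, of X Y b] by blast
    obtain d2 where d2: "d2 > 0" "\<forall>h. 0 < h \<and> h < d2 \<longrightarrow>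
      \<bar>(f (p + h *\<^sub>R Y + h *\<^sub>R X) - f (p + h *\<^sub>R Y) - f (p + h *\<^sub>R X) + f p) \<bullet> b - h * (h * (f'' X Y \<bullet> b))\<bar>
      \<le> h * (h * (e * (2 * norm Y + norm X) * norm Y * norm b))"
      using second_difference_estimate[OF U f f' \<open>0 < e\<close>, of Y X b] by blast
    define h where "h = min d1 d2 / 2"
    have h: "0 < h" "h < d1" "h < d2" using d1(1) d2(1) by (auto simp: h_def)
    define \<Delta> where "\<Delta> = (f (p + h *\<^sub>R X + h *\<^sub>R Y) - f (p + h *\<^sub>R X) - f (p + h *\<^sub>R Y) + f p) \<bullet> b"
    have \<Delta>: "(f (p + h *\<^sub>R Y + h *\<^sub>R X) - f (p + h *\<^sub>R Y) - f (p + h *\<^sub>R X) + f p) \<bullet> b = \<Delta>"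
      by (simp add: \<Delta>_def algebra_simps)
    have "\<bar>\<Delta> - h * (h * (f'' Y X \<bullet> b))\<bar> \<le> h * (h * (e * (2 * norm X + norm Y) * norm X * norm b))"
      "\<bar>\<Delta> - h * (h * (f'' X Y \<bullet> b))\<bar> \<le> h * (h * (e * (2 * norm Y + norm X) * norm Y * norm b))"
      using d1(2) d2(2) h \<Delta> unfolding \<Delta>_def by auto
    then have "\<bar>h * (h * (f'' X Y \<bullet> b)) - h * (h * (f'' Y X \<bullet> b))\<bar> \<le> h * (h * (e * c))"
    proof -
      have "h * (h * (e * c)) = h * (h * (e * (2 * norm X + norm Y) * norm X * norm b))
          + h * (h * (e * (2 * norm Y + norm X) * norm Y * norm b))"
        by (simp add: c_def algebra_simps)
      then show ?thesis
        using \<open>\<bar>\<Delta> - h * (h * (f'' Y X \<bullet> b))\<bar> \<le> _\<close> \<open>\<bar>\<Delta> - h * (h * (f'' X Y \<bullet> b))\<bar> \<le> _\<close>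
        by linarith
    qed
    then have "(h * h) * \<bar>f'' X Y \<bullet> b - f'' Y X \<bullet> b\<bar> \<le> (h * h) * (e * c)"
      using h(1) by (simp add: abs_mult right_diff_distrib[symmetric] mult.assoc)
    then show ?thesis using h(1) by (simp only: mult_le_cancel_left_pos mult_pos_pos)
  qed
  have "\<bar>f'' X Y \<bullet> b - f'' Y X \<bullet> b\<bar> \<le> 0"
  proof (rule field_le_epsilon)
    fix e :: real assume "0 < e"
    have "0 \<le> c" by (simp add: c_def)
    then have "\<bar>f'' X Y \<bullet> b - f'' Y X \<bullet> b\<bar> \<le> e / (c + 1) * c"
      using \<open>0 < e\<close> by (intro le) (simp add: divide_pos_pos)
    also have "\<dots> \<le> 0 + e" using \<open>0 < e\<close> \<open>0 \<le> c\<close> by (simp add: divide_le_eq mult_left_mono)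
    finally show "\<bar>f'' X Y \<bullet> b - f'' Y X \<bullet> b\<bar> \<le> 0 + e" .
  qed
  then show "f'' X Y \<bullet> b = f'' Y X \<bullet> b" by simp
qed

section \<open>Tangent spaces and their projections\<close>

text \<open>The chain rule along a curve in \<open>N\<close> with velocity \<open>X\<close>. Through
  this lemma identities that hold only on \<open>N\<close> are differentiated; \<open>H\<close> may
  be anything off \<open>N\<close>.\<close>

lemma derivative_eq_0_of_tangent:
  fixes H :: "'a::euclidean_space \<Rightarrow> 'b::real_normed_vector"
  assumes "open U" "p \<in> U" and H: "(H has_derivative H') (at p)"
    and 0: "\<And>q. q \<in> U \<Longrightarrow> q \<in> N \<Longrightarrow> H q = 0" and "X \<in> tangent_space N p"
  shows "H' X = 0"
proof -
  obtain \<gamma> e where \<gamma>: "0 < e" "\<gamma> ` {-e<..<e} \<subseteq> N" "\<gamma> 0 = p" "(\<gamma> has_vector_derivative X) (at 0)"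
    using assms(5) unfolding tangent_space_def by blast
  have "continuous (at 0) \<gamma>" using \<gamma>(4) has_vector_derivative_continuous by blast
  then have "\<forall>\<^sub>F t in at 0. \<gamma> t \<in> U"
    using \<gamma>(3) assms(1,2) by (auto simp: continuous_at intro: topological_tendstoD)
  moreover have "\<forall>\<^sub>F t in at 0. t \<in> {-e<..<e}"
    using \<gamma>(1) by (intro eventually_at_in_open') auto
  ultimately have ev: "\<forall>\<^sub>F t in at 0. H (\<gamma> t) = 0"
    by eventually_elim (use 0 \<gamma>(2) in blast)
  have "0 \<in> {-e<..<e}" using \<gamma>(1) by simp
  then have "p \<in> N" using \<gamma>(2,3) by blast
  have "((\<lambda>t. H (\<gamma> t)) has_derivative (\<lambda>t. H' (t *\<^sub>R X))) (at 0)"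
    using has_derivative_compose[OF \<gamma>(4)[unfolded has_vector_derivative_def]] H \<gamma>(3) by simp
  then have "((\<lambda>t. 0) has_derivative (\<lambda>t. H' (t *\<^sub>R X))) (at 0)"
    by (rule has_derivative_transform_eventually) (use ev 0 assms(2) \<open>p \<in> N\<close> \<gamma>(3) in auto)
  then have "(\<lambda>t::real. H' (t *\<^sub>R X)) = (\<lambda>t. 0)" by (rule has_derivative_unique) simp
  then have "H' (1 *\<^sub>R X) = 0" by meson
  then show ?thesis by simp
qed

text \<open>
  Writing \<open>L\<^sup>\<bottom>\<close> for the complement of the model space of a flattening chart \<open>\<Phi>\<close>, the map \<open>G\<close> is the
  \<open>L\<^sup>\<bottom>\<close>-component of \<open>\<Phi>\<close>: a defining function of \<open>N\<close> whose derivative has constant range.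
\<close>

lemma submanifold_defining_function:
  fixes N :: "'a::euclidean_space set"
  assumes "C2_submanifold n N" "p \<in> N"
  obtains U and G :: "'a \<Rightarrow> 'a" and C :: "'a \<Rightarrow> 'a \<Rightarrow>\<^sub>L 'a" and R where
    "open U" "p \<in> U" "\<And>q. q \<in> U \<Longrightarrow> (G has_derivative blinfun_apply (C q)) (at q)" "C1_on U C"
    "\<And>q. q \<in> U \<Longrightarrow> q \<in> N \<longleftrightarrow> G q = 0"
    "\<And>q. q \<in> U \<Longrightarrow> q \<in> N \<Longrightarrow> tangent_space N q = {v. C q v = 0}"
    "subspace R" "\<And>q. q \<in> U \<Longrightarrow> range (C q) = R"
proof -
  obtain U V L and \<Phi> \<Psi> :: "'a \<Rightarrow> 'a" where U: "open U" "p \<in> U" and V: "open V" and L: "subspace L"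
    and hom: "homeomorphism U V \<Phi> \<Psi>" and \<Phi>C: "C2_on U \<Phi>" and \<Psi>C: "C2_on V \<Psi>"
    and im: "\<Phi> ` (U \<inter> N) = V \<inter> L"
    using assms(1)[unfolded C2_submanifold_def, rule_format, OF assms(2)] by (elim exE conjE)
  obtain \<Phi>' :: "'a \<Rightarrow> 'a \<Rightarrow>\<^sub>L 'a" where \<Phi>': "\<And>q. q \<in> U \<Longrightarrow> (\<Phi> has_derivative blinfun_apply (\<Phi>' q)) (at q)" "C1_on U \<Phi>'"
    using \<Phi>C unfolding C2_on_def by blast
  obtain \<Psi>' :: "'a \<Rightarrow> 'a \<Rightarrow>\<^sub>L 'a" where \<Psi>': "\<And>q. q \<in> V \<Longrightarrow> (\<Psi> has_derivative blinfun_apply (\<Psi>' q)) (at q)" "C1_on V \<Psi>'"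
    using \<Psi>C unfolding C2_on_def by blast
  have \<Psi>\<Phi>: "\<Psi> (\<Phi> q) = q" "\<Phi> q \<in> V" if "q \<in> U" for q
    using hom that by (auto simp: homeomorphism_def)
  have \<Phi>\<Psi>: "\<Phi> (\<Psi> y) = y" "\<Psi> y \<in> U" if "y \<in> V" for y
    using hom that by (auto simp: homeomorphism_def)
  \<comment> \<open>Differentiating both compositions of \<Phi> and \<Psi> shows that their
    derivatives are mutually inverse. This yields the constant range of \<open>C\<close> and the
    velocity of the curve constructed below.\<close>
  have inv1: "\<Psi>' (\<Phi> q) (\<Phi>' q v) = v" if "q \<in> U" for q v
  proof -
    have "((\<lambda>q. \<Psi> (\<Phi> q)) has_derivative (\<lambda>v. \<Psi>' (\<Phi> q) (\<Phi>' q v))) (at q)"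
      by (rule has_derivative_compose[OF \<Phi>'(1)[OF that] \<Psi>'(1)[OF \<Psi>\<Phi>(2)[OF that]]])
    moreover have "((\<lambda>q. \<Psi> (\<Phi> q)) has_derivative (\<lambda>v. v)) (at q)"
      by (rule has_derivative_transform_within_open[OF has_derivative_ident U(1) that]) (simp add: \<Psi>\<Phi>)
    ultimately have "(\<lambda>v. \<Psi>' (\<Phi> q) (\<Phi>' q v)) = (\<lambda>v. v)" by (rule has_derivative_unique)
    then show ?thesis by meson
  qed
  have inv2: "\<Phi>' q (\<Psi>' (\<Phi> q) v) = v" if "q \<in> U" for q v
  proof -
    have y: "\<Phi> q \<in> V" "\<Psi> (\<Phi> q) = q" using \<Psi>\<Phi> that by auto
    have d: "(\<Phi> has_derivative blinfun_apply (\<Phi>' q)) (at (\<Psi> (\<Phi> q)))" using \<Phi>'(1)[OF that] y by simp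
    have "((\<lambda>y. \<Phi> (\<Psi> y)) has_derivative (\<lambda>v. \<Phi>' q (\<Psi>' (\<Phi> q) v))) (at (\<Phi> q))"
      by (rule has_derivative_compose[OF \<Psi>'(1)[OF y(1)] d])
    moreover have "((\<lambda>y. \<Phi> (\<Psi> y)) has_derivative (\<lambda>v. v)) (at (\<Phi> q))"
      by (rule has_derivative_transform_within_open[OF has_derivative_ident V y(1)]) (simp add: \<Phi>\<Psi>)
    ultimately have "(\<lambda>v. \<Phi>' q (\<Psi>' (\<Phi> q) v)) = (\<lambda>v. v)" by (rule has_derivative_unique)
    then show ?thesis by meson
  qed
  define Q where "Q = orth_proj (L\<^sup>\<bottom>)"
  have sub: "subspace (L\<^sup>\<bottom>)" by (rule subspace_orthogonal_comp)
  have Qbl: "bounded_linear Q"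
    using orth_proj_linear[OF sub] by (simp add: Q_def linear_conv_bounded_linear)
  have Q0: "Q y = 0 \<longleftrightarrow> y \<in> L" for y
    using orth_proj_in[OF L, of y] orth_proj_ident[OF L, of y]
    by (auto simp: Q_def orth_proj_orthogonal_comp[OF L])
  define C where "C q = Blinfun Q o\<^sub>L \<Phi>' q" for q
  have C: "C q v = Q (\<Phi>' q v)" for q v
    by (simp add: C_def bounded_linear_Blinfun_apply[OF Qbl])
  show thesis
  proof (rule that[of U "\<lambda>q. Q (\<Phi> q)" C "L\<^sup>\<bottom>", OF U _ _ _ _ sub])
    show "((\<lambda>q. Q (\<Phi> q)) has_derivative blinfun_apply (C q)) (at q)" if "q \<in> U" for q
      using bounded_linear.has_derivative[OF Qbl \<Phi>'(1)[OF that]] by (simp add: C[abs_def])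
    show "C1_on U C"
      unfolding C_def
      by (rule C1_on_bounded_linear[OF bounded_bilinear.bounded_linear_right[OF bounded_bilinear_blinfun_compose] \<Phi>'(2)])
    show N: "q \<in> N \<longleftrightarrow> Q (\<Phi> q) = 0" if "q \<in> U" for q
    proof
      assume "q \<in> N"
      then show "Q (\<Phi> q) = 0" unfolding Q0 using im that by blast
    next
      assume "Q (\<Phi> q) = 0"
      then have "\<Phi> q \<in> \<Phi> ` (U \<inter> N)" unfolding im Q0 using \<Psi>\<Phi>(2)[OF that] by blast
      then obtain q' where "q' \<in> U" "q' \<in> N" "\<Phi> q = \<Phi> q'" by blast
      then show "q \<in> N" using \<Psi>\<Phi>(1) that by metis
    qed
    show "range (C q) = L\<^sup>\<bottom>" if "q \<in> U" for q
    proof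
      show "range (C q) \<subseteq> L\<^sup>\<bottom>" using orth_proj_in[OF sub] by (auto simp: C Q_def)
      show "L\<^sup>\<bottom> \<subseteq> range (C q)"
      proof
        fix y assume "y \<in> L\<^sup>\<bottom>"
        then have "C q (\<Psi>' (\<Phi> q) y) = y"
          using orth_proj_ident[OF sub] by (simp add: C inv2[OF that] Q_def)
        then show "y \<in> range (C q)" by (metis rangeI)
      qed
    qed
    show "tangent_space N q = {v. C q v = 0}" if q: "q \<in> U" "q \<in> N" for q
    proof (intro equalityI subsetI)
      fix v assume v: "v \<in> tangent_space N q"
      have "((\<lambda>q. Q (\<Phi> q)) has_derivative blinfun_apply (C q)) (at q)"
        using bounded_linear.has_derivative[OF Qbl \<Phi>'(1)[OF q(1)]] by (simp add: C[abs_def])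
      then have "C q v = 0"
        by (rule derivative_eq_0_of_tangent[OF U(1) q(1) _ _ v]) (simp add: N)
      then show "v \<in> {v. C q v = 0}" by simp
    next
      fix v assume "v \<in> {v. C q v = 0}"
      then have w: "\<Phi>' q v \<in> L" by (simp add: C Q0)
      define w where "w = \<Phi>' q v"
      \<comment> \<open>A straight line in \<open>L\<close> through \<open>\<Phi> q\<close>, carried
        back by \<Psi>, stays in \<open>N\<close>; its velocity at 0 is \<Psi>' applied to \<Phi>'
        v, that is, \<open>v\<close>.\<close>
      define \<gamma> where "\<gamma> t = \<Psi> (\<Phi> q + t *\<^sub>R w)" for t
      have "open ((\<lambda>t. \<Phi> q + t *\<^sub>R w) -` V)" by (intro open_vimage V continuous_intros)
      moreover have "0 \<in> (\<lambda>t. \<Phi> q + t *\<^sub>R w) -` V" using \<Psi>\<Phi>(2)[OF q(1)] by simp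
      ultimately obtain e where e: "0 < e" "ball 0 e \<subseteq> (\<lambda>t. \<Phi> q + t *\<^sub>R w) -` V"
        using open_contains_ball by blast
      have inV: "\<Phi> q + t *\<^sub>R w \<in> V" if "t \<in> {-e<..<e}" for t
      proof -
        have "t \<in> ball 0 e" using that by (auto simp: dist_real_def)
        then show ?thesis using e(2) by blast
      qed
      have dl: "((\<lambda>t. \<Phi> q + t *\<^sub>R w) has_derivative (\<lambda>s. s *\<^sub>R w)) (at t)" for t
        by (auto intro!: derivative_eq_intros)
      have d: "(\<gamma> has_vector_derivative \<Psi>' (\<Phi> q + t *\<^sub>R w) w) (at t)" if "t \<in> {-e<..<e}" for t
        using has_derivative_compose[OF dl \<Psi>'(1)[OF inV[OF that]]]
        by (simp add: has_vector_derivative_def \<gamma>_def[abs_def] blinfun.scaleR_right)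
      have "\<gamma> C1_differentiable_on {-e<..<e}"
        unfolding C1_differentiable_on_def
      proof (intro exI conjI ballI)
        show "(\<gamma> has_vector_derivative \<Psi>' (\<Phi> q + t *\<^sub>R w) w) (at t)" if "t \<in> {-e<..<e}" for t
          using that by (rule d)
        show "continuous_on {-e<..<e} (\<lambda>t. \<Psi>' (\<Phi> q + t *\<^sub>R w) w)"
          using inV by (intro continuous_intros continuous_on_compose2[OF C1_on_imp_continuous_on[OF \<Psi>'(2)]]) auto
      qed
      moreover have "\<gamma> ` {-e<..<e} \<subseteq> N"
      proof
        fix y assume "y \<in> \<gamma> ` {-e<..<e}"
        then obtain t where t: "t \<in> {-e<..<e}" "y = \<gamma> t" by blast
        have "\<Phi> q \<in> L" using im q by blast
        then have "\<Phi> q + t *\<^sub>R w \<in> V \<inter> L"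
          using inV[OF t(1)] w L by (simp add: w_def subspace_add subspace_scale)
        then obtain q' where "q' \<in> U" "q' \<in> N" "\<Phi> q + t *\<^sub>R w = \<Phi> q'" using im by blast
        then show "y \<in> N" using \<Psi>\<Phi>(1) t(2) by (simp add: \<gamma>_def)
      qed
      moreover have "\<gamma> 0 = q" using \<Psi>\<Phi>(1)[OF q(1)] by (simp add: \<gamma>_def)
      moreover have "(\<gamma> has_vector_derivative v) (at 0)"
        using d[of 0] e(1) inv1[OF q(1)] by (simp add: w_def)
      ultimately show "v \<in> tangent_space N q"
        unfolding tangent_space_def using e(1) by blast
    qed
  qed
qed

lemma tangent_space_subspace:
  assumes "C2_submanifold n N" "p \<in> N"
  shows "subspace (tangent_space N p)"
proof (rule submanifold_defining_function[OF assms])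
  fix U G R and C :: "'a \<Rightarrow> 'a \<Rightarrow>\<^sub>L 'a"
  assume "p \<in> U" "\<And>q. q \<in> U \<Longrightarrow> q \<in> N \<Longrightarrow> tangent_space N q = {v. C q v = 0}"
  then have "tangent_space N p = {v. C p v = 0}" using assms(2) by blast
  then show ?thesis
    by (simp add: subspace_def blinfun.zero_right blinfun.add_right blinfun.scaleR_right)
qed

text \<open>The orthogonal projection onto the kernel of \<open>C\<close> is \<open>1 - C\<^sup>T (C C\<^sup>T + P\<^sub>R\<^sub>\<bottom>)\<^sup>-\<^sup>1 C\<close>.\<close>

lemma C1_kernel_projection:
  fixes C :: "'a::euclidean_space \<Rightarrow> (real^'d) \<Rightarrow>\<^sub>L (real^'d)"
  assumes C: "C1_on U C" and R: "subspace R" "\<And>q. q \<in> U \<Longrightarrow> range (C q) = R"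
  obtains F :: "'a \<Rightarrow> real^'d^'d" where "C1_on U F"
    "\<And>q. q \<in> U \<Longrightarrow> F q = matrix (orth_proj {v. C q v = 0})"
proof -
  define M where "M q = matrix (blinfun_apply (C q))" for q
  \<comment> \<open>M M^T is degenerate exactly on the complement of \<open>R\<close>. As
    \<open>R\<close> is the same for all \<open>q\<close>, the correction \<open>P\<close> is
    constant and costs no regularity.\<close>
  define P where "P = matrix (orth_proj (R\<^sup>\<bottom>))"
  define S where "S q = M q ** transpose (M q) + P" for q
  \<comment> \<open>Column \<open>k\<close> of \<open>X q\<close> is the Cramer solution of
    \<open>S q *v y = column k (M q)\<close>; thus \<open>S q ** X q = M q\<close>.\<close>
  define X where "X q = transpose (\<chi> k. \<chi> l. det (\<chi> i j. if j = l then M q $ i $ k else S q $ i $ j) / det (S q))" for q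
  define F where "F q = mat 1 - transpose (M q) ** X q" for q
  have sub: "subspace (R\<^sup>\<bottom>)" by (rule subspace_orthogonal_comp)
  have Mv: "M q *v v = C q v" for q v
    by (simp add: M_def matrix_works bounded_linear.linear[OF blinfun.bounded_linear_right])
  have MC: "C1_on U M"
  proof -
    have "C1_on U (\<lambda>q. \<chi> i j. C q (axis j 1) $ i)"
      by (intro C1_on_vec_lambda C1_on_vec_nth C1_on_bounded_linear[OF blinfun.bounded_linear_left C])
    then show ?thesis by (simp add: M_def[abs_def] matrix_def)
  qed
  have SC: "C1_on U S"
  proof -
    have "C1_on U (\<lambda>q. (\<chi> i j. (\<Sum>k\<in>UNIV. M q $ i $ k * M q $ j $ k)) + P)"
      by (intro C1_on_add C1_on_const C1_on_vec_lambda C1_on_sum C1_on_mult C1_on_vec_nth MC)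
    then show ?thesis by (simp add: S_def[abs_def] matrix_matrix_mult_def transpose_def)
  qed
  have detS: "det (S q) \<noteq> 0" if "q \<in> U" for q
  proof -
    \<comment> \<open>The quadratic form of \<open>S q\<close> at \<open>w\<close> is |M^T w|^2 + |P
      w|^2. If it vanishes, \<open>w\<close> lies in the range \<open>R\<close> of
      \<open>M q\<close> and is orthogonal to that range.\<close>
    have "w = 0" if "S q *v w = 0" for w
    proof -
      have "0 = w \<bullet> (S q *v w)" using that by simp
      also have "\<dots> = (transpose (M q) *v w) \<bullet> (transpose (M q) *v w) + w \<bullet> orth_proj (R\<^sup>\<bottom>) w"
        by (simp add: S_def matrix_vector_mult_add_rdistrib matrix_vector_mul_assoc[symmetric]
            inner_add_right dot_lmul_matrix[symmetric] P_def matrix_orth_proj[OF sub] vector_transpose_matrix)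
      also have "w \<bullet> orth_proj (R\<^sup>\<bottom>) w = orth_proj (R\<^sup>\<bottom>) w \<bullet> orth_proj (R\<^sup>\<bottom>) w"
        using orth_proj_inner[OF sub, of w "orth_proj (R\<^sup>\<bottom>) w"]
        by (simp add: orth_proj_ident[OF sub orth_proj_in[OF sub]])
      finally have "(transpose (M q) *v w) \<bullet> (transpose (M q) *v w) = 0" "orth_proj (R\<^sup>\<bottom>) w \<bullet> orth_proj (R\<^sup>\<bottom>) w = 0"
        using inner_ge_zero[of "transpose (M q) *v w"] inner_ge_zero[of "orth_proj (R\<^sup>\<bottom>) w"] by linarith+
      then have a: "transpose (M q) *v w = 0" and b: "orth_proj (R\<^sup>\<bottom>) w = 0" by simp_all
      then have "w \<in> R" using orth_proj_in[OF R(1), of w] by (simp add: orth_proj_orthogonal_comp[OF R(1)])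
      then obtain v where v: "w = M q *v v" using R(2)[OF \<open>q \<in> U\<close>] by (auto simp: Mv)
      have "w \<bullet> w = (transpose (M q) *v w) \<bullet> v"
        by (subst (2) v) (simp add: dot_lmul_matrix[symmetric] vector_transpose_matrix)
      then show "w = 0" using a by simp
    qed
    then show ?thesis
      by (metis invertible_det_nz invertible_left_inverse matrix_left_invertible_ker)
  qed
  have SX: "S q ** X q = M q" if "q \<in> U" for q
  proof -
    have "S q *v column k (X q) = column k (M q)" for k
      by (subst cramer[OF detS[OF that]]) (simp add: X_def column_def transpose_def vec_eq_iff cong: if_cong)
    then have "(S q ** X q) $ i $ k = M q $ i $ k" for i k
      by (simp add: vec_eq_iff column_def matrix_vector_mult_def matrix_matrix_mult_def)
    then show ?thesis by (simp add: vec_eq_iff)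
  qed
  have XC: "C1_on U (\<lambda>q. X q $ l $ k)" for l k
  proof -
    have "C1_on U (\<lambda>q. \<chi> l. det (\<chi> i j. if j = l then (\<chi> i. M q $ i $ k) $ i else S q $ i $ j) / det (S q))"
      by (intro C1_on_solve SC detS C1_on_vec_lambda C1_on_vec_nth MC)
    from C1_on_vec_nth[OF this, of l] show ?thesis by (simp add: X_def transpose_def cong: if_cong)
  qed
  show thesis
  proof
    have "C1_on U (\<lambda>q. mat 1 - (\<chi> i j. \<Sum>k\<in>UNIV. M q $ k $ i * X q $ k $ j))"
      by (intro C1_on_diff C1_on_const C1_on_vec_lambda C1_on_sum C1_on_mult C1_on_vec_nth MC XC)
    then show "C1_on U F" by (simp add: F_def[abs_def] matrix_matrix_mult_def transpose_def)
    fix q assume q: "q \<in> U"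
    define K where "K = {v. C q v = 0}"
    have K: "subspace K"
      by (simp add: K_def subspace_def blinfun.zero_right blinfun.add_right blinfun.scaleR_right)
    have PR: "orth_proj (R\<^sup>\<bottom>) y = 0" if "y \<in> R" for y
      using orth_proj_ident[OF R(1) that] by (simp add: orth_proj_orthogonal_comp[OF R(1)])
    have MR: "M q *v y \<in> R" for y using R(2)[OF q] by (auto simp: Mv)
    have "F q *v v = orth_proj K v" for v
    proof (rule orth_proj_eqI[OF K, symmetric])
      define y where "y = X q *v v"
      have Fv: "F q *v v = v - transpose (M q) *v y"
        by (simp add: F_def y_def matrix_vector_mult_diff_rdistrib matrix_vector_mul_assoc)
      have "S q *v y = M q *v v" by (simp add: y_def matrix_vector_mul_assoc SX[OF q])
      then have eq: "M q *v (transpose (M q) *v y) + orth_proj (R\<^sup>\<bottom>) y = M q *v v"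
        by (simp add: S_def P_def matrix_vector_mult_add_rdistrib
            matrix_vector_mul_assoc[symmetric] matrix_orth_proj[OF sub])
      \<comment> \<open>This component of \<open>y\<close> equals M v - M M^T y, so it lies in
        \<open>R\<close> and in its complement. What remains of the equation is M (F v) = 0.\<close>
      have "orth_proj (R\<^sup>\<bottom>) y = 0"
      proof -
        have "orth_proj (R\<^sup>\<bottom>) y = M q *v v - M q *v (transpose (M q) *v y)" using eq by (simp add: algebra_simps)
        then have "orth_proj (R\<^sup>\<bottom>) y \<in> R" using subspace_diff[OF R(1) MR MR] by simp
        from PR[OF this] show ?thesis by (simp add: orth_proj_ident[OF sub orth_proj_in[OF sub]])
      qed
      then have "M q *v (F q *v v) = 0"
        using eq by (simp add: Fv matrix_vector_mult_diff_distrib)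
      then show "F q *v v \<in> K" by (simp add: K_def Mv)
      show "v - F q *v v \<in> K\<^sup>\<bottom>"
        unfolding orthogonal_comp_def orthogonal_def
      proof (intro CollectI ballI)
        fix k assume "k \<in> K"
        then have "M q *v k = 0" by (simp add: K_def Mv)
        moreover have "k \<bullet> (transpose (M q) *v y) = (M q *v k) \<bullet> y"
          using dot_lmul_matrix[of y "M q" k] by (simp add: inner_commute)
        ultimately show "k \<bullet> (v - F q *v v) = 0" by (simp add: Fv)
      qed
    qed
    then have "F q = matrix (orth_proj K)" by (metis matrix_of_matrix_vector_mul ext)
    then show "F q = matrix (orth_proj {v. C q v = 0})" by (simp add: K_def)
  qed
qed

section \<open>The second fundamental form\<close>

lemma tangential_projection:
  fixes N :: "(real^'d) set"
  assumes "C2_submanifold n N" "p \<in> N"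
  obtains U F where "open U" "p \<in> U" "C1_on U F"
    "\<And>q. q \<in> U \<Longrightarrow> q \<in> N \<Longrightarrow> F q = matrix (tangential N q)"
proof (rule submanifold_defining_function[OF assms])
  fix U R and G :: "real^'d \<Rightarrow> real^'d" and C :: "real^'d \<Rightarrow> (real^'d) \<Rightarrow>\<^sub>L (real^'d)"
  assume U: "open U" "p \<in> U" and C: "C1_on U C"
    and T: "\<And>q. q \<in> U \<Longrightarrow> q \<in> N \<Longrightarrow> tangent_space N q = {v. C q v = 0}"
    and R: "subspace R" "\<And>q. q \<in> U \<Longrightarrow> range (C q) = R"
  obtain F where F: "C1_on U F" "\<And>q. q \<in> U \<Longrightarrow> F q = matrix (orth_proj {v. C q v = 0})"
    using C1_kernel_projection[OF C R] by blast
  show thesis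
    by (rule that[OF U F(1)]) (simp add: F(2) tangential_def T)
qed

lemma tangential_in: "C2_submanifold n N \<Longrightarrow> p \<in> N \<Longrightarrow> tangential N p v \<in> tangent_space N p"
  unfolding tangential_def by (intro orth_proj_in tangent_space_subspace)

lemma tangential_ident: "C2_submanifold n N \<Longrightarrow> p \<in> N \<Longrightarrow> v \<in> tangent_space N p \<Longrightarrow> tangential N p v = v"
  unfolding tangential_def by (intro orth_proj_ident tangent_space_subspace)

lemma normal_part_eq: "C2_submanifold n N \<Longrightarrow> p \<in> N \<Longrightarrow> normal_part N p v = v - tangential N p v"
  unfolding tangential_def normal_part_def by (intro orth_proj_orthogonal_comp tangent_space_subspace)

lemma normal_part_in: "normal_part N p v \<in> (tangent_space N p)\<^sup>\<bottom>"
  unfolding normal_part_def by (intro orth_proj_in subspace_orthogonal_comp)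

text \<open>
  Differentiating \<open>C Z = 0\<close> along \<open>N\<close>, where \<open>C = DG\<close> for a defining function \<open>G\<close>, expresses the
  second fundamental form through the symmetric second derivative of \<open>G\<close>.
\<close>

lemma second_ff:
  fixes N :: "(real^'d) set"
  assumes N: "C2_submanifold n N" "p \<in> N"
  obtains C :: "(real^'d) \<Rightarrow>\<^sub>L (real^'d)" and H where
    "\<And>Y. linear (\<lambda>X. H X Y)" "\<And>X. linear (\<lambda>Y. H X Y)" "\<And>X Y. H X Y = H Y X"
    "\<And>v w. v - w \<in> (tangent_space N p)\<^sup>\<bottom> \<Longrightarrow> C v = C w \<Longrightarrow> v = w"
    "\<And>X Y. second_ff N p X Y \<in> (tangent_space N p)\<^sup>\<bottom>"
    "\<And>X Y. C (second_ff N p X Y) = H (tangential N p X) (tangential N p Y)"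
    "\<And>U Z X Y. open U \<Longrightarrow> p \<in> U \<Longrightarrow> C1_on U Z \<Longrightarrow> (\<And>q. q \<in> U \<Longrightarrow> q \<in> N \<Longrightarrow> Z q \<in> tangent_space N q) \<Longrightarrow>
      Z p = tangential N p Y \<Longrightarrow>
      second_ff N p X Y = normal_part N p (frechet_derivative Z (at p) (tangential N p X))"
proof (rule submanifold_defining_function[OF N])
  fix U R and G :: "real^'d \<Rightarrow> real^'d" and C :: "real^'d \<Rightarrow> (real^'d) \<Rightarrow>\<^sub>L (real^'d)"
  assume U: "open U" "p \<in> U" and G: "\<And>q. q \<in> U \<Longrightarrow> (G has_derivative blinfun_apply (C q)) (at q)"
    and C: "C1_on U C" and T: "\<And>q. q \<in> U \<Longrightarrow> q \<in> N \<Longrightarrow> tangent_space N q = {v. C q v = 0}"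
  define C' where "C' = frechet_derivative C (at p)"
  have C': "(C has_derivative C') (at p)" unfolding C'_def by (rule C1_on_frechet(1)[OF C U(2)])
  have linC': "linear C'" using C' by (rule has_derivative_linear)
  have Tp: "tangent_space N p = {v. C p v = 0}" using T U(2) N(2) by blast
  \<comment> \<open>The kernel of \<open>C p\<close> is the tangent space, so \<open>C p\<close> is
    injective on normal vectors and identities between them can be checked after applying
    it.\<close>
  have inj: "v = w" if vw: "v - w \<in> (tangent_space N p)\<^sup>\<bottom>" "C p v = C p w" for v w
  proof -
    have "v - w \<in> tangent_space N p" using vw(2) by (simp add: Tp blinfun.diff_right)
    then have "(v - w) \<bullet> (v - w) = 0" using vw(1) by (simp add: orthogonal_comp_def orthogonal_def)
    then show ?thesis by simp
  qed
  have key: "C p (normal_part N p (frechet_derivative Z (at p) (tangential N p X))) = - C' (tangential N p X) (tangential N p Y)"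
    if Z: "open U'" "p \<in> U'" "C1_on U' Z" "\<And>q. q \<in> U' \<Longrightarrow> q \<in> N \<Longrightarrow> Z q \<in> tangent_space N q"
      "Z p = tangential N p Y" for U' Z X Y
  proof -
    have "((\<lambda>q. C q (Z q)) has_derivative
        (\<lambda>v. C p (frechet_derivative Z (at p) v) + C' v (Z p))) (at p)"
      by (rule bounded_bilinear.FDERIV[OF bounded_bilinear_blinfun_apply C' C1_on_frechet(1)[OF Z(3,2)]])
    from derivative_eq_0_of_tangent[OF open_Int[OF U(1) Z(1)] _ this _ tangential_in[OF N]]
    have "C p (frechet_derivative Z (at p) (tangential N p X)) + C' (tangential N p X) (Z p) = 0"
      using U(2) Z(2,4) T by auto
    moreover have "C p (tangential N p v) = 0" for v
      using tangential_in[OF N, of v] by (simp add: Tp)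
    ultimately show ?thesis
      by (simp add: normal_part_eq[OF N] blinfun.diff_right Z(5) eq_neg_iff_add_eq_0)
  qed
  \<comment> \<open>Uniqueness in the definite description: by \<open>key\<close>, the image under
    \<open>C p\<close> depends on the field only through its value at \<open>p\<close>.\<close>
  have eq: "second_ff N p X Y = normal_part N p (frechet_derivative Z (at p) (tangential N p X))"
    if Z: "open U'" "p \<in> U'" "C1_on U' Z" "\<And>q. q \<in> U' \<Longrightarrow> q \<in> N \<Longrightarrow> Z q \<in> tangent_space N q"
      "Z p = tangential N p Y" for U' Z X Y
    unfolding second_ff_def
  proof (rule the_equality)
    show "\<exists>U Z'. open U \<and> p \<in> U \<and> C1_on U Z' \<and> (\<forall>q\<in>U \<inter> N. Z' q \<in> tangent_space N q) \<and>
        Z' p = tangential N p Y \<and>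
        normal_part N p (frechet_derivative Z (at p) (tangential N p X)) =
        normal_part N p (frechet_derivative Z' (at p) (tangential N p X))"
      using Z by (intro exI[of _ U'] exI[of _ Z]) auto
    fix a
    assume "\<exists>U Z'. open U \<and> p \<in> U \<and> C1_on U Z' \<and> (\<forall>q\<in>U \<inter> N. Z' q \<in> tangent_space N q) \<and>
        Z' p = tangential N p Y \<and> a = normal_part N p (frechet_derivative Z' (at p) (tangential N p X))"
    then obtain U2 Z2 where Z2: "open U2" "p \<in> U2" "C1_on U2 Z2" "\<And>q. q \<in> U2 \<Longrightarrow> q \<in> N \<Longrightarrow> Z2 q \<in> tangent_space N q"
      "Z2 p = tangential N p Y" and a: "a = normal_part N p (frechet_derivative Z2 (at p) (tangential N p X))"
      by (elim exE conjE) blast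
    show "a = normal_part N p (frechet_derivative Z (at p) (tangential N p X))"
      unfolding a
      by (rule inj[OF subspace_diff[OF subspace_orthogonal_comp normal_part_in normal_part_in]])
         (simp only: key[OF Z2] key[OF Z])
  qed
  obtain U1 F where F: "open U1" "p \<in> U1" "C1_on U1 F"
    "\<And>q. q \<in> U1 \<Longrightarrow> q \<in> N \<Longrightarrow> F q = matrix (tangential N q)"
    using tangential_projection[OF N] by blast
  have Fv: "F q *v v = tangential N q v" if "q \<in> U1" "q \<in> N" for q v
    using matrix_orth_proj(1)[OF tangent_space_subspace[OF N(1) that(2)]] by (simp add: F(4)[OF that] tangential_def)
  \<comment> \<open>Existence in the definite description: projecting a constant vector gives a
    tangent field with any prescribed tangential value at \<open>p\<close>.\<close>
  have Z: "C1_on U1 (\<lambda>q. F q *v Y)" for Y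
    by (rule C1_on_bounded_linear[OF _ F(3)])
       (simp add: linear_conv_bounded_linear[symmetric] linear_iff matrix_vector_mult_add_rdistrib scaleR_matrix_vector_assoc)
  have Z2: "q \<in> U1 \<Longrightarrow> q \<in> N \<Longrightarrow> F q *v Y \<in> tangent_space N q" for q Y
    using tangential_in[OF N(1)] by (simp add: Fv)
  have char: "C p (second_ff N p X Y) = - C' (tangential N p X) (tangential N p Y)" for X Y
    using key[OF F(1,2) Z Z2 Fv[OF F(2) N(2)]] eq[OF F(1,2) Z Z2 Fv[OF F(2) N(2)]] by simp
  show thesis
  proof (rule that[of "\<lambda>X Y. - C' X Y" "C p"])
    show "linear (\<lambda>X. - C' X Y)" for Y
      by (intro linearI) (simp_all add: linear_add[OF linC'] linear_cmul[OF linC'] blinfun.add_left blinfun.scaleR_left)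
    show "linear (\<lambda>Y. - C' X Y)" for X
      by (intro linearI) (simp_all add: blinfun.add_right blinfun.scaleR_right)
    show "- C' X Y = - C' Y X" for X Y
      using second_derivative_symmetric[OF U G C', of X Y] by simp
    show "second_ff N p X Y \<in> (tangent_space N p)\<^sup>\<bottom>" for X Y
      using eq[OF F(1,2) Z[of Y] Z2 Fv[OF F(2) N(2)], of X] normal_part_in by simp
  qed (fact inj char eq)+
qed

section \<open>The connection form as a commutator\<close>

lemma bounded_bilinear_matrix_mult: "bounded_bilinear ((**) :: real^'d^'d \<Rightarrow> real^'d^'d \<Rightarrow> real^'d^'d)"
  by (rule bilinear_conv_bounded_bilinear[THEN iffD1])
     (auto simp: bilinear_def linear_iff matrix_matrix_mult_def vec_eq_iff sum.distrib sum_distrib_left algebra_simps)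

lemma connection_projection_identity:
  fixes N :: "(real^'d) set" and F :: "real^'d \<Rightarrow> real^'d^'d"
  assumes N: "C2_submanifold n N" "p \<in> N" and X: "X \<in> tangent_space N p"
    and U: "open U" "p \<in> U" and F: "C1_on U F" "\<And>q. q \<in> U \<Longrightarrow> q \<in> N \<Longrightarrow> F q = matrix (tangential N q)"
  shows "frechet_derivative F (at p) X +
    commutator (\<chi> i j. - (\<Sum>k\<in>UNIV. (A_coeff N p i j k - A_coeff N p j i k) * X $ k)) (matrix (tangential N p)) = 0"
proof (rule second_ff[OF N])
  fix C :: "(real^'d) \<Rightarrow>\<^sub>L (real^'d)" and H
  assume H: "\<And>Y. linear (\<lambda>X. H X Y)" "\<And>X. linear (\<lambda>Y. H X Y)" "\<And>X Y. H X Y = H Y X"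
    and inj: "\<And>v w. v - w \<in> (tangent_space N p)\<^sup>\<bottom> \<Longrightarrow> C v = C w \<Longrightarrow> v = w"
    and nor: "\<And>X Y. second_ff N p X Y \<in> (tangent_space N p)\<^sup>\<bottom>"
    and char: "\<And>X Y. C (second_ff N p X Y) = H (tangential N p X) (tangential N p Y)"
    and eq: "\<And>U Z X Y. open U \<Longrightarrow> p \<in> U \<Longrightarrow> C1_on U Z \<Longrightarrow> (\<And>q. q \<in> U \<Longrightarrow> q \<in> N \<Longrightarrow> Z q \<in> tangent_space N q) \<Longrightarrow>
      Z p = tangential N p Y \<Longrightarrow>
      second_ff N p X Y = normal_part N p (frechet_derivative Z (at p) (tangential N p X))"
  note sub = tangent_space_subspace[OF N]
  note nsub = subspace_orthogonal_comp[of "tangent_space N p"]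
  define P where "P = matrix (tangential N p)"
  define D where "D = frechet_derivative F (at p) X"
  have Pv: "P *v v = tangential N p v" and PP: "P ** P = P" and PT: "transpose P = P" for v
    using matrix_orth_proj[OF sub] by (simp_all add: P_def tangential_def)
  have Fp: "F p = P" using F(2)[OF U(2) N(2)] by (simp add: P_def)
  have FD: "(F has_derivative frechet_derivative F (at p)) (at p)"
    by (rule C1_on_frechet(1)[OF F(1) U(2)])
  have Fq: "F q ** F q = F q" "transpose (F q) = F q" "F q *v v = tangential N q v" if "q \<in> U" "q \<in> N" for q v
    using matrix_orth_proj[OF tangent_space_subspace[OF N(1) that(2)]] by (simp_all add: F(2)[OF that] tangential_def)
  have tl: "bounded_linear (transpose :: real^'d^'d \<Rightarrow> real^'d^'d)"
    by (auto simp: linear_conv_bounded_linear[symmetric] linear_iff transpose_def vec_eq_iff)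
  \<comment> \<open>\<open>F\<close> is idempotent and symmetric on \<open>N\<close> only. The
    tangent direction \<open>X\<close> nevertheless gives the derivatives of both identities: P D +
    D P = D and D^T = D.\<close>
  have "((\<lambda>q. F q ** F q - F q) has_derivative
      (\<lambda>v. F p ** frechet_derivative F (at p) v + frechet_derivative F (at p) v ** F p - frechet_derivative F (at p) v)) (at p)"
    by (intro has_derivative_diff bounded_bilinear.FDERIV[OF bounded_bilinear_matrix_mult] FD)
  from derivative_eq_0_of_tangent[OF U this _ X] have "F p ** D + D ** F p - D = 0"
    by (simp add: Fq D_def)
  then have D: "P ** D + D ** P = D" by (simp add: Fp)
  have "((\<lambda>q. transpose (F q) - F q) has_derivative
      (\<lambda>v. transpose (frechet_derivative F (at p) v) - frechet_derivative F (at p) v)) (at p)"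
    by (intro has_derivative_diff bounded_linear.has_derivative[OF tl] FD)
  from derivative_eq_0_of_tangent[OF U this _ X] have "transpose D - D = 0"
    by (simp add: Fq D_def)
  then have DT: "transpose D = D" by simp
  have tlin: "linear (tangential N p)" unfolding tangential_def by (rule orth_proj_linear[OF sub])
  have lin: "linear (second_ff N p Y)" for Y
  proof (rule linearI)
    show "second_ff N p Y (a + b) = second_ff N p Y a + second_ff N p Y b" for a b
      by (rule inj[OF subspace_diff[OF nsub nor subspace_add[OF nsub nor nor]]])
         (simp add: char blinfun.add_right linear_add[OF tlin] linear_add[OF H(2)])
    show "second_ff N p Y (c *\<^sub>R a) = c *\<^sub>R second_ff N p Y a" for a c
      by (rule inj[OF subspace_diff[OF nsub nor subspace_scale[OF nsub nor]]])
         (simp add: char blinfun.scaleR_right linear_cmul[OF tlin] linear_cmul[OF H(2)])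
  qed
  have sym: "second_ff N p Y Z = second_ff N p Z Y" for Y Z
    by (rule inj[OF subspace_diff[OF nsub nor nor]]) (simp add: char H(3))
  have sff: "second_ff N p X Y = D *v Y - P *v (D *v Y)" for Y
  proof -
    have l: "bounded_linear (\<lambda>M. M *v Y)" for Y :: "real^'d"
      by (simp add: linear_conv_bounded_linear[symmetric] linear_iff matrix_vector_mult_add_rdistrib scaleR_matrix_vector_assoc)
    have "((\<lambda>q. F q *v Y) has_derivative (\<lambda>v. frechet_derivative F (at p) v *v Y)) (at p)"
      by (rule bounded_linear.has_derivative[OF l FD])
    then have fd: "frechet_derivative (\<lambda>q. F q *v Y) (at p) = (\<lambda>v. frechet_derivative F (at p) v *v Y)"
      using frechet_derivative_at by metis
    have "second_ff N p X Y = normal_part N p (frechet_derivative (\<lambda>q. F q *v Y) (at p) (tangential N p X))"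
      by (rule eq[OF U C1_on_bounded_linear[OF l F(1)]])
         (simp_all add: Fq U N tangential_in[OF N(1)])
    then show ?thesis
      by (simp add: fd tangential_ident[OF N X] normal_part_eq[OF N] Pv D_def)
  qed
  \<comment> \<open>In \<open>A_coeff\<close> the vector \<open>X\<close> enters the second slot,
    that of the field. Symmetry moves it to the slot of the differentiation direction, where
    \<open>sff\<close> applies.\<close>
  have A: "(\<Sum>k\<in>UNIV. A_coeff N p i j k * X $ k) = (D - P ** D) $ i $ j" for i j
  proof -
    have "X = (\<Sum>k\<in>UNIV. X $ k *\<^sub>R axis k 1)"
      by (simp add: vec_eq_iff axis_def if_distrib[of "(*) _"] cong: if_cong)
    then have "second_ff N p (axis j 1) X = (\<Sum>k\<in>UNIV. X $ k *\<^sub>R second_ff N p (axis j 1) (axis k 1))"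
      by (metis (no_types, lifting) linear_sum[OF lin] linear_cmul[OF lin] sum.cong)
    then have "(\<Sum>k\<in>UNIV. A_coeff N p i j k * X $ k) = second_ff N p (axis j 1) X $ i"
      by (simp add: A_coeff_def mult.commute)
    also have "\<dots> = (D *v axis j 1 - P *v (D *v axis j 1)) $ i" by (simp add: sym[of "axis j 1"] sff)
    also have "\<dots> = ((D - P ** D) *v axis j 1) $ i"
      by (simp add: matrix_vector_mult_diff_rdistrib matrix_vector_mul_assoc)
    finally show ?thesis by (simp add: matrix_vector_mult_basis column_def)
  qed
  \<comment> \<open>The skew part of D - P D is needed: D is symmetric and cancels, and the
    transpose of P D is D P.\<close>
  have W: "(\<chi> i j. - (\<Sum>k\<in>UNIV. (A_coeff N p i j k - A_coeff N p j i k) * X $ k)) = P ** D - D ** P"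
  proof -
    have "transpose (P ** D) = D ** P" by (simp add: matrix_transpose_mul DT PT)
    then have PD: "(P ** D) $ j $ i = (D ** P) $ i $ j" for i j
      by (simp add: vec_eq_iff transpose_def)
    have DD: "D $ j $ i = D $ i $ j" for i j using DT by (simp add: vec_eq_iff transpose_def)
    show ?thesis
      by (simp add: vec_eq_iff left_diff_distrib sum_subtractf A PD DD)
  qed
  \<comment> \<open>Multiplying P D + D P = D by P from the left leaves P D P = 0, which removes the
    mixed terms of the commutator.\<close>
  have "P ** D ** P = 0"
  proof -
    have "P ** (P ** D + D ** P) = P ** D" by (simp add: D)
    then show ?thesis by (simp add: matrix_add_ldistrib matrix_mul_assoc PP)
  qed
  then have "commutator (P ** D - D ** P) P = - (P ** D + D ** P)"
    by (simp add: commutator_def bounded_bilinear.diff_left[OF bounded_bilinear_matrix_mult]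
        bounded_bilinear.diff_right[OF bounded_bilinear_matrix_mult] matrix_mul_assoc PP)
       (simp add: matrix_mul_assoc[symmetric] PP)
  then show ?thesis by (simp add: W D_def[symmetric] P_def[symmetric] D)
qed

section \<open>Parallel projections\<close>

text \<open>By Lindelof, countably many of the neighbourhoods in the target cover \<open>N\<close>,
  so the union of their exceptional sets is still a null set.\<close>

lemma AE_of_locally:
  fixes u :: "'x \<Rightarrow> 'a::euclidean_space"
  assumes "\<And>p. p \<in> N \<Longrightarrow> \<exists>W. open W \<and> p \<in> W \<and> (AE x in M. u x \<in> W \<longrightarrow> Q x)"
  shows "AE x in M. u x \<in> N \<longrightarrow> Q x"
proof -
  define \<W> where "\<W> = {W. open W \<and> (AE x in M. u x \<in> W \<longrightarrow> Q x)}"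
  obtain \<W>' where \<W>': "\<W>' \<subseteq> \<W>" "countable \<W>'" "\<Union>\<W>' = \<Union>\<W>"
    using Lindelof[of \<W>] by (auto simp: \<W>_def)
  have "N \<subseteq> \<Union>\<W>" using assms unfolding \<W>_def by blast
  have "AE x in M. \<forall>W\<in>\<W>'. u x \<in> W \<longrightarrow> Q x"
    using \<W>'(1,2) by (subst AE_ball_countable) (auto simp: \<W>_def)
  then show ?thesis
    by eventually_elim (use \<open>N \<subseteq> \<Union>\<W>\<close> \<W>'(3) in blast)
qed

lemma C1_on_cutoff_scaleR:
  fixes F :: "'a::euclidean_space \<Rightarrow> 'b::euclidean_space"
  assumes "C1_on UNIV \<theta>" "compact K" "K \<subseteq> U" "open U" "\<And>x. x \<notin> K \<Longrightarrow> \<theta> x = 0" "C1_on U F"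
  shows "C1_on UNIV (\<lambda>x. \<theta> x *\<^sub>R F x)"
proof -
  have o: "open (- K)" using assms(2) by (simp add: compact_imp_closed open_Compl)
  have 1: "C1_on U (\<lambda>x. \<theta> x *\<^sub>R F x)"
    by (intro C1_on_scaleR assms(6) C1_on_subset[OF assms(1)]) simp
  have "C1_on (- K) (\<lambda>x. \<theta> x *\<^sub>R F x) \<longleftrightarrow> C1_on (- K) (\<lambda>x. 0 :: 'b)"
    by (rule C1_on_cong[OF o]) (simp add: assms(5))
  then have "C1_on (U \<union> - K) (\<lambda>x. \<theta> x *\<^sub>R F x)"
    using C1_on_const by (intro C1_on_Un assms(4) o 1) blast
  moreover have "U \<union> - K = UNIV" using assms(3) by blast
  ultimately show ?thesis by simp
qed

text \<open>Compact support supplies the bounded derivative that the chain rule asks for. The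
  extension is glued by induction over a finite cover of \<open>K\<close>.\<close>

lemma projection_extension_compact:
  fixes N :: "(real^'d) set"
  assumes N: "C2_submanifold n N" and K: "compact K" "K \<subseteq> N"
  obtains F W K' where "C1_on UNIV F" "compact K'" "\<And>q. q \<notin> K' \<Longrightarrow> F q = 0" "open W" "K \<subseteq> W"
    "\<And>q. q \<in> W \<Longrightarrow> q \<in> N \<Longrightarrow> F q = matrix (tangential N q)"
proof -
  define patch where "patch W U F \<theta> C \<longleftrightarrow> open U \<and> C1_on U F \<and>
      (\<forall>q\<in>U. q \<in> N \<longrightarrow> F q = matrix (tangential N q)) \<and> C1_on UNIV \<theta> \<and> open W \<and>
      (\<forall>q\<in>W. \<theta> q = 1) \<and> compact C \<and> C \<subseteq> U \<and> (\<forall>q. q \<notin> C \<longrightarrow> \<theta> q = 0)"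
    for W U and F :: "real^'d \<Rightarrow> real^'d^'d" and \<theta> :: "real^'d \<Rightarrow> real" and C
  define \<W> where "\<W> = {W. \<exists>U F \<theta> C. patch W U F \<theta> C}"
  have "p \<in> \<Union>\<W>" if "p \<in> K" for p
  proof -
    obtain U F where U: "open U" "p \<in> U" "C1_on U F"
      "\<And>q. q \<in> U \<Longrightarrow> q \<in> N \<Longrightarrow> F q = matrix (tangential N q)"
      by (rule tangential_projection[OF N subsetD[OF K(2) \<open>p \<in> K\<close>]]) blast
    have p: "compact {p}" "{p} \<subseteq> U" using U(2) by auto
    show ?thesis
    proof (rule C1_cutoff[OF p(1) U(1) p(2)])
      fix \<theta> :: "real^'d \<Rightarrow> real" and W C
      assume "C1_on UNIV \<theta>" "open W" "{p} \<subseteq> W" "\<And>x. x \<in> W \<Longrightarrow> \<theta> x = 1"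
        "compact C" "C \<subseteq> U" "\<And>x. x \<notin> C \<Longrightarrow> \<theta> x = 0"
      then have "patch W U F \<theta> C" "p \<in> W" using U by (simp_all add: patch_def)
      then show ?thesis unfolding \<W>_def by blast
    qed
  qed
  moreover have open_\<W>: "open W" if "W \<in> \<W>" for W
    using that unfolding \<W>_def patch_def by blast
  ultimately obtain \<I> where I: "\<I> \<subseteq> \<W>" "finite \<I>" "K \<subseteq> \<Union>\<I>"
    using compactE[OF K(1), of \<W>] by (metis subsetI)
  have "finite \<I> \<Longrightarrow> \<I> \<subseteq> \<W> \<Longrightarrow> \<exists>F0 K0. C1_on UNIV F0 \<and> compact K0 \<and> (\<forall>q. q \<notin> K0 \<longrightarrow> F0 q = 0) \<and>
    (\<forall>q\<in>\<Union>\<I>. q \<in> N \<longrightarrow> F0 q = matrix (tangential N q))"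
  proof (induction \<I> rule: finite_induct)
    case empty
    show ?case by (intro exI[of _ "\<lambda>_. 0"] exI[of _ "{}"]) (simp add: C1_on_const)
  next
    case (insert W \<I>)
    then obtain F0 K0 where F0': "C1_on UNIV F0" "compact K0" "\<forall>q. q \<notin> K0 \<longrightarrow> F0 q = 0"
      "\<forall>q\<in>\<Union>\<I>. q \<in> N \<longrightarrow> F0 q = matrix (tangential N q)"
      by auto
    note F0 = F0'(1,2) F0'(3,4)[rule_format]
    obtain U F \<theta> C where "patch W U F \<theta> C" using insert.prems unfolding \<W>_def by blast
    then have U: "open U" "C1_on U F" and F: "\<And>q. q \<in> U \<Longrightarrow> q \<in> N \<Longrightarrow> F q = matrix (tangential N q)"
      and \<theta>: "C1_on UNIV \<theta>" "\<And>q. q \<in> W \<Longrightarrow> \<theta> q = 1" and C: "compact C" "C \<subseteq> U" "\<And>q. q \<notin> C \<Longrightarrow> \<theta> q = 0"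
      by (simp_all add: patch_def)
    \<comment> \<open>Correct on the enlarged cover: on \<open>W\<close> the weight is 1. On the
      older patches \<open>F0\<close> is correct; there either \<theta> is 0, or \<open>q\<close>
      lies in \<open>C\<close>, where \<open>F\<close> is correct too and the weights add up to
      1.\<close>
    define F1 where "F1 q = \<theta> q *\<^sub>R F q + (1 - \<theta> q) *\<^sub>R F0 q" for q
    have "C1_on UNIV F1"
      unfolding F1_def
      by (intro C1_on_add C1_on_cutoff_scaleR[OF \<theta>(1) C(1,2) U(1) C(3) U(2)] C1_on_scaleR C1_on_diff C1_on_const F0(1) \<theta>(1))
    moreover have "compact (C \<union> K0)" using C(1) F0(2) by (rule compact_Un)
    moreover have "F1 q = 0" if "q \<notin> C \<union> K0" for q using C(3) F0(3) that by (simp add: F1_def)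
    moreover have "F1 q = matrix (tangential N q)" if q: "q \<in> \<Union>(insert W \<I>)" "q \<in> N" for q
    proof (cases "q \<in> C")
      case True
      then have Fq: "F q = matrix (tangential N q)" using C(2) F q(2) by blast
      show ?thesis
      proof (cases "q \<in> W")
        case False
        then have "F0 q = matrix (tangential N q)" using F0(4) q by blast
        then show ?thesis by (simp add: F1_def Fq scaleR_left_distrib[symmetric])
      qed (simp add: F1_def Fq \<theta>(2))
    next
      case False
      then have \<theta>0: "\<theta> q = 0" by (rule C(3))
      then have "q \<notin> W" using \<theta>(2)[of q] by auto
      then have "F0 q = matrix (tangential N q)" using F0(4) q by blast
      then show ?thesis by (simp add: F1_def \<theta>0)
    qed
    ultimately show ?case by blast
  qed
  then obtain F0 K0 where F0': "C1_on UNIV F0" "compact K0" "\<forall>q. q \<notin> K0 \<longrightarrow> F0 q = 0"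
      "\<forall>q\<in>\<Union>\<I>. q \<in> N \<longrightarrow> F0 q = matrix (tangential N q)"
    using I(1,2) by auto
  note F0 = F0'(1,2) F0'(3,4)[rule_format]
  have o: "open (\<Union>\<I>)" using I(1) open_\<W> by blast
  show thesis by (rule that[OF F0(1,2,3) o I(3) F0(4)])
qed

lemma has_weak_deriv_compose_compact_support:
  fixes u :: "real^'m \<Rightarrow> 'a::euclidean_space" and F :: "'a \<Rightarrow> 'b::euclidean_space"
  assumes "open S" "has_weak_deriv S u du" "C1_on UNIV F" "compact K" "\<And>q. q \<notin> K \<Longrightarrow> F q = 0"
  shows "has_weak_deriv S (\<lambda>x. F (u x)) (\<lambda>x a. frechet_derivative F (at (u x)) (du x a))"
proof (rule C1_compact_support_bounded_derivative[OF assms(3,4,5)])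
  fix B assume "\<And>x v. norm (frechet_derivative F (at x) v) \<le> B * norm v"
  then show ?thesis by (rule has_weak_deriv_compose[OF assms(1,2,3)])
qed

lemma frechet_derivative_cong_open:
  assumes "open W" "p \<in> W" "\<And>q. q \<in> W \<Longrightarrow> f q = g q" "(g has_derivative D) (at p)"
  shows "frechet_derivative f (at p) = D"
proof -
  have "(f has_derivative D) (at p)"
    by (rule has_derivative_transform_within_open[OF assms(4,1,2)]) (simp add: assms(3))
  then show ?thesis using frechet_derivative_at by metis
qed

lemma weak_deriv_tangent:
  fixes N :: "(real^'d) set" and u :: "real^'m \<Rightarrow> real^'d"
  assumes N: "C2_submanifold n N" and "open S" and u: "has_weak_deriv S u du"
    and uN: "AE x\<in>S in lebesgue. u x \<in> N"
  shows "AE x\<in>S in lebesgue. du x a \<in> tangent_space N (u x)"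
proof -
  have "AE x in lebesgue. u x \<in> N \<longrightarrow> (x \<in> S \<longrightarrow> du x a \<in> tangent_space N (u x))"
  proof (rule AE_of_locally)
    fix p assume p: "p \<in> N"
    show "\<exists>W. open W \<and> p \<in> W \<and> (AE x in lebesgue. u x \<in> W \<longrightarrow> (x \<in> S \<longrightarrow> du x a \<in> tangent_space N (u x)))"
    proof (rule submanifold_defining_function[OF N p])
      fix U R and G :: "real^'d \<Rightarrow> real^'d" and C :: "real^'d \<Rightarrow> (real^'d) \<Rightarrow>\<^sub>L (real^'d)"
      assume U: "open U" "p \<in> U" and G: "\<And>q. q \<in> U \<Longrightarrow> (G has_derivative blinfun_apply (C q)) (at q)"
        and C: "C1_on U C" and GN: "\<And>q. q \<in> U \<Longrightarrow> q \<in> N \<longleftrightarrow> G q = 0"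
        and T: "\<And>q. q \<in> U \<Longrightarrow> q \<in> N \<Longrightarrow> tangent_space N q = {v. C q v = 0}"
      have GC: "C1_on U G"
        unfolding C1_on_def using G C1_on_imp_continuous_on[OF C] by blast
      have p': "compact {p}" "{p} \<subseteq> U" using U(2) by auto
      show ?thesis
      proof (rule C1_cutoff[OF p'(1) U(1) p'(2)])
        fix \<theta> :: "real^'d \<Rightarrow> real" and W K
        assume \<theta>: "C1_on UNIV \<theta>" and W: "open W" "{p} \<subseteq> W" "\<And>x. x \<in> W \<Longrightarrow> \<theta> x = 1"
          and K: "compact K" "K \<subseteq> U" "\<And>x. x \<notin> K \<Longrightarrow> \<theta> x = 0"
        have WU: "W \<subseteq> U" using W(3) K(2,3) by force
        \<comment> \<open>\<open>G\<close> has its properties only on \<open>U\<close>. The product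
          with \<theta> is a compactly supported map on the whole space, and it has the same
          derivative as \<open>G\<close> on \<open>W\<close>.\<close>
        define H where "H q = \<theta> q *\<^sub>R G q" for q
        have HC: "C1_on UNIV H"
          unfolding H_def by (rule C1_on_cutoff_scaleR[OF \<theta> K(1,2) U(1) K(3) GC])
        have wd: "has_weak_deriv S (\<lambda>x. H (u x)) (\<lambda>x a. frechet_derivative H (at (u x)) (du x a))"
          by (rule has_weak_deriv_compose_compact_support[OF assms(2) u HC K(1)]) (simp add: H_def K(3))
        have "AE x in lebesgue. u x \<in> W \<longrightarrow> (x \<in> S \<longrightarrow> du x a \<in> tangent_space N (u x))"
          using weak_deriv_eq_0_on_zero_set[OF assms(2) wd, of a] uN
        proof eventually_elim
          fix x assume 1: "x \<in> S \<longrightarrow> H (u x) = 0 \<longrightarrow> frechet_derivative H (at (u x)) (du x a) = 0"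
            and 2: "x \<in> S \<longrightarrow> u x \<in> N"
          show "u x \<in> W \<longrightarrow> (x \<in> S \<longrightarrow> du x a \<in> tangent_space N (u x))"
          proof (intro impI)
            assume x: "u x \<in> W" "x \<in> S"
            then have ux: "u x \<in> U" "u x \<in> N" using WU 2 by auto
            then have "H (u x) = 0" using GN by (simp add: H_def)
            then have "frechet_derivative H (at (u x)) (du x a) = 0" using 1 x by blast
            moreover have "frechet_derivative H (at (u x)) = blinfun_apply (C (u x))"
              by (rule frechet_derivative_cong_open[OF W(1) x(1) _ G[OF ux(1)]]) (simp add: H_def W(3))
            ultimately show "du x a \<in> tangent_space N (u x)" using T[OF ux] by simp
          qed
        qed
        then show ?thesis using W(1,2) by blast
      qed
    qed
  qed
  then show ?thesis using uN by eventually_elim blast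
qed

lemma nabla_T_proj_eq_0:
  fixes N :: "(real^'d) set" and u :: "real^'m \<Rightarrow> real^'d"
  assumes N: "C2_submanifold n N" and "open S" and u: "has_weak_deriv S u du"
    and uN: "AE x\<in>S in lebesgue. u x \<in> N" and dE: "has_weak_deriv S (T_proj N u) dE"
  shows "AE x\<in>S in lebesgue. nabla_End (conn_form N u du) (T_proj N u) dE x a = 0"
proof -
  let ?P = "\<lambda>x. x \<in> S \<longrightarrow> nabla_End (conn_form N u du) (T_proj N u) dE x a = 0"
  have "AE x in lebesgue. u x \<in> N \<longrightarrow> ?P x"
  proof (rule AE_of_locally)
    fix p assume p: "p \<in> N"
    \<comment> \<open>A single point serves as the compact set, since an extension that is correct
      near \<open>p\<close> is all that is asked for.\<close>
    have "compact {p}" "{p} \<subseteq> N" using p by auto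
    then show "\<exists>W. open W \<and> p \<in> W \<and> (AE x in lebesgue. u x \<in> W \<longrightarrow>
        ?P x)"
    proof (rule projection_extension_compact[OF N])
      fix F W K'
      assume F: "C1_on UNIV F" "compact K'" "\<And>q. q \<notin> K' \<Longrightarrow> F q = 0" and W: "open W" "{p} \<subseteq> W"
        and FP: "\<And>q. q \<in> W \<Longrightarrow> q \<in> N \<Longrightarrow> F q = matrix (tangential N q)"
      have wd: "has_weak_deriv S (\<lambda>x. F (u x)) (\<lambda>x a. frechet_derivative F (at (u x)) (du x a))"
        by (rule has_weak_deriv_compose_compact_support[OF assms(2) u F])
      have "AE x in lebesgue. u x \<in> W \<longrightarrow> ?P x"
        using weak_deriv_eq_on_coincidence_set[OF assms(2) dE wd, of a] uN
          weak_deriv_tangent[OF N assms(2) u uN, of a]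
      proof eventually_elim
        fix x
        assume 1: "x \<in> S \<longrightarrow> T_proj N u x = F (u x) \<longrightarrow> dE x a = frechet_derivative F (at (u x)) (du x a)"
          and 2: "x \<in> S \<longrightarrow> u x \<in> N" and 3: "x \<in> S \<longrightarrow> du x a \<in> tangent_space N (u x)"
        show "u x \<in> W \<longrightarrow> ?P x"
        proof (intro impI)
          assume x: "u x \<in> W" "x \<in> S"
          have "T_proj N u x = F (u x)" using FP x 2 by (simp add: T_proj_def)
          then have "dE x a = frechet_derivative F (at (u x)) (du x a)" using 1 x by blast
          then show "nabla_End (conn_form N u du) (T_proj N u) dE x a = 0"
            using connection_projection_identity[OF N, of "u x" "du x a" W F] 2 3 x W(1)
              C1_on_subset[OF F(1)] FP
            by (simp add: nabla_End_def conn_form_def T_proj_def)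
        qed
      qed
      then show ?thesis using W by blast
    qed
  qed
  then show ?thesis using uN by eventually_elim blast
qed

section \<open>Weak differentiability of the projections\<close>

text \<open>A projection does not increase norms, so each of the d^2 entries is at most 1 in
  absolute value. What matters is a bound uniform over all subspaces.\<close>

lemma norm_matrix_orth_proj_le:
  fixes S :: "(real^'d) set"
  assumes "subspace S"
  shows "norm (matrix (orth_proj S)) \<le> real (CARD('d) * CARD('d))"
proof -
  have "norm (orth_proj S v) \<le> norm v" for v
  proof -
    have "orth_proj S v \<bullet> orth_proj S v = v \<bullet> orth_proj S v"
      using orth_proj_inner[OF assms, of v "orth_proj S v"] by (simp add: orth_proj_ident[OF assms orth_proj_in[OF assms]])
    then have "norm (orth_proj S v) * norm (orth_proj S v) = v \<bullet> orth_proj S v"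
      by (simp add: power2_eq_square[symmetric] power2_norm_eq_inner)
    also have "\<dots> \<le> norm v * norm (orth_proj S v)" by (rule norm_cauchy_schwarz)
    finally have "norm (orth_proj S v) * norm (orth_proj S v) \<le> norm v * norm (orth_proj S v)" .
    then show ?thesis by (cases "orth_proj S v = 0") auto
  qed
  then have entry: "\<bar>matrix (orth_proj S) $ i $ j\<bar> \<le> 1" for i j
    using order_trans[OF component_le_norm_cart, of "orth_proj S (axis j 1)" 1 i]
    by (metis (no_types) matrix_def norm_axis_1 vec_lambda_beta)
  have "norm (matrix (orth_proj S)) \<le> (\<Sum>i\<in>UNIV. norm (matrix (orth_proj S) $ i))"
    unfolding norm_vec_def by (rule L2_set_le_sum) simp
  also have "\<dots> \<le> (\<Sum>i\<in>UNIV. \<Sum>j\<in>UNIV. \<bar>matrix (orth_proj S) $ i $ j\<bar>)"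
    by (intro sum_mono norm_le_l1_cart)
  also have "\<dots> \<le> (\<Sum>i\<in>(UNIV::'d set). \<Sum>j\<in>(UNIV::'d set). 1)"
    by (intro sum_mono entry)
  finally show ?thesis by simp
qed

lemma norm_commutator_le:
  obtains c where "0 \<le> c" "\<And>W E :: real^'d^'d. norm (commutator W E) \<le> c * norm W * norm E"
proof -
  obtain k where k: "\<And>(A :: real^'d^'d) (B :: real^'d^'d). norm (A ** B) \<le> norm A * norm B * k" "0 \<le> k"
    using bounded_bilinear.nonneg_bounded[OF bounded_bilinear_matrix_mult] by blast
  show thesis
  proof (rule that[of "2 * k"])
    fix W E :: "real^'d^'d"
    have "norm (commutator W E) \<le> norm (W ** E) + norm (E ** W)"
      unfolding commutator_def by (rule norm_triangle_ineq4)
    also have "\<dots> \<le> norm W * norm E * k + norm E * norm W * k" by (intro add_mono k)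
    finally show "norm (commutator W E) \<le> 2 * k * norm W * norm E" by (simp add: mult_ac)
  qed (use k in simp)
qed

text \<open>
  Cutting off with \<open>\<theta> (y / k)\<close> in the target produces the error term
  \<open>D\<theta> (u / k) (du / k) T\<close>, which is dominated by the locally integrable \<open>|du|\<close> and tends to \<open>0\<close>.
\<close>

lemma has_weak_deriv_T_proj_of_integrable_connection:
  fixes N :: "(real^'d) set" and u :: "real^'m \<Rightarrow> real^'d"
  assumes N: "C2_submanifold n N" and "open S" and u: "has_weak_deriv S u du"
    and K: "closed K" "K \<subseteq> N" and uK: "AE x\<in>S in lebesgue. u x \<in> K"
    and \<omega>: "\<And>a. loc_integrable_on (\<lambda>x. conn_form N u du x a) S"
  shows "has_weak_deriv S (T_proj N u) (\<lambda>x a. - commutator (conn_form N u du x a) (T_proj N u x))"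
proof -
  have uN: "AE x\<in>S in lebesgue. u x \<in> N" using uK K(2) by (auto elim: eventually_mono)
  obtain \<theta> :: "real^'d \<Rightarrow> real" and W C where \<theta>: "C1_on UNIV \<theta>" "\<And>y. 0 \<le> \<theta> y" "\<And>y. \<theta> y \<le> 1"
    and W: "open W" "cball 0 1 \<subseteq> W" "\<And>y. y \<in> W \<Longrightarrow> \<theta> y = 1"
    and C: "compact C" "C \<subseteq> ball 0 2" "\<And>y. y \<notin> C \<Longrightarrow> \<theta> y = 0"
    by (rule C1_cutoff[of "cball (0::real^'d) 1" "ball 0 2"]) auto
  obtain L where L: "0 \<le> L" "\<And>x v. norm (frechet_derivative \<theta> (at x) v) \<le> L * norm v"
    "\<And>x v. x \<notin> C \<Longrightarrow> frechet_derivative \<theta> (at x) v = 0"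
    using C1_compact_support_bounded_derivative[OF \<theta>(1) C(1,3)] by blast
  have \<theta>'W: "frechet_derivative \<theta> (at y) v = 0" if "y \<in> W" for y v
  proof -
    have "frechet_derivative \<theta> (at y) = (\<lambda>v. 0)"
      by (rule frechet_derivative_cong_open[OF W(1) that]) (use W(3) in auto)
    then show ?thesis by simp
  qed
  define s where "s k = 1 / real (Suc k)" for k
  have s: "0 < s k" "s k \<le> 1" for k by (simp_all add: s_def)
  \<comment> \<open>The ball contains the support of the rescaled cutoff. As \<open>K\<close> is
    closed the intersection is compact, so an extension of the projection is available for each
    \<open>k\<close>.\<close>
  define Kk where "Kk k = K \<inter> cball 0 (2 / s k)" for k
  have "\<exists>F W K'. C1_on UNIV F \<and> open W \<and> Kk k \<subseteq> W \<and> compact K' \<and> (\<forall>q. q \<notin> K' \<longrightarrow> F q = 0) \<and>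
      (\<forall>q\<in>W. q \<in> N \<longrightarrow> F q = matrix (tangential N q))" for k
  proof -
    have "compact (Kk k)" "Kk k \<subseteq> N" using K by (auto simp: Kk_def intro: closed_Int_compact)
    then show ?thesis by (rule projection_extension_compact[OF N]) blast
  qed
  then obtain F Wk where F: "\<And>k. C1_on UNIV (F k)" and Wk: "\<And>k. open (Wk k)" "\<And>k. Kk k \<subseteq> Wk k"
    and FP: "\<And>k. \<forall>q\<in>Wk k. q \<in> N \<longrightarrow> F k q = matrix (tangential N q)"
    by metis
  define H where "H k y = \<theta> (s k *\<^sub>R y) *\<^sub>R F k y" for k y
  have \<theta>k: "C1_on UNIV (\<lambda>y. \<theta> (s k *\<^sub>R y))" for k
    by (rule C1_on_compose[OF C1_on_bounded_linear[OF bounded_linear_scaleR_right C1_on_id] \<theta>(1)]) simp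
  have \<theta>k': "((\<lambda>y. \<theta> (s k *\<^sub>R y)) has_derivative (\<lambda>v. frechet_derivative \<theta> (at (s k *\<^sub>R y)) (s k *\<^sub>R v))) (at y)" for k y
  proof -
    have "((\<lambda>y. s k *\<^sub>R y) has_derivative (\<lambda>v. s k *\<^sub>R v)) (at y)" by (auto intro!: derivative_eq_intros)
    then show ?thesis by (rule has_derivative_compose[OF _ C1_on_frechet(1)[OF \<theta>(1) UNIV_I]])
  qed
  have HC: "C1_on UNIV (H k)" for k
    unfolding H_def by (intro C1_on_scaleR \<theta>k F)
  have H': "frechet_derivative (H k) (at y) v = \<theta> (s k *\<^sub>R y) *\<^sub>R frechet_derivative (F k) (at y) v
      + frechet_derivative \<theta> (at (s k *\<^sub>R y)) (s k *\<^sub>R v) *\<^sub>R F k y" for k y v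
  proof -
    have "(H k has_derivative (\<lambda>v. \<theta> (s k *\<^sub>R y) *\<^sub>R frechet_derivative (F k) (at y) v
      + frechet_derivative \<theta> (at (s k *\<^sub>R y)) (s k *\<^sub>R v) *\<^sub>R F k y)) (at y)"
      unfolding H_def by (rule bounded_bilinear.FDERIV[OF bounded_bilinear_scaleR \<theta>k' C1_on_frechet(1)[OF F UNIV_I]])
    then have "(\<lambda>v. \<theta> (s k *\<^sub>R y) *\<^sub>R frechet_derivative (F k) (at y) v
      + frechet_derivative \<theta> (at (s k *\<^sub>R y)) (s k *\<^sub>R v) *\<^sub>R F k y) = frechet_derivative (H k) (at y)"
      by (rule frechet_derivative_at)
    from fun_cong[OF this[symmetric], of v] show ?thesis .
  qed
  have H0: "H k y = 0" if "y \<notin> cball 0 (2 / s k)" for k y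
  proof -
    have "2 < norm (s k *\<^sub>R y)" using that s[of k] by (simp add: not_le pos_divide_less_eq mult.commute)
    then have "s k *\<^sub>R y \<notin> C" using C(2) by force
    then show ?thesis by (simp add: H_def C(3))
  qed
  define E where "E = T_proj N u"
  define \<omega>E where "\<omega>E x a = - commutator (conn_form N u du x a) (E x)" for x a
  have wd: "has_weak_deriv S (\<lambda>x. H k (u x)) (\<lambda>x a. frechet_derivative (H k) (at (u x)) (du x a))" for k
    by (rule has_weak_deriv_compose_compact_support[OF assms(2) u HC compact_cball H0])
  define w where "w y X = (\<chi> i j. - (\<Sum>l\<in>UNIV. (A_coeff N y i j l - A_coeff N y j i l) * X $ l))" for y and X :: "real^'d"
  let ?H' = "\<lambda>k y X. \<theta> (s k *\<^sub>R y) *\<^sub>R (- commutator (w y X) (matrix (tangential N y)))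
      + frechet_derivative \<theta> (at (s k *\<^sub>R y)) (s k *\<^sub>R X) *\<^sub>R matrix (tangential N y)"
  \<comment> \<open>At points of \<open>K\<close> and in tangent directions, the extension
    \<open>F k\<close> disappears from both formulas in favour of the projection and the connection
    form. Hence no uniform control over the derivatives of the \<open>F k\<close> is
    required.\<close>
  have HE: "H k y = \<theta> (s k *\<^sub>R y) *\<^sub>R matrix (tangential N y)"
    and H'E: "X \<in> tangent_space N y \<Longrightarrow> frechet_derivative (H k) (at y) X = ?H' k y X"
    if y: "y \<in> K" for k y X
  proof -
    have yN: "y \<in> N" using y K(2) by blast
    have *: "H k y = \<theta> (s k *\<^sub>R y) *\<^sub>R matrix (tangential N y) \<and> (X \<in> tangent_space N y \<longrightarrow> frechet_derivative (H k) (at y) X = ?H' k y X)"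
    proof (cases "y \<in> cball 0 (2 / s k)")
      case True
      then have yW: "y \<in> Wk k" using y Wk(2)[of k] by (auto simp: Kk_def)
      have Fy: "F k y = matrix (tangential N y)" using FP yW yN by blast
      have "frechet_derivative (F k) (at y) X =
         - commutator (w y X) (matrix (tangential N y))"
        if "X \<in> tangent_space N y"
        using connection_projection_identity[OF N yN that Wk(1) yW C1_on_subset[OF F subset_UNIV]] FP
        by (simp add: w_def eq_neg_iff_add_eq_0)
      then show ?thesis by (simp add: H' H_def Fy)
    next
      case False
      have "2 < norm (s k *\<^sub>R y)" using False s[of k] by (simp add: not_le pos_divide_less_eq mult.commute)
      then have "s k *\<^sub>R y \<notin> C" using C(2) by force
      then show ?thesis by (simp add: H' H_def C(3) L(3))
    qed
    show "H k y = \<theta> (s k *\<^sub>R y) *\<^sub>R matrix (tangential N y)" using * by blast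
    show "X \<in> tangent_space N y \<Longrightarrow> frechet_derivative (H k) (at y) X = ?H' k y X"
      using * by blast
  qed
  let ?dH = "\<lambda>k x a. \<theta> (s k *\<^sub>R u x) *\<^sub>R \<omega>E x a
      + frechet_derivative \<theta> (at (s k *\<^sub>R u x)) (s k *\<^sub>R du x a) *\<^sub>R E x"
  have dH: "AE x\<in>S in lebesgue. u x \<in> K \<and> (\<forall>k. frechet_derivative (H k) (at (u x)) (du x a) = ?dH k x a)" for a
    using uK weak_deriv_tangent[OF N assms(2) u uN, of a]
  proof eventually_elim
    fix x assume "x \<in> S \<longrightarrow> u x \<in> K" "x \<in> S \<longrightarrow> du x a \<in> tangent_space N (u x)"
    then show "x \<in> S \<longrightarrow> u x \<in> K \<and> (\<forall>k. frechet_derivative (H k) (at (u x)) (du x a) = ?dH k x a)"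
      using H'E[of "u x" "du x a"] by (simp add: \<omega>E_def E_def T_proj_def conn_form_def w_def)
  qed
  \<comment> \<open>On \<open>W\<close> the cutoff is 1 and its derivative is 0. For almost every
    \<open>x\<close> the approximations and their derivatives are therefore eventually equal to
    their limits.\<close>
  have small: "\<forall>\<^sub>F k in sequentially. s k *\<^sub>R y \<in> W" for y
  proof -
    have "(\<lambda>k. s k *\<^sub>R y) \<longlonglongrightarrow> 0 *\<^sub>R y"
      unfolding s_def using LIMSEQ_inverse_real_of_nat by (intro tendsto_intros) (simp add: inverse_eq_divide)
    moreover have "0 *\<^sub>R y \<in> W" using W(2) by auto
    ultimately show ?thesis by (rule topological_tendstoD[OF _ W(1)])
  qed
  define M where "M = real (CARD('d) * CARD('d))"
  have M: "norm (matrix (tangential N y)) \<le> M" if "y \<in> N" for y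
    unfolding M_def tangential_def by (rule norm_matrix_orth_proj_le[OF tangent_space_subspace[OF N that]])
  have M0: "0 \<le> M" by (simp add: M_def)
  obtain c where c: "0 \<le> c" "\<And>W E :: real^'d^'d. norm (commutator W E) \<le> c * norm W * norm E"
    using norm_commutator_le by blast
  have ldu: "loc_integrable_on (\<lambda>x. du x a) S" for a using u by (auto simp: has_weak_deriv_def)
  \<comment> \<open>In the majorant, the first term bounds the commutator and the second the
    derivative of the cutoff, using \<open>s k \<le> 1\<close>; neither depends on
    \<open>k\<close>.\<close>
  have "has_weak_deriv S E \<omega>E"
  proof (rule has_weak_deriv_dominated_limit[OF wd, where b = "\<lambda>_. M"
      and c = "\<lambda>x a. c * M * norm (conn_form N u du x a) + L * M * norm (du x a)"])
    show "AE x\<in>S in lebesgue. (\<lambda>k. H k (u x)) \<longlonglongrightarrow> E x"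
      using uK
    proof eventually_elim
      fix x assume x: "x \<in> S \<longrightarrow> u x \<in> K"
      show "x \<in> S \<longrightarrow> (\<lambda>k. H k (u x)) \<longlonglongrightarrow> E x"
      proof
        assume "x \<in> S"
        then have "\<forall>\<^sub>F k in sequentially. H k (u x) = E x"
          using small[of "u x"] by (auto elim!: eventually_mono simp: HE x W(3) E_def T_proj_def)
        then show "(\<lambda>k. H k (u x)) \<longlonglongrightarrow> E x" by (rule tendsto_eventually)
      qed
    qed
    show "AE x\<in>S in lebesgue. (\<lambda>k. frechet_derivative (H k) (at (u x)) (du x a)) \<longlonglongrightarrow> \<omega>E x a" for a
      using dH[of a]
    proof eventually_elim
      fix x assume x: "x \<in> S \<longrightarrow> u x \<in> K \<and> (\<forall>k. frechet_derivative (H k) (at (u x)) (du x a) = ?dH k x a)"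
      show "x \<in> S \<longrightarrow> (\<lambda>k. frechet_derivative (H k) (at (u x)) (du x a)) \<longlonglongrightarrow> \<omega>E x a"
      proof
        assume "x \<in> S"
        then have "\<forall>\<^sub>F k in sequentially. frechet_derivative (H k) (at (u x)) (du x a) = \<omega>E x a"
          using small[of "u x"] x by (auto elim!: eventually_mono simp: W(3) \<theta>'W)
        then show "(\<lambda>k. frechet_derivative (H k) (at (u x)) (du x a)) \<longlonglongrightarrow> \<omega>E x a" by (rule tendsto_eventually)
      qed
    qed
    show "loc_integrable_on (\<lambda>x. M) S"
      by (auto simp: loc_integrable_on_def intro: absolutely_integrable_on_const lmeasurable_compact)
    show "AE x\<in>S in lebesgue. norm (H k (u x)) \<le> M" for k
      using uK
    proof eventually_elim
      fix x assume x: "x \<in> S \<longrightarrow> u x \<in> K"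
      show "x \<in> S \<longrightarrow> norm (H k (u x)) \<le> M"
      proof
        assume "x \<in> S"
        then have "u x \<in> K" "u x \<in> N" using x K(2) by auto
        then have "norm (H k (u x)) \<le> 1 * M"
          unfolding HE[OF \<open>u x \<in> K\<close>] norm_scaleR using \<theta>(2,3)[of "s k *\<^sub>R u x"] M by (intro mult_mono) auto
        then show "norm (H k (u x)) \<le> M" by simp
      qed
    qed
    show "loc_integrable_on (\<lambda>x. c * M * norm (conn_form N u du x a) + L * M * norm (du x a)) S" for a
      using \<omega>[of a] ldu[of a] unfolding loc_integrable_on_def
      by (auto intro!: set_integral_add(1) set_integrable_mult_right set_integrable_norm)
    show "AE x\<in>S in lebesgue. norm (frechet_derivative (H k) (at (u x)) (du x a))
        \<le> c * M * norm (conn_form N u du x a) + L * M * norm (du x a)" for k a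
      using dH[of a]
    proof eventually_elim
      fix x assume x: "x \<in> S \<longrightarrow> u x \<in> K \<and> (\<forall>k. frechet_derivative (H k) (at (u x)) (du x a) = ?dH k x a)"
      show "x \<in> S \<longrightarrow> norm (frechet_derivative (H k) (at (u x)) (du x a))
        \<le> c * M * norm (conn_form N u du x a) + L * M * norm (du x a)"
      proof
        assume xS: "x \<in> S"
        then have "u x \<in> N" using x K(2) by auto
        then have E: "norm (E x) \<le> M" using M by (simp add: E_def T_proj_def)
        have "norm (\<omega>E x a) \<le> c * norm (conn_form N u du x a) * norm (E x)"
          using c(2) by (simp add: \<omega>E_def)
        also have "\<dots> \<le> c * norm (conn_form N u du x a) * M"
          using E c(1) by (intro mult_left_mono) auto
        finally have 1: "norm (\<theta> (s k *\<^sub>R u x) *\<^sub>R \<omega>E x a) \<le> 1 * (c * norm (conn_form N u du x a) * M)"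
          unfolding norm_scaleR using \<theta>(2,3)[of "s k *\<^sub>R u x"] by (intro mult_mono) auto
        have "norm (frechet_derivative \<theta> (at (s k *\<^sub>R u x)) (s k *\<^sub>R du x a)) \<le> L * norm (s k *\<^sub>R du x a)"
          by (rule L(2))
        also have "\<dots> \<le> L * (1 * norm (du x a))"
          unfolding norm_scaleR using s[of k] L(1) by (intro mult_left_mono mult_right_mono) auto
        finally have 2: "norm (frechet_derivative \<theta> (at (s k *\<^sub>R u x)) (s k *\<^sub>R du x a) *\<^sub>R E x) \<le> L * (1 * norm (du x a)) * M"
          unfolding norm_scaleR using E L(1) by (intro mult_mono) auto
        show "norm (frechet_derivative (H k) (at (u x)) (du x a))
          \<le> c * M * norm (conn_form N u du x a) + L * M * norm (du x a)"
          using norm_triangle_mono[OF 1 2] x xS by (simp add: mult_ac)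
      qed
    qed
  qed
  then show ?thesis by (simp add: E_def \<omega>E_def[abs_def])
qed

text \<open>One compactly supported extension that is correct near \<open>K\<close> represents the
  projection along \<open>u\<close> almost everywhere, so the chain rule applies directly.\<close>

lemma has_weak_deriv_T_proj_of_compact:
  fixes N :: "(real^'d) set" and u :: "real^'m \<Rightarrow> real^'d"
  assumes N: "C2_submanifold n N" and "open S" and u: "has_weak_deriv S u du"
    and K: "compact K" "K \<subseteq> N" and uK: "AE x\<in>S in lebesgue. u x \<in> K"
  obtains dE where "has_weak_deriv S (T_proj N u) dE"
proof (rule projection_extension_compact[OF N K])
  fix F W K'
  assume F: "C1_on UNIV F" "compact K'" "\<And>q. q \<notin> K' \<Longrightarrow> F q = 0" and W: "open W" "K \<subseteq> W"
    and FP: "\<And>q. q \<in> W \<Longrightarrow> q \<in> N \<Longrightarrow> F q = matrix (tangential N q)"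
  have "AE x\<in>S in lebesgue. F (u x) = T_proj N u x"
    using uK
  proof eventually_elim
    fix x assume "x \<in> S \<longrightarrow> u x \<in> K"
    then show "x \<in> S \<longrightarrow> F (u x) = T_proj N u x" using FP[of "u x"] K(2) W(2) by (auto simp: T_proj_def)
  qed
  then show thesis
    using that has_weak_deriv_cong_AE[OF has_weak_deriv_compose_compact_support[OF assms(2) u F]] by blast
qed

lemma V_proj_eq:
  assumes "C2_submanifold n N" "u x \<in> N"
  shows "V_proj N u x = mat 1 - T_proj N u x"
proof -
  have "normal_part N (u x) v = (mat 1 - T_proj N u x) *v v" for v
    using matrix_orth_proj(1)[OF tangent_space_subspace[OF assms], of v]
    by (simp add: normal_part_eq[OF assms] T_proj_def tangential_def matrix_vector_mult_diff_rdistrib)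
  then show ?thesis unfolding V_proj_def by (metis matrix_of_matrix_vector_mul ext)
qed

text \<open>Multiples of the identity matrix commute with everything; this carries the result from T
  to V and R.\<close>

lemma commutator_affine: "commutator W (c *\<^sub>R E + b *\<^sub>R mat 1) = c *\<^sub>R commutator W E"
  by (simp add: commutator_def bounded_bilinear.add_left[OF bounded_bilinear_matrix_mult]
      bounded_bilinear.add_right[OF bounded_bilinear_matrix_mult]
      bounded_bilinear.scaleR_left[OF bounded_bilinear_matrix_mult]
      bounded_bilinear.scaleR_right[OF bounded_bilinear_matrix_mult] scaleR_diff_right)

text \<open>Weak derivatives are determined only up to null sets. Accordingly \<open>du\<close> is
  an arbitrary weak derivative of \<open>u\<close>, and the identity is asserted almost everywhere
  for each weak derivative \<open>dE\<close>.\<close>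

theorem lemma2p5:
  fixes N :: "(real ^ 'd) set"
    and n :: nat
    and u :: "real ^ 'm \<Rightarrow> real ^ 'd"
    and du :: "('m, real ^ 'd) oneform"
    and \<omega> :: "('m, real ^ 'd ^ 'd) oneform"
  assumes "C2_submanifold n N"
    and "u \<in> W12_into (ball 0 1) N"
    and "has_weak_deriv (ball 0 1) u du"
    and "\<omega> = conn_form N u du"
  shows "\<forall>E \<in> {T_proj N u, V_proj N u, R_refl N u}.
           ((\<exists>K. closed K \<and> K \<subseteq> N \<and> (AE x\<in>ball 0 1 in lebesgue. u x \<in> K) \<and>
                 (compact K \<or> (\<forall>a. loc_integrable_on (\<lambda>x. \<omega> x a) (ball 0 1))))
              \<longrightarrow> weakly_differentiable_on E (ball 0 1)) \<and>
           (\<forall>dE. has_weak_deriv (ball 0 1) E dE \<longrightarrow>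
              (\<forall>a. AE x\<in>ball 0 1 in lebesgue. nabla_End \<omega> E dE x a = 0))"
proof
  fix E assume "E \<in> {T_proj N u, V_proj N u, R_refl N u}"
  let ?S = "ball 0 1 :: (real^'m) set"
  have uN: "AE x\<in>?S in lebesgue. u x \<in> N" using assms(2) by (simp add: W12_into_def)
  have V: "AE x\<in>?S in lebesgue. V_proj N u x = mat 1 - T_proj N u x"
    using uN by eventually_elim (use V_proj_eq[OF assms(1)] in blast)
  \<comment> \<open>T, V = 1 - T and R = 2 T - 1 are all affine in T. A nonzero \<open>c\<close>
    also allows the way back from a given weak derivative of \<open>E\<close> to one of T.\<close>
  have "\<exists>c b. c \<noteq> 0 \<and> (AE x\<in>?S in lebesgue. E x = c *\<^sub>R T_proj N u x + b *\<^sub>R mat 1)"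
  proof -
    consider "E = T_proj N u" | "E = V_proj N u" | "E = R_refl N u"
      using \<open>E \<in> _\<close> by blast
    then show ?thesis
    proof cases
      case 1
      then show ?thesis by (intro exI[of _ 1] exI[of _ 0]) simp
    next
      case 2
      have "AE x\<in>?S in lebesgue. E x = (-1) *\<^sub>R T_proj N u x + 1 *\<^sub>R mat 1"
        using V by eventually_elim (simp add: 2)
      then show ?thesis by (intro exI[of _ "-1"] exI[of _ 1]) simp
    next
      case 3
      have "AE x\<in>?S in lebesgue. E x = 2 *\<^sub>R T_proj N u x + (-1) *\<^sub>R mat 1"
        using V by eventually_elim (simp add: 3 R_refl_def scaleR_2)
      then show ?thesis by (intro exI[of _ 2] exI[of _ "-1"]) simp
    qed
  qed
  then obtain c b where c: "c \<noteq> 0" and E: "AE x\<in>?S in lebesgue. E x = c *\<^sub>R T_proj N u x + b *\<^sub>R mat 1"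
    by blast
  have ET: "AE x\<in>?S in lebesgue. c *\<^sub>R T_proj N u x + b *\<^sub>R mat 1 = E x"
    "AE x\<in>?S in lebesgue. (1 / c) *\<^sub>R E x + (- b / c) *\<^sub>R mat 1 = T_proj N u x"
    using E by (eventually_elim, use c in \<open>simp add: scaleR_add_right\<close>)+
  show "((\<exists>K. closed K \<and> K \<subseteq> N \<and> (AE x\<in>?S in lebesgue. u x \<in> K) \<and>
        (compact K \<or> (\<forall>a. loc_integrable_on (\<lambda>x. \<omega> x a) ?S))) \<longrightarrow> weakly_differentiable_on E ?S) \<and>
      (\<forall>dE. has_weak_deriv ?S E dE \<longrightarrow> (\<forall>a. AE x\<in>?S in lebesgue. nabla_End \<omega> E dE x a = 0))"
  proof (intro conjI impI allI)
    assume "\<exists>K. closed K \<and> K \<subseteq> N \<and> (AE x\<in>?S in lebesgue. u x \<in> K) \<and>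
        (compact K \<or> (\<forall>a. loc_integrable_on (\<lambda>x. \<omega> x a) ?S))"
    then obtain K where K: "closed K" "K \<subseteq> N" "AE x\<in>?S in lebesgue. u x \<in> K"
      "compact K \<or> (\<forall>a. loc_integrable_on (\<lambda>x. \<omega> x a) ?S)" by blast
    obtain dT where "has_weak_deriv ?S (T_proj N u) dT"
      using K(4)
    proof
      assume "compact K"
      then show thesis by (rule has_weak_deriv_T_proj_of_compact[OF assms(1) open_ball assms(3) _ K(2,3) that])
    next
      assume "\<forall>a. loc_integrable_on (\<lambda>x. \<omega> x a) ?S"
      then have "\<And>a. loc_integrable_on (\<lambda>x. conn_form N u du x a) ?S" by (simp add: assms(4))
      from that[OF has_weak_deriv_T_proj_of_integrable_connection[OF assms(1) open_ball assms(3) K(1-3) this]]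
      show thesis .
    qed
    from has_weak_deriv_cong_AE[OF has_weak_deriv_affine[OF open_ball this] ET(1)]
    show "weakly_differentiable_on E ?S" unfolding weakly_differentiable_on_def by blast
  next
    fix dE a assume dE: "has_weak_deriv ?S E dE"
    \<comment> \<open>Inverting the affine relation makes \<open>dE\<close> divided by
      \<open>c\<close> a weak derivative of T, to which the identity for T applies.\<close>
    have "has_weak_deriv ?S (T_proj N u) (\<lambda>x a. (1 / c) *\<^sub>R dE x a)"
      by (rule has_weak_deriv_cong_AE[OF has_weak_deriv_affine[OF open_ball dE] ET(2)])
    from nabla_T_proj_eq_0[OF assms(1) open_ball assms(3) uN this, of a] E
    show "AE x\<in>?S in lebesgue. nabla_End \<omega> E dE x a = 0"
    proof eventually_elim
      fix x
      assume 1: "x \<in> ?S \<longrightarrow> nabla_End (conn_form N u du) (T_proj N u) (\<lambda>x a. (1 / c) *\<^sub>R dE x a) x a = 0"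
        and 2: "x \<in> ?S \<longrightarrow> E x = c *\<^sub>R T_proj N u x + b *\<^sub>R mat 1"
      show "x \<in> ?S \<longrightarrow> nabla_End \<omega> E dE x a = 0"
      proof
        assume x: "x \<in> ?S"
        then have "c *\<^sub>R ((1 / c) *\<^sub>R dE x a + commutator (\<omega> x a) (T_proj N u x)) = 0"
          using 1 by (simp add: nabla_End_def assms(4))
        then have "dE x a + c *\<^sub>R commutator (\<omega> x a) (T_proj N u x) = 0"
          using c by (simp add: scaleR_add_right)
        then show "nabla_End \<omega> E dE x a = 0"
          using 2 x by (simp add: nabla_End_def commutator_affine)
      qed
    qed
  qed
qed

end
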